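(* Let $d\ge 1$, let $p>1$, and let $0\le a\in L_{p,w}(\mathbb{R}^d)$ and $0\le b\in L_p(\mathbb{R}^d)$. Then for all $\mu>0$ $$ \operatorname{Tr}\left( a(-i\nabla)^{1/2}\, b(X)\, a(-i\nabla)^{1/2} - \mu\right)_+ \;\le\; \mu^{-p+1}\ \frac{(p+1)^{p-1}}{(p-1)^p}\ (2\pi)^{-d}\ \| a\|_{p,w}^{p}\, \| b\|_p^p . $$
   Context: All operators act in $L_2(\mathbb{R}^d)$. For a measurable function $b$ on $\mathbb{R}^d$, $b(X)$ denotes multiplication by $b$ in position space; for a measurable function $a$ on $\mathbb{R}^d$, $a(-i\nabla)$ denotes multiplication by $a$ in momentum space, i.e. $a(-i\nabla)=\mathcal F^{-1} a \mathcal F$ with the unitary Fourier transform $(\mathcal F u)(p)=(2\pi)^{-d/2}\int_{\mathbb{R}^d} e^{-ip\cdot x}u(x)\,dx$. The operator $a(-i\nabla)^{1/2} b(X) a(-i\nabla)^{1/2}$ is understood as $K^*K$ with $K=b(X)^{1/2}a(-i\nabla)^{1/2}$ (quadratic form sense). $L_{p,w}(\mathbb{R}^d)$ is the space of functions $a$ on $\mathbb{R}^d$ for which the quasi-norm given by $\|a\|_{p,w}^p=\sup_{\tau>0}\tau^p\,|\{|a|>\tau\}|$ is finite, where $|\cdot|$ is Lebesgue measure. $\|b\|_p$ is the usual $L_p(\mathbb{R}^d)$ norm. For a self-adjoint operator $H$, $H_+$ is its positive part, defined by functional calculus with $E_+=\max\{E,0\}$. *)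

theory Defs
  imports "HOL-Analysis.Analysis"
begin

section \<open>The Hilbert space of square-integrable functions\<close>

text \<open>Elements of $L_2$ are handled through representatives; all notions below are invariant
  under changing functions on Lebesgue null sets.\<close>

type_synonym 'n wave = "real ^ 'n \<Rightarrow> complex"

definition ae_eq :: "'n::finite wave \<Rightarrow> 'n wave \<Rightarrow> bool" where
  "ae_eq u v \<longleftrightarrow> (AE x in lebesgue. u x = v x)"

definition L2 :: "'n::finite wave set" where
  "L2 = {u. u \<in> borel_measurable lebesgue \<and> integrable lebesgue (\<lambda>x. (cmod (u x))\<^sup>2)}"

definition l2_inner :: "'n::finite wave \<Rightarrow> 'n wave \<Rightarrow> complex" where
  "l2_inner u v = (LINT x|lebesgue. cnj (u x) * v x)"

definition l2_norm :: "'n::finite wave \<Rightarrow> real" where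
  "l2_norm u = sqrt (LINT x|lebesgue. (cmod (u x))\<^sup>2)"

definition L2_tendsto :: "(nat \<Rightarrow> 'n::finite wave) \<Rightarrow> 'n wave \<Rightarrow> bool" where
  "L2_tendsto f u \<longleftrightarrow>
     (\<forall>n. f n \<in> L2) \<and> u \<in> L2 \<and> (\<lambda>n. l2_norm (\<lambda>x. f n x - u x)) \<longlonglongrightarrow> 0"

definition orthonormal_basis :: "(nat \<Rightarrow> 'n::finite wave) \<Rightarrow> bool" where
  "orthonormal_basis e \<longleftrightarrow>
     (\<forall>n. e n \<in> L2) \<and>
     (\<forall>m n. l2_inner (e m) (e n) = (if m = n then 1 else 0)) \<and>
     (\<forall>u\<in>L2. (\<forall>n. l2_inner (e n) u = 0) \<longrightarrow> ae_eq u (\<lambda>x. 0))"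


section \<open>Possibly unbounded operators\<close>

text \<open>A possibly unbounded operator is given by its graph, so its domain is \<^const>\<open>Domain\<close>
  of the graph.  The product $ST$ of operators is the relation \<open>T O S\<close>, on the natural domain.\<close>

type_synonym 'n operator = "('n wave \<times> 'n wave) set"

definition op_closure :: "'n::finite operator \<Rightarrow> 'n operator" where
  "op_closure T = {(u, v). \<exists>f g. (\<forall>n. (f n, g n) \<in> T) \<and> L2_tendsto f u \<and> L2_tendsto g v}"

definition op_adjoint :: "'n::finite operator \<Rightarrow> 'n operator" where
  "op_adjoint T =
     {(v, w). v \<in> L2 \<and> w \<in> L2 \<and> (\<forall>(u, y)\<in>T. l2_inner v y = l2_inner w u)}"

definition op_minus_scalar :: "'n::finite operator \<Rightarrow> real \<Rightarrow> 'n operator" where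
  "op_minus_scalar T c = {(u, \<lambda>x. w x - complex_of_real c * u x) | u w. (u, w) \<in> T}"

text \<open>The operator of the quadratic form $u \mapsto \|Ku\|^2$: the form is first closed, that is,
  $K$ is replaced by its closure.  For a closed $K$ this is literally $K^*K$.  The closure matters,
  since for an unbounded symbol $a$ the operator $b(X)^{1/2} a(-i\nabla)^{1/2}$ on its natural
  domain is closable but not closed.\<close>

definition form_operator :: "'n::finite operator \<Rightarrow> 'n operator" where
  "form_operator K = op_closure K O op_adjoint (op_closure K)"


section \<open>Multiplication in position and in momentum space\<close>

definition fourier_integral :: "'n::finite wave \<Rightarrow> 'n wave" where
  "fourier_integral u \<xi> =
     complex_of_real ((2 * pi) powr (- real CARD('n) / 2)) *
     (LINT x|lebesgue. exp (- \<i> * complex_of_real (\<xi> \<bullet> x)) * u x)"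

text \<open>The unitary Fourier transform on $L_2$ is the continuous extension of the Fourier integral
  from $L_1 \cap L_2$.\<close>

definition fourier_op :: "'n::finite operator" where
  "fourier_op =
     {(u, v). \<exists>f. (\<forall>n. integrable lebesgue (f n)) \<and> L2_tendsto f u \<and>
                  L2_tendsto (\<lambda>n. fourier_integral (f n)) v}"

definition position_op :: "(real ^ 'n \<Rightarrow> real) \<Rightarrow> 'n::finite operator" where
  "position_op m =
     {(u, v). u \<in> L2 \<and> v \<in> L2 \<and> (AE x in lebesgue. v x = complex_of_real (m x) * u x)}"

definition momentum_op :: "(real ^ 'n \<Rightarrow> real) \<Rightarrow> 'n::finite operator" where
  "momentum_op m = fourier_op O position_op m O fourier_op\<inverse>"

definition cwikel_K :: "(real ^ 'n \<Rightarrow> real) \<Rightarrow> (real ^ 'n \<Rightarrow> real) \<Rightarrow> 'n::finite operator" where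
  "cwikel_K a b = momentum_op (\<lambda>\<xi>. sqrt (a \<xi>)) O position_op (\<lambda>x. sqrt (b x))"


section \<open>Functional calculus for self-adjoint operators\<close>

text \<open>An everywhere defined symmetric map is automatically linear (almost everywhere).\<close>

definition orth_projection :: "('n::finite wave \<Rightarrow> 'n wave) \<Rightarrow> bool" where
  "orth_projection P \<longleftrightarrow>
     (\<forall>u\<in>L2. P u \<in> L2) \<and>
     (\<forall>u\<in>L2. \<forall>v\<in>L2. l2_inner (P u) v = l2_inner u (P v)) \<and>
     (\<forall>u\<in>L2. ae_eq (P (P u)) (P u))"

definition projection_valued_measure :: "(real set \<Rightarrow> 'n::finite wave \<Rightarrow> 'n wave) \<Rightarrow> bool" where
  "projection_valued_measure E \<longleftrightarrow>
     (\<forall>B\<in>sets borel. orth_projection (E B)) \<and>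
     (\<forall>u\<in>L2. ae_eq (E {} u) (\<lambda>x. 0)) \<and>
     (\<forall>u\<in>L2. ae_eq (E UNIV u) u) \<and>
     (\<forall>A\<in>sets borel. \<forall>B\<in>sets borel. \<forall>u\<in>L2. ae_eq (E (A \<inter> B) u) (E A (E B u))) \<and>
     (\<forall>A. range A \<subseteq> sets borel \<and> disjoint_family A \<longrightarrow>
        (\<forall>u\<in>L2. L2_tendsto (\<lambda>N x. \<Sum>n<N. E (A n) u x) (E (\<Union>n. A n) u)))"

definition scalar_measure ::
    "(real set \<Rightarrow> 'n::finite wave \<Rightarrow> 'n wave) \<Rightarrow> 'n wave \<Rightarrow> real measure" where
  "scalar_measure E u = measure_of UNIV (sets borel) (\<lambda>B. ennreal (Re (l2_inner u (E B u))))"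

definition spectral_domain ::
    "(real set \<Rightarrow> 'n::finite wave \<Rightarrow> 'n wave) \<Rightarrow> (real \<Rightarrow> real) \<Rightarrow> 'n wave set" where
  "spectral_domain E f = {u \<in> L2. integrable (scalar_measure E u) (\<lambda>t. (f t)\<^sup>2)}"

text \<open>The operator $\int f\,dE$: its domain consists of the $u$ with
  $\int |f|^2\,d\langle u, Eu\rangle < \infty$, and
  $\langle v, (\int f\,dE) u\rangle = \int f\,d\langle v, Eu\rangle$.  The complex measure
  $\langle v, Eu\rangle$ is written out by the polarization identity
  $4\langle v, Eu\rangle = \sum_{k<4} i^k \langle u + i^k v, E(u + i^k v)\rangle$.\<close>

definition spectral_integral ::
    "(real set \<Rightarrow> 'n::finite wave \<Rightarrow> 'n wave) \<Rightarrow> (real \<Rightarrow> real) \<Rightarrow> 'n operator" where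
  "spectral_integral E f =
     {(u, w). u \<in> spectral_domain E f \<and> w \<in> L2 \<and>
        (\<forall>v\<in>spectral_domain E f.
           4 * l2_inner v w =
             (\<Sum>k<4. \<i> ^ k *
                complex_of_real (LINT t|scalar_measure E (\<lambda>x. u x + \<i> ^ k * v x). f t)))}"

text \<open>By the spectral theorem such an $E$ exists for every self-adjoint $H$, and it is unique up to
  the choice of representatives.\<close>

definition spectral_measure :: "'n::finite operator \<Rightarrow> real set \<Rightarrow> 'n wave \<Rightarrow> 'n wave" where
  "spectral_measure H =
     (SOME E. projection_valued_measure E \<and> H = spectral_integral E (\<lambda>t. t))"

definition fun_calculus :: "(real \<Rightarrow> real) \<Rightarrow> 'n::finite operator \<Rightarrow> 'n operator" where
  "fun_calculus f H = spectral_integral (spectral_measure H) f"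

definition positive_part :: "'n::finite operator \<Rightarrow> 'n operator" where
  "positive_part H = fun_calculus (\<lambda>t. max t 0) H"


section \<open>The trace of a nonnegative operator\<close>

text \<open>Meaningful for nonnegative self-adjoint $T$ only, where the sum does not depend on the basis
  if $T$ is bounded.  The supremum over the bases avoids singling one out, and it yields the value
  infinity for unbounded $T$, whose domain fails to contain some basis.\<close>

definition op_apply :: "'n::finite operator \<Rightarrow> 'n wave \<Rightarrow> 'n wave" where
  "op_apply T u = (SOME w. (u, w) \<in> T)"

definition op_trace :: "'n::finite operator \<Rightarrow> ennreal" where
  "op_trace T =
     (SUP e \<in> {e. orthonormal_basis e}.
        if range e \<subseteq> Domain T
        then (\<Sum>n. ennreal (Re (l2_inner (e n) (op_apply T (e n)))))
        else \<infinity>)"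


section \<open>Lebesgue and weak Lebesgue spaces\<close>

definition Lp :: "real \<Rightarrow> (real ^ 'n::finite \<Rightarrow> real) set" where
  "Lp p = {b. b \<in> borel_measurable lebesgue \<and> integrable lebesgue (\<lambda>x. \<bar>b x\<bar> powr p)}"

definition Lp_norm :: "real \<Rightarrow> (real ^ 'n::finite \<Rightarrow> real) \<Rightarrow> real" where
  "Lp_norm p b = (LINT x|lebesgue. \<bar>b x\<bar> powr p) powr (1 / p)"

definition weak_sup :: "real \<Rightarrow> (real ^ 'n::finite \<Rightarrow> real) \<Rightarrow> ennreal" where
  "weak_sup p a = (SUP \<tau> \<in> {0<..}. ennreal (\<tau> powr p) * emeasure lebesgue {x. \<bar>a x\<bar> > \<tau>})"

definition weak_Lp :: "real \<Rightarrow> (real ^ 'n::finite \<Rightarrow> real) set" where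
  "weak_Lp p = {a. a \<in> borel_measurable lebesgue \<and> weak_sup p a < \<infinity>}"

definition weak_Lp_norm :: "real \<Rightarrow> (real ^ 'n::finite \<Rightarrow> real) \<Rightarrow> real" where
  "weak_Lp_norm p a = enn2real (weak_sup p a) powr (1 / p)"

end

(*
  The bound is Rumin's method for Cwikel-type estimates.  For an operator 0 <= gamma <= 1 one writes
  its trace as an integral over a of the level sets {a E <= 1}, via 1 / a = |{E >= 0. a E <= 1}|,
  and splits each a(-i nabla)^(1/2) f into its low part, on {a E <= 1}, and its high part.  Bessel's
  inequality bounds the density of the high part pointwise by the integral of a over {a E > 1},
  which the weak norm controls by a multiple of E^(p-1).  Weighting the two parts by
  theta = 1 - (E / T)^((p-1)/2) with T proportional to b(x) and integrating over E and x yields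
  Tr(K gamma K^* ) <= mu Tr gamma + C for every such gamma, with the stated constant C.

  Taking gamma to be a spectral projection of K^* K - mu proves the theorem.  The same inequality,
  with mu small, shows that K is bounded and that the spectral subspaces of K^* K away from 0 have
  finite dimension; so K^* K is diagonalizable and its spectral measure is a sum of
  eigenprojections.  No spectral theorem beyond this discrete case is needed.
*)
theory Submission
  imports Defs "HOL-Probability.Probability"
begin

section \<open>Orthogonal projections and adjoints in real Hilbert spaces\<close>

text \<open>Three obstacles shape the proof. \<open>spectral_measure\<close> is an arbitrary choice,
  so a projection valued measure has to be exhibited before anything is known about the chosen one;
  and until then the spectrum of K^* K can only be probed by finite families of vectors. The
  inequality is therefore stated for \<open>Bessel\<close> families, that is, for gamma = sum_j
  |psi_j><psi_j| with gamma <= 1. Secondly, for unbounded \<open>a\<close> the Fourier integral of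
  sqrt(a) f need not converge, while Bessel's inequality is used at single points x. So everything
  is first restricted to the sets \<open>Om n\<close>, with bounds that do not depend on n. Thirdly,
  the form of theta: let rho be the density of the family at x. By the triangle inequality the
  density of its low part is at least (sqrt rho - sqrt(C1 E^(p-1)))_+^2. This is convex in rho, and
  its tangent at rho = C1 T^(p-1) has the slope theta = 1 - (E/T)^((p-1)/2) for E <= T. Integrated
  over E, the slope is T (p-1)/(p+1); T is chosen to make it b(x)/mu.\<close>

lemma power2_norm_parallelogram:
  fixes x y z :: "'a::real_inner"
  shows "(norm (y - z))\<^sup>2 = 2 * (norm (x - y))\<^sup>2 + 2 * (norm (x - z))\<^sup>2
           - 4 * (norm (x - (1/2) *\<^sub>R (y + z)))\<^sup>2"
  unfolding power2_norm_eq_inner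
  by (simp add: inner_diff_left inner_diff_right inner_add_left inner_add_right inner_commute algebra_simps)

text \<open>The witness is the nearest point of \<open>S\<close>. A minimizing sequence is Cauchy by
  the parallelogram identity, because midpoints stay in \<open>S\<close> and cannot beat the infimum
  \<open>D\<close>; if the residual were not orthogonal to \<open>S\<close>, a move along
  \<open>z\<close> would come closer.\<close>

lemma orthogonal_decomposition_exists:
  fixes S :: "'a::{real_inner, complete_space} set"
  assumes S: "subspace S" "closed S"
  shows "\<exists>y\<in>S. \<forall>z\<in>S. inner (x - y) z = 0"
proof -
  define D where "D = Inf ((\<lambda>y. (norm (x - y))\<^sup>2) ` S)"
  have ne: "S \<noteq> {}" using S(1) subspace_0 by blast
  have bdd: "bdd_below ((\<lambda>y. (norm (x - y))\<^sup>2) ` S)"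
    by (rule bdd_belowI[of _ 0]) auto
  have D_le: "D \<le> (norm (x - y))\<^sup>2" if "y \<in> S" for y
    unfolding D_def using bdd that by (intro cInf_lower) auto
  have "\<exists>y\<in>S. (norm (x - y))\<^sup>2 < D + 1 / (real n + 1)" for n
  proof -
    have "D < D + 1 / (real n + 1)" by simp
    then obtain a where "a \<in> (\<lambda>y. (norm (x - y))\<^sup>2) ` S" "a < D + 1 / (real n + 1)"
      unfolding D_def using ne bdd cInf_less_iff[of "(\<lambda>y. (norm (x - y))\<^sup>2) ` S"]
      by (metis image_is_empty)
    then show ?thesis by auto
  qed
  then obtain y where y: "\<And>n. y n \<in> S" "\<And>n. (norm (x - y n))\<^sup>2 < D + 1 / (real n + 1)"
    by metis
  have dist: "(norm (y m - y n))\<^sup>2 \<le> 2 / (real m + 1) + 2 / (real n + 1)" for m n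
  proof -
    have "(1/2) *\<^sub>R (y m + y n) \<in> S"
      using S(1) y(1) by (intro subspace_scale subspace_add)
    then have "D \<le> (norm (x - (1/2) *\<^sub>R (y m + y n)))\<^sup>2" by (rule D_le)
    then show ?thesis
      using y(2)[of m] y(2)[of n] power2_norm_parallelogram[of "y m" "y n" x] by simp
  qed
  have "Cauchy y"
  proof (rule metric_CauchyI)
    fix e :: real assume e: "e > 0"
    obtain N where N: "4 / e\<^sup>2 < real N" using reals_Archimedean2 by blast
    show "\<exists>M. \<forall>m\<ge>M. \<forall>n\<ge>M. dist (y m) (y n) < e"
    proof (intro exI allI impI)
      fix m n assume mn: "N \<le> m" "N \<le> n"
      have N0: "0 < real N" using N e by (smt (verit) divide_pos_pos zero_less_power)
      have "2 / (real m + 1) < 2 / real N" "2 / (real n + 1) < 2 / real N"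
        using mn N0 by (auto intro!: divide_strict_left_mono)
      moreover have "4 / real N < e\<^sup>2" using N N0 e by (simp add: field_simps)
      ultimately have "(norm (y m - y n))\<^sup>2 < e\<^sup>2" using dist[of m n] by simp
      then show "dist (y m) (y n) < e"
        using e by (simp add: dist_norm power2_less_imp_less)
    qed
  qed
  then obtain l where l: "y \<longlonglongrightarrow> l" using Cauchy_convergent convergent_def by blast
  have lS: "l \<in> S" using closed_sequentially[OF S(2)] y(1) l by blast
  have lD: "(norm (x - l))\<^sup>2 \<le> D"
  proof (rule LIMSEQ_le)
    show "(\<lambda>n. (norm (x - y n))\<^sup>2) \<longlonglongrightarrow> (norm (x - l))\<^sup>2"
      by (intro tendsto_intros l)
    show "(\<lambda>n. D + 1 / (real n + 1)) \<longlonglongrightarrow> D"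
      using LIMSEQ_inverse_real_of_nat_add[of D] by (simp add: inverse_eq_divide add.commute)
    show "\<exists>N. \<forall>n\<ge>N. (norm (x - y n))\<^sup>2 \<le> D + 1 / (real n + 1)"
      using y(2) less_imp_le by blast
  qed
  have "inner (x - l) z = 0" if z: "z \<in> S" for z
  proof (cases "z = 0")
    case False
    \<comment> \<open>The minimizer of the distance along the line \<open>l + t *\<^sub>R z\<close>;
      it makes the gain explicit.\<close>
    define t where "t = inner (x - l) z / (norm z)\<^sup>2"
    have "l + t *\<^sub>R z \<in> S" using S(1) lS z by (intro subspace_scale subspace_add)
    from D_le[OF this] lD have "(norm (x - l))\<^sup>2 \<le> (norm (x - (l + t *\<^sub>R z)))\<^sup>2"
      by (rule order_trans[rotated])
    also have "\<dots> = (norm (x - l))\<^sup>2 - 2 * t * inner (x - l) z + t\<^sup>2 * (norm z)\<^sup>2"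
      unfolding power2_norm_eq_inner
      by (simp add: inner_diff_left inner_diff_right inner_add_left inner_add_right inner_commute
          algebra_simps power2_eq_square)
    also have "\<dots> = (norm (x - l))\<^sup>2 - (inner (x - l) z)\<^sup>2 / (norm z)\<^sup>2"
      using False unfolding t_def by (simp add: field_simps power2_eq_square)
    finally have "(inner (x - l) z)\<^sup>2 / (norm z)\<^sup>2 \<le> 0" by simp
    then show ?thesis using False by (simp add: divide_le_0_iff)
  qed simp
  with lS show ?thesis by blast
qed

definition proj_on :: "'a::{real_inner, complete_space} set \<Rightarrow> 'a \<Rightarrow> 'a" where
  "proj_on S x = (SOME y. y \<in> S \<and> (\<forall>z\<in>S. inner (x - y) z = 0))"

context
  fixes S :: "'a::{real_inner, complete_space} set"
  assumes S: "subspace S" "closed S"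
begin

lemma proj_on_in: "proj_on S x \<in> S"
  and proj_on_orthogonal: "z \<in> S \<Longrightarrow> inner (x - proj_on S x) z = 0"
proof -
  have "proj_on S x \<in> S \<and> (\<forall>z\<in>S. inner (x - proj_on S x) z = 0)"
    unfolding proj_on_def
    by (rule someI_ex[of "\<lambda>y. y \<in> S \<and> (\<forall>z\<in>S. inner (x - y) z = 0)"])
      (use orthogonal_decomposition_exists[OF S, of x] in blast)
  then show "proj_on S x \<in> S" "z \<in> S \<Longrightarrow> inner (x - proj_on S x) z = 0" by auto
qed

lemma proj_on_unique:
  assumes "y \<in> S" "\<And>z. z \<in> S \<Longrightarrow> inner (x - y) z = 0"
  shows "proj_on S x = y"
proof -
  have *: "proj_on S x - y \<in> S" using S(1) assms(1) proj_on_in by (intro subspace_diff)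
  have "inner (proj_on S x - y) (proj_on S x - y)
      = inner (x - y) (proj_on S x - y) - inner (x - proj_on S x) (proj_on S x - y)"
    by (simp add: inner_diff_left)
  also have "\<dots> = 0" using assms(2)[OF *] proj_on_orthogonal[OF *] by simp
  finally show ?thesis by simp
qed

lemma proj_on_ident: "x \<in> S \<Longrightarrow> proj_on S x = x"
  by (rule proj_on_unique) auto

lemma proj_on_eq_0: "(\<And>z. z \<in> S \<Longrightarrow> inner x z = 0) \<Longrightarrow> proj_on S x = 0"
  using S(1) by (intro proj_on_unique) (auto simp: subspace_0)

lemma proj_on_symmetric: "inner (proj_on S x) y = inner x (proj_on S y)"
proof -
  have "inner x (proj_on S y) = inner (proj_on S x) (proj_on S y)"
    "inner y (proj_on S x) = inner (proj_on S y) (proj_on S x)"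
    using proj_on_orthogonal[of "proj_on S y" x, OF proj_on_in]
      proj_on_orthogonal[of "proj_on S x" y, OF proj_on_in]
    unfolding inner_diff_left by linarith+
  then show ?thesis by (metis inner_commute)
qed

lemma norm_proj_on_le: "norm (proj_on S x) \<le> norm x"
proof -
  have "(norm (proj_on S x))\<^sup>2 = inner (proj_on S x) x"
    using proj_on_orthogonal[of "proj_on S x" x, OF proj_on_in]
    by (simp add: power2_norm_eq_inner inner_diff_left inner_commute[of "proj_on S x" x])
  also have "\<dots> \<le> norm (proj_on S x) * norm x" by (rule norm_cauchy_schwarz)
  finally show ?thesis
    by (cases "norm (proj_on S x) = 0") (auto simp: power2_eq_square)
qed

lemma bounded_linear_proj_on: "bounded_linear (proj_on S)"
proof (rule bounded_linear_intro[where K=1])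
  fix x y :: 'a and r :: real
  show "proj_on S (x + y) = proj_on S x + proj_on S y"
  proof (rule proj_on_unique)
    fix z assume "z \<in> S"
    then show "inner (x + y - (proj_on S x + proj_on S y)) z = 0"
      using proj_on_orthogonal[of z x] proj_on_orthogonal[of z y]
      by (simp add: inner_diff_left inner_add_left)
  qed (intro subspace_add S proj_on_in)
  show "proj_on S (r *\<^sub>R x) = r *\<^sub>R proj_on S x"
  proof (rule proj_on_unique)
    fix z assume "z \<in> S"
    then show "inner (r *\<^sub>R x - r *\<^sub>R proj_on S x) z = 0"
      using proj_on_orthogonal[of z x]
      by (metis inner_scaleR_left mult_zero_right scaleR_right_diff_distrib)
  qed (intro subspace_scale S proj_on_in)
qed (simp add: norm_proj_on_le)

end

lemma Riesz_representation:
  fixes f :: "'a::{real_inner, complete_space} \<Rightarrow> real"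
  assumes "bounded_linear f"
  shows "\<exists>y. \<forall>x. f x = inner x y"
proof -
  interpret bounded_linear f by fact
  let ?S = "{x. f x = 0}"
  have S: "subspace ?S" "closed ?S"
    using assms by (auto simp: subspace_def add scaleR zero
        intro!: closed_Collect_eq continuous_intros linear_continuous_on)
  show ?thesis
  proof (cases "\<forall>x. f x = 0")
    case False
    then obtain x where x: "f x \<noteq> 0" by blast
    define u where "u = x - proj_on ?S x"
    have fu: "f u \<noteq> 0" using proj_on_in[OF S, of x] x by (simp add: u_def diff)
    then have u0: "inner u u \<noteq> 0" using zero by auto
    have "f z = inner z ((f u / inner u u) *\<^sub>R u)" for z
    proof -
      have "z - (f z / f u) *\<^sub>R u \<in> ?S" using fu by (simp add: diff scaleR)
      from proj_on_orthogonal[OF S this, of x]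
      have "inner u (z - (f z / f u) *\<^sub>R u) = 0" by (simp add: u_def)
      then have "inner u z = f z / f u * inner u u" by (simp add: inner_diff_right)
      then show ?thesis using fu u0 by (simp add: inner_commute field_simps)
    qed
    then show ?thesis by blast
  qed (auto intro: exI[of _ 0])
qed

text \<open>\<open>S y\<close> is the Riesz representative of
  \<open>x \<mapsto> inner (T x) y\<close>. For the bounded operator \<open>K\<close> below this
  provides the adjoint in K^* K.\<close>

lemma adjoint_exists:
  fixes T :: "'a::{real_inner, complete_space} \<Rightarrow> 'b::real_inner"
  assumes T: "bounded_linear T"
  shows "\<exists>S. bounded_linear S \<and> (\<forall>x y. inner (T x) y = inner x (S y))"
proof -
  interpret T: bounded_linear T by fact
  have "\<exists>z. \<forall>x. inner (T x) y = inner x z" for y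
    by (intro Riesz_representation bounded_linear_compose[OF bounded_linear_inner_left T])
  then obtain S where S: "\<And>x y. inner (T x) y = inner x (S y)" by metis
  obtain K where K: "K \<ge> 0" "\<And>x. norm (T x) \<le> norm x * K"
    using T.nonneg_bounded by blast
  have "bounded_linear S"
  proof (rule bounded_linear_intro[where K=K])
    fix x y :: 'b and r :: real
    have eqI: "u = v" if "\<And>x. inner x u = inner x v" for u v :: 'a
      using that[of "u - v"] by (metis inner_diff_right inner_eq_zero_iff right_minus_eq)
    show "S (x + y) = S x + S y"
      by (rule eqI) (simp add: inner_add_right S[symmetric])
    show "S (r *\<^sub>R x) = r *\<^sub>R S x"
      by (rule eqI) (simp add: S[symmetric])
    have "norm (S x) * norm (S x) = inner (T (S x)) x"
      by (simp add: S flip: power2_norm_eq_inner power2_eq_square)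
    also have "\<dots> \<le> norm (S x) * K * norm x"
      using norm_cauchy_schwarz[of "T (S x)" x] K(2)[of "S x"]
      by (meson mult_right_mono norm_ge_zero order_trans)
    finally show "norm (S x) \<le> norm x * K"
      using K(1) by (cases "norm (S x) = 0") (auto simp: algebra_simps)
  qed
  with S show ?thesis by blast
qed

section \<open>Diagonal operators and their spectral projections\<close>

lemma closure_of_span_closed_subspace:
  "subspace (closure (span X))" "closed (closure (span X))" for X :: "'a::real_normed_vector set"
proof -
  show "subspace (closure (span X))"
    unfolding subspace_def
  proof (intro conjI ballI allI)
    show "0 \<in> closure (span X)" using span_zero closure_subset by blast
    fix x assume x: "x \<in> closure (span X)"
    then obtain f where f: "\<And>n. f n \<in> span X" "f \<longlonglongrightarrow> x"
      unfolding closure_sequential by blast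
    show "c *\<^sub>R x \<in> closure (span X)" for c
      unfolding closure_sequential
      by (intro exI[of _ "\<lambda>n. c *\<^sub>R f n"]) (auto intro!: tendsto_intros f span_scale)
    fix y assume "y \<in> closure (span X)"
    then obtain g where g: "\<And>n. g n \<in> span X" "g \<longlonglongrightarrow> y"
      unfolding closure_sequential by blast
    show "x + y \<in> closure (span X)"
      unfolding closure_sequential
      by (intro exI[of _ "\<lambda>n. f n + g n"]) (auto intro!: tendsto_intros f g span_add)
  qed
qed simp

lemma orthogonal_to_closure_span:
  fixes X :: "'a::real_inner set"
  assumes "\<And>z. z \<in> X \<Longrightarrow> inner x z = 0" "z \<in> closure (span X)"
  shows "inner x z = 0"
proof -
  have "closure (span X) \<subseteq> {z. inner x z = 0}"
  proof (rule closure_minimal)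
    have "subspace {z. inner x z = 0}"
      by (auto simp: subspace_def inner_add_right)
    then show "span X \<subseteq> {z. inner x z = 0}"
      using assms(1) by (intro span_minimal) auto
    show "closed {z. inner x z = 0}"
      by (intro closed_Collect_eq continuous_intros)
  qed
  then show ?thesis using assms(2) by auto
qed

text \<open>Symmetry and a dense span of eigenvectors stand in for the spectral theorem: spectral
  projections become orthogonal projections onto closed spans of eigenvectors, and identities
  between them are checked on eigenvectors.\<close>

locale diagonal_op =
  fixes A :: "'a::{real_inner, complete_space} \<Rightarrow> 'a"
  assumes bounded_linear_A: "bounded_linear A"
    and symmetric: "inner (A x) y = inner x (A y)"
    and dense: "closure (span {x. \<exists>c. A x = c *\<^sub>R x}) = UNIV"
begin

interpretation A: bounded_linear A by (rule bounded_linear_A)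

definition spec :: "real set \<Rightarrow> 'a set" where
  "spec B = closure (span {x. \<exists>c\<in>B. A x = c *\<^sub>R x})"

definition P :: "real set \<Rightarrow> 'a \<Rightarrow> 'a" where
  "P B = proj_on (spec B)"

lemma spec: "subspace (spec B)" "closed (spec B)"
  unfolding spec_def by (rule closure_of_span_closed_subspace)+

lemma P_symmetric: "inner (P B x) y = inner x (P B y)"
  unfolding P_def by (rule proj_on_symmetric[OF spec])

lemma norm_P_le: "norm (P B x) \<le> norm x"
  unfolding P_def by (rule norm_proj_on_le[OF spec])

lemma bounded_linear_P: "bounded_linear (P B)"
  unfolding P_def by (rule bounded_linear_proj_on[OF spec])

lemma inner_P: "inner x (P B x) = (norm (P B x))\<^sup>2"
proof -
  have "P B (P B x) = P B x"
    unfolding P_def by (rule proj_on_ident[OF spec proj_on_in[OF spec]])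
  then show ?thesis by (metis P_symmetric power2_norm_eq_inner)
qed

lemma eigen_orthogonal: "A x = c *\<^sub>R x \<Longrightarrow> A y = d *\<^sub>R y \<Longrightarrow> c \<noteq> d \<Longrightarrow> inner x y = 0"
  using symmetric[of x y] by simp

text \<open>Eigenvectors for distinct eigenvalues are orthogonal, so \<open>x\<close> either lies in
  \<open>spec B\<close> or is orthogonal to it. If \<open>x = 0\<close>, then \<open>c\<close> is
  arbitrary, and the two cases agree.\<close>

lemma P_eigen:
  assumes "A x = c *\<^sub>R x"
  shows "P B x = (if c \<in> B then x else 0)"
proof (cases "c \<in> B")
  case True
  have "x \<in> spec B"
    unfolding spec_def using True assms
    by (intro subsetD[OF closure_subset] span_base) auto
  then show ?thesis using True unfolding P_def by (simp add: proj_on_ident[OF spec])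
next
  case False
  have "inner x z = 0" if "z \<in> spec B" for z
    using that unfolding spec_def
    by (rule orthogonal_to_closure_span[rotated]) (use assms False eigen_orthogonal in blast)
  then show ?thesis using False unfolding P_def by (simp add: proj_on_eq_0[OF spec])
qed

lemma eigen_induct:
  assumes "closed {x. Q x}" "subspace {x. Q x}" "\<And>x c. A x = c *\<^sub>R x \<Longrightarrow> Q x"
  shows "Q x"
proof -
  have "closure (span {x. \<exists>c. A x = c *\<^sub>R x}) \<subseteq> {x. Q x}"
    by (intro closure_minimal span_minimal) (use assms in auto)
  then show ?thesis using dense by auto
qed

text \<open>Both sides are continuous and linear, and eigenvectors span a dense subspace. The
  algebra of the projections \<open>P B\<close> reduces in this way to the case distinction in
  \<open>P_eigen\<close>.\<close>

lemma eigen_ext: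
  assumes f: "bounded_linear f" and g: "bounded_linear (g :: 'a \<Rightarrow> 'a)"
    and "\<And>x c. A x = c *\<^sub>R x \<Longrightarrow> f x = g x"
  shows "f x = g x"
proof (rule eigen_induct[where Q="\<lambda>x. f x = g x"])
  show "closed {x. f x = g x}"
    by (intro closed_Collect_eq linear_continuous_on f g)
  show "subspace {x. f x = g x}"
    using linear_add[OF bounded_linear.linear[OF f]] linear_scale[OF bounded_linear.linear[OF f]]
      linear_add[OF bounded_linear.linear[OF g]] linear_scale[OF bounded_linear.linear[OF g]]
      bounded_linear.linear[OF f] bounded_linear.linear[OF g]
    by (auto simp: subspace_def linear_0)
qed fact

lemma P_empty: "P {} x = 0"
  by (rule eigen_ext[where f="P {}" and g="\<lambda>_. 0"])
    (use P_eigen[of _ _ "{}"] bounded_linear_P in auto)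

lemma P_UNIV: "P UNIV x = x"
  by (rule eigen_ext[where f="P UNIV" and g="\<lambda>x. x"]) 
    (use P_eigen[of _ _ UNIV] bounded_linear_P in \<open>auto simp: bounded_linear_ident\<close>)

lemma P_Int: "P (B \<inter> C) x = P B (P C x)"
proof (rule eigen_ext[where f="P (B \<inter> C)" and g="\<lambda>x. P B (P C x)"])
  show "bounded_linear (\<lambda>x. P B (P C x))"
    by (intro bounded_linear_compose[OF bounded_linear_P bounded_linear_P])
  show "P (B \<inter> C) x = P B (P C x)" if "A x = c *\<^sub>R x" for x c
    by (auto simp: P_eigen[OF that] linear_0[OF bounded_linear.linear[OF bounded_linear_P]])
qed (rule bounded_linear_P)

text \<open>\<open>J\<close> maps every eigenspace into itself. Applied to multiplication by i, this
  makes the projections of a real Hilbert space complex linear.\<close>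

lemma P_commute: "bounded_linear J \<Longrightarrow> (\<And>x. A (J x) = J (A x)) \<Longrightarrow> P B (J x) = J (P B x)"
proof (rule eigen_ext[where f="\<lambda>x. P B (J x)" and g="\<lambda>x. J (P B x)"])
  assume J: "bounded_linear J" "\<And>x. A (J x) = J (A x)"
  show "bounded_linear (\<lambda>x. P B (J x))" "bounded_linear (\<lambda>x. J (P B x))"
    by (intro bounded_linear_compose[OF bounded_linear_P J(1)]
        bounded_linear_compose[OF J(1) bounded_linear_P])+
  fix x c assume x: "A x = c *\<^sub>R x"
  have *: "A (J x) = c *\<^sub>R J x"
    using J x linear_scale[OF bounded_linear.linear[OF J(1)]] by simp
  show "P B (J x) = J (P B x)"
    by (simp add: P_eigen[OF x] P_eigen[OF *] linear_0[OF bounded_linear.linear[OF J(1)]])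
qed

lemma P_finite_Union:
  assumes "disjoint_family_on B I" "finite I"
  shows "P (\<Union>i\<in>I. B i) x = (\<Sum>i\<in>I. P (B i) x)"
proof (rule eigen_ext[where f="P (\<Union>i\<in>I. B i)" and g="\<lambda>x. \<Sum>i\<in>I. P (B i) x"])
  fix x c assume x: "A x = c *\<^sub>R x"
  show "P (\<Union>i\<in>I. B i) x = (\<Sum>i\<in>I. P (B i) x)"
  proof (cases "c \<in> (\<Union>i\<in>I. B i)")
    case True
    then obtain k where k: "k \<in> I" "c \<in> B k" by auto
    have "(\<Sum>i\<in>I. P (B i) x) = (\<Sum>i\<in>I. if i = k then x else 0)"
      using k assms(1) by (intro sum.cong) (auto simp: P_eigen[OF x] disjoint_family_on_def)
    then show ?thesis using k True assms(2) by (simp add: P_eigen[OF x])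
  next
    case False
    then show ?thesis by (simp add: P_eigen[OF x])
  qed
qed (intro bounded_linear_P bounded_linear_sum)+

text \<open>For an eigenvector the partial sums are eventually constant, because its eigenvalue lies
  in at most one \<open>B n\<close>. The remainders \<open>?T N\<close> are bounded by 2 uniformly
  in \<open>N\<close>, since a partial sum is again a projection; hence the vectors on which they
  tend to 0 form a closed subspace, and the claim extends to all vectors.\<close>

lemma P_Union_tendsto:
  assumes B: "disjoint_family (B :: nat \<Rightarrow> real set)"
  shows "(\<lambda>N. \<Sum>n<N. P (B n) x) \<longlonglongrightarrow> P (\<Union>n. B n) x"
proof -
  let ?T = "\<lambda>N x. P (\<Union>n. B n) x - (\<Sum>n<N. P (B n) x)"
  have T: "bounded_linear (?T N)" for N
    by (intro bounded_linear_sub bounded_linear_P bounded_linear_sum)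
  have T_le: "norm (?T N x) \<le> 2 * norm x" for N x
  proof -
    have "?T N x = P (\<Union>n. B n) x - P (\<Union>n<N. B n) x"
      using B by (subst P_finite_Union) (auto simp: disjoint_family_on_def)
    then show ?thesis
      using norm_triangle_ineq4[of "P (\<Union>n. B n) x" "P (\<Union>n<N. B n) x"]
        norm_P_le[of "\<Union>n. B n" x] norm_P_le[of "\<Union>n<N. B n" x] by simp
  qed
  have "(\<lambda>N. ?T N x) \<longlonglongrightarrow> 0"
  proof (rule eigen_induct[where Q="\<lambda>x. (\<lambda>N. ?T N x) \<longlonglongrightarrow> 0"])
    show "subspace {x. (\<lambda>N. ?T N x) \<longlonglongrightarrow> 0}"
    proof (rule subspaceI, goal_cases)
      case 1 show ?case by (simp add: linear_0[OF bounded_linear.linear[OF T]])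
    next
      case (2 x y)
      then show ?case
        using tendsto_add[of "\<lambda>N. ?T N x" 0 _ "\<lambda>N. ?T N y" 0]
        unfolding mem_Collect_eq linear_add[OF bounded_linear.linear[OF T]] by simp
    next
      case (3 c x)
      then show ?case
        using tendsto_scaleR[of "\<lambda>_. c" c _ "\<lambda>N. ?T N x" 0]
        unfolding mem_Collect_eq linear_scale[OF bounded_linear.linear[OF T]] by simp
    qed
    show "closed {x. (\<lambda>N. ?T N x) \<longlonglongrightarrow> 0}"
      unfolding closed_sequential_limits
    proof (intro allI impI, elim conjE)
      fix f l assume f: "\<forall>n. f n \<in> {x. (\<lambda>N. ?T N x) \<longlonglongrightarrow> 0}" and l: "f \<longlonglongrightarrow> l"
      have "(\<lambda>N. ?T N l) \<longlonglongrightarrow> 0"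
      proof (rule LIMSEQ_I)
        fix r :: real assume r: "r > 0"
        obtain n where n: "norm (l - f n) < r / 4"
          using LIMSEQ_D[OF l, of "r/4"] r by (auto simp: norm_minus_commute)
        obtain N where N: "\<And>k. k \<ge> N \<Longrightarrow> norm (?T k (f n)) < r / 2"
          using f LIMSEQ_D[of "\<lambda>N. ?T N (f n)" 0 "r/2"] r by auto
        have "norm (?T k l) < r" if "k \<ge> N" for k
        proof -
          have "?T k l = ?T k (l - f n) + ?T k (f n)"
            by (simp only: linear_diff[OF bounded_linear.linear[OF T]] diff_add_cancel)
          then have "norm (?T k l) \<le> norm (?T k (l - f n)) + norm (?T k (f n))"
            by (metis norm_triangle_ineq)
          then show ?thesis using T_le[of "l - f n" k] n N[OF that] by linarith
        qed
        then show "\<exists>N. \<forall>k\<ge>N. norm (?T k l - 0) < r" by auto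
      qed
      then show "l \<in> {x. (\<lambda>N. ?T N x) \<longlonglongrightarrow> 0}" by simp
    qed
    fix x c assume x: "A x = c *\<^sub>R x"
    have "\<forall>\<^sub>F N in sequentially. ?T N x = 0"
    proof (cases "c \<in> (\<Union>n. B n)")
      case True
      then obtain k where k: "c \<in> B k" by auto
      have "?T N x = 0" if "N > k" for N
      proof -
        have "(\<Sum>n<N. P (B n) x) = (\<Sum>n<N. if n = k then x else 0)"
          using k B by (intro sum.cong) (auto simp: P_eigen[OF x] disjoint_family_on_def)
        then show ?thesis using True that by (simp add: P_eigen[OF x])
      qed
      then show ?thesis by (auto simp: eventually_sequentially intro!: exI[of _ "Suc k"])
    next
      case False
      then show ?thesis by (auto simp: P_eigen[OF x])
    qed
    then show "(\<lambda>N. ?T N x) \<longlonglongrightarrow> 0" by (rule tendsto_eventually)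
  qed
  then have "(\<lambda>N. P (\<Union>n. B n) x - ?T N x) \<longlonglongrightarrow> P (\<Union>n. B n) x - 0"
    by (intro tendsto_intros)
  then show ?thesis by simp
qed

text \<open>Indexing the summands by their eigenvalue merges vectors with equal eigenvalue, so that
  distinct summands are orthogonal and Pythagoras applies in \<open>diagonal_bound\<close>.\<close>

lemma span_eigen_decomp:
  assumes "x \<in> span {x. \<exists>c. A x = c *\<^sub>R x}"
  shows "\<exists>F y. finite F \<and> (\<forall>c. A (y c) = c *\<^sub>R y c) \<and> x = (\<Sum>c\<in>F. y c)"
  using assms
proof (induction rule: span_induct_alt)
  case base
  show ?case by (intro exI[of _ "{}"] exI[of _ "\<lambda>_. 0"]) (auto simp: A.zero)
next
  case (step r x z)
  then obtain c F y where c: "A x = c *\<^sub>R x" and F: "finite F"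
    and y: "\<And>c. A (y c) = c *\<^sub>R y c" and z: "z = (\<Sum>c\<in>F. y c)" by auto
  \<comment> \<open>The new vector joins the summand of its own eigenvalue \<open>c\<close>, whether
    or not \<open>c\<close> already occurs in \<open>F\<close>; values of \<open>y\<close> outside
    \<open>F\<close> are discarded.\<close>
  define y' where "y' d = (if d \<in> F then y d else 0) + (if d = c then r *\<^sub>R x else 0)" for d
  have "A (y' d) = d *\<^sub>R y' d" for d
    using y c by (auto simp: y'_def A.add A.scaleR A.zero scaleR_add_right)
  moreover have "r *\<^sub>R x + z = (\<Sum>c\<in>insert c F. y' c)"
  proof -
    have "(\<Sum>d\<in>insert c F. y' d) = (\<Sum>d\<in>insert c F. if d \<in> F then y d else 0) + r *\<^sub>R x"
      using F unfolding y'_def sum.distrib by simp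
    also have "(\<Sum>d\<in>insert c F. if d \<in> F then y d else 0) = z"
      unfolding z using F by (intro sum.mono_neutral_cong_right) auto
    finally show ?thesis by simp
  qed
  ultimately show ?case using F by (intro exI[of _ "insert c F"] exI[of _ y']) auto
qed

text \<open>By orthogonality, the form of \<open>T\<close> on a sum of eigenvectors is the sum of
  their squared norms weighted with \<open>\<tau> c\<close>. The bound on \<open>\<tau>\<close>
  refers to true eigenvalues only, hence the condition \<open>x \<noteq> 0\<close>.\<close>

lemma diagonal_bound:
  assumes T: "bounded_linear T"
    and \<tau>: "\<And>x c. A x = c *\<^sub>R x \<Longrightarrow> x \<noteq> 0 \<Longrightarrow> \<bar>\<tau> c\<bar> \<le> \<epsilon>"
    and TA: "\<And>x c. A x = c *\<^sub>R x \<Longrightarrow> T x = \<tau> c *\<^sub>R x"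
  shows "\<bar>inner x (T x)\<bar> \<le> \<epsilon> * (norm x)\<^sup>2"
proof -
  have "closure (span {x. \<exists>c. A x = c *\<^sub>R x}) \<subseteq> {x. \<bar>inner x (T x)\<bar> \<le> \<epsilon> * (norm x)\<^sup>2}"
  proof (rule closure_minimal)
    show "closed {x. \<bar>inner x (T x)\<bar> \<le> \<epsilon> * (norm x)\<^sup>2}"
      by (intro closed_Collect_le continuous_intros linear_continuous_on T)
    show "span {x. \<exists>c. A x = c *\<^sub>R x} \<subseteq> {x. \<bar>inner x (T x)\<bar> \<le> \<epsilon> * (norm x)\<^sup>2}"
    proof
      fix x assume "x \<in> span {x. \<exists>c. A x = c *\<^sub>R x}"
      then obtain F y where F: "finite F" and y: "\<And>c. A (y c) = c *\<^sub>R y c"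
        and x: "x = (\<Sum>c\<in>F. y c)" using span_eigen_decomp by blast
      have orth: "inner (y c) (y d) = (if c = d then (norm (y c))\<^sup>2 else 0)" for c d
        using eigen_orthogonal[OF y y] by (auto simp: power2_norm_eq_inner)
      have nx: "(norm x)\<^sup>2 = (\<Sum>c\<in>F. (norm (y c))\<^sup>2)"
        unfolding power2_norm_eq_inner[of x] unfolding x
        using F by (simp add: inner_sum_left inner_sum_right orth)
      have "T x = (\<Sum>c\<in>F. \<tau> c *\<^sub>R y c)"
        unfolding x linear_sum[OF bounded_linear.linear[OF T]] by (simp add: TA[OF y])
      then have "inner x (T x) = (\<Sum>c\<in>F. \<tau> c * (norm (y c))\<^sup>2)"
        unfolding x using F
        by (simp add: inner_sum_left inner_sum_right orth if_distrib[of "\<lambda>u. _ * u"] cong: if_cong)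
      also have "\<bar>\<dots>\<bar> \<le> (\<Sum>c\<in>F. \<epsilon> * (norm (y c))\<^sup>2)"
      proof (rule order_trans[OF sum_abs sum_mono])
        fix c show "\<bar>\<tau> c * (norm (y c))\<^sup>2\<bar> \<le> \<epsilon> * (norm (y c))\<^sup>2"
          using \<tau>[OF y, of c] by (cases "y c = 0") (auto simp: abs_mult intro: mult_right_mono)
      qed
      also have "\<dots> = \<epsilon> * (norm x)\<^sup>2" by (simp add: nx sum_distrib_left)
      finally show "x \<in> {x. \<bar>inner x (T x)\<bar> \<le> \<epsilon> * (norm x)\<^sup>2}" by simp
    qed
  qed
  then show ?thesis using dense by auto
qed

section \<open>Scalar spectral measures and their moments\<close>

definition \<nu> :: "'a \<Rightarrow> real measure" where
  "\<nu> x = measure_of UNIV (sets borel) (\<lambda>B. ennreal (inner x (P B x)))"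

lemma sets_\<nu> [simp, measurable_cong]: "sets (\<nu> x) = sets borel"
  and space_\<nu> [simp]: "space (\<nu> x) = UNIV"
  unfolding \<nu>_def by (simp_all add: sets.sigma_sets_eq[of borel, simplified] space_measure_of_conv)

lemma emeasure_\<nu>:
  assumes "B \<in> sets borel"
  shows "emeasure (\<nu> x) B = ennreal (inner x (P B x))"
proof (rule emeasure_measure_of[OF \<nu>_def])
  show "positive (sets (\<nu> x)) (\<lambda>B. ennreal (inner x (P B x)))"
    by (auto simp: positive_def P_empty)
  show "countably_additive (sets (\<nu> x)) (\<lambda>B. ennreal (inner x (P B x)))"
    unfolding countably_additive_def
  proof (intro allI impI)
    fix B :: "nat \<Rightarrow> real set"
    assume B: "disjoint_family B"
    have "(\<lambda>N. inner x (\<Sum>n<N. P (B n) x)) \<longlonglongrightarrow> inner x (P (\<Union>n. B n) x)"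
      by (intro tendsto_intros P_Union_tendsto B)
    then have "(\<lambda>n. inner x (P (B n) x)) sums inner x (P (\<Union>n. B n) x)"
      by (simp add: sums_def inner_sum_right)
    then show "(\<Sum>n. ennreal (inner x (P (B n) x))) = ennreal (inner x (P (\<Union> (range B)) x))"
      by (intro suminf_ennreal_eq) (auto simp: inner_P)
  qed
qed (use assms in auto)

lemma finite_measure_\<nu>: "finite_measure (\<nu> x)"
  by (rule finite_measureI) (simp add: emeasure_\<nu>)

lemma measure_\<nu>: "B \<in> sets borel \<Longrightarrow> measure (\<nu> x) B = inner x (P B x)"
  by (simp add: measure_def emeasure_\<nu> inner_P)

lemma eigenvalue_bound:
  "\<exists>M\<ge>0. \<forall>x c. A x = c *\<^sub>R x \<longrightarrow> x \<noteq> 0 \<longrightarrow> \<bar>c\<bar> \<le> M"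
proof -
  obtain K where K: "K \<ge> 0" "\<And>x. norm (A x) \<le> norm x * K"
    using A.nonneg_bounded by blast
  have "\<bar>c\<bar> \<le> K" if "A x = c *\<^sub>R x" "x \<noteq> 0" for x c
    using K(2)[of x] that by (simp add: mult.commute)
  with K(1) show ?thesis by blast
qed

text \<open>The measure is carried by the interval of radius \<open>M\<close>, since no eigenvalue
  exceeds \<open>M\<close> in modulus; this gives all moments. For the first moment,
  \<open>t\<close> is rounded down to a multiple of \<epsilon>. Under the integral this costs at
  most \<epsilon> times the squared norm; on the operator side, \<open>A\<close> minus the
  corresponding sum of projections is diagonal with entries of size at most \<epsilon>, and
  \<open>diagonal_bound\<close> gives the same error.\<close>

lemma spectral_identity:
  shows integrable_\<nu>_power: "integrable (\<nu> x) (\<lambda>t. t ^ k)"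
    and integral_\<nu>: "(LINT t|\<nu> x. t) = inner x (A x)"
proof -
  interpret finite_measure "\<nu> x" by (rule finite_measure_\<nu>)
  obtain M where M: "M \<ge> 0" "\<And>x c. A x = c *\<^sub>R x \<Longrightarrow> x \<noteq> 0 \<Longrightarrow> \<bar>c\<bar> \<le> M"
    using eigenvalue_bound by blast
  have "P {t. \<not> \<bar>t\<bar> \<le> M} y = 0" for y
  proof (rule eigen_ext[where f="P {t. \<not> \<bar>t\<bar> \<le> M}" and g="\<lambda>_. 0"])
    show "P {t. \<not> \<bar>t\<bar> \<le> M} y = 0" if "A y = c *\<^sub>R y" for y c
      using M(2)[OF that] by (cases "y = 0")
        (auto simp: P_eigen[OF that] linear_0[OF bounded_linear.linear[OF bounded_linear_P]])
  qed (auto simp: bounded_linear_P)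
  then have "emeasure (\<nu> x) {t. \<not> \<bar>t\<bar> \<le> M} = 0"
    by (subst emeasure_\<nu>) auto
  then have AE: "AE t in \<nu> x. \<bar>t\<bar> \<le> M"
    by (intro AE_I[of _ _ "{t. \<not> \<bar>t\<bar> \<le> M}"]) auto
  have int: "integrable (\<nu> x) (\<lambda>t. t ^ k)" for k
  proof (rule integrable_const_bound)
    show "AE t in \<nu> x. norm (t ^ k) \<le> M ^ k"
      using AE by eventually_elim (auto simp: power_abs intro!: power_mono)
  qed simp
  then show "integrable (\<nu> x) (\<lambda>t. t ^ k)" .
  have bound: "\<bar>(LINT t|\<nu> x. t) - inner x (A x)\<bar> \<le> 2 * \<epsilon> * (norm x)\<^sup>2" if \<epsilon>: "\<epsilon> > 0" for \<epsilon>
  proof -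
    define B where "B i = {t. \<lfloor>t / \<epsilon>\<rfloor> = i}" for i :: int
    \<comment> \<open>The integers that \<open>\<lfloor>t / \<epsilon>\<rfloor>\<close> can take for
      \<open>\<bar>t\<bar> \<le> M\<close>, with one to spare at the lower end.\<close>
    define I where "I = {-\<lceil>M / \<epsilon>\<rceil> - 1..\<lceil>M / \<epsilon>\<rceil>}"
    have [measurable]: "B i \<in> sets borel" for i unfolding B_def by measurable
    have inI: "\<lfloor>t / \<epsilon>\<rfloor> \<in> I" if "\<bar>t\<bar> \<le> M" for t
    proof -
      have "t / \<epsilon> \<le> M / \<epsilon>" "- (M / \<epsilon>) \<le> t / \<epsilon>"
        using that \<epsilon> by (auto simp: field_simps)
      then show ?thesis unfolding I_def by (simp; linarith)
    qed
    have step: "(\<Sum>i\<in>I. \<epsilon> * of_int i * indicator (B i) t) = \<epsilon> * of_int \<lfloor>t / \<epsilon>\<rfloor>" if "\<bar>t\<bar> \<le> M" for t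
    proof -
      have "(\<Sum>i\<in>I. \<epsilon> * of_int i * indicator (B i) t)
          = (\<Sum>i\<in>I. if i = \<lfloor>t / \<epsilon>\<rfloor> then \<epsilon> * of_int i else 0)"
        by (intro sum.cong) (auto simp: B_def)
      then show ?thesis using inI[OF that] by (simp add: I_def)
    qed
    have near: "\<bar>t - \<epsilon> * of_int \<lfloor>t / \<epsilon>\<rfloor>\<bar> \<le> \<epsilon>" for t
    proof -
      have "\<bar>t / \<epsilon> - of_int \<lfloor>t / \<epsilon>\<rfloor>\<bar> \<le> 1" by linarith
      then have "\<epsilon> * \<bar>t / \<epsilon> - of_int \<lfloor>t / \<epsilon>\<rfloor>\<bar> \<le> \<epsilon>"
        using \<epsilon> by (simp add: mult_left_le)
      moreover have "\<epsilon> * \<bar>t / \<epsilon> - of_int \<lfloor>t / \<epsilon>\<rfloor>\<bar> = \<bar>\<epsilon> * (t / \<epsilon> - of_int \<lfloor>t / \<epsilon>\<rfloor>)\<bar>"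
        using \<epsilon> by (simp add: abs_mult)
      ultimately show ?thesis using \<epsilon> by (simp add: right_diff_distrib)
    qed
    define s where "s t = (\<Sum>i\<in>I. \<epsilon> * of_int i * indicator (B i) t)" for t :: real
    have ints: "integrable (\<nu> x) s" unfolding s_def
      by (intro Bochner_Integration.integrable_sum integrable_mult_right integrable_real_indicator)
        (auto simp: less_top[symmetric])
    have "\<bar>(LINT t|\<nu> x. t) - (LINT t|\<nu> x. s t)\<bar> = \<bar>LINT t|\<nu> x. t - s t\<bar>"
      using int[of 1] ints by simp
    also have "\<dots> \<le> (LINT t|\<nu> x. \<bar>t - s t\<bar>)"
      by (rule integral_abs_bound)
    also have "\<dots> \<le> (LINT t|\<nu> x. \<epsilon>)"
    proof (rule integral_mono_AE)
      show "AE t in \<nu> x. \<bar>t - s t\<bar> \<le> \<epsilon>"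
        using AE by eventually_elim (simp add: s_def step near)
    qed (use int[of 1] ints in auto)
    also have "\<dots> = \<epsilon> * (norm x)\<^sup>2"
      by (simp add: measure_\<nu> P_UNIV power2_norm_eq_inner)
    finally have 1: "\<bar>(LINT t|\<nu> x. t) - (LINT t|\<nu> x. s t)\<bar> \<le> \<epsilon> * (norm x)\<^sup>2" .
    \<comment> \<open>\<open>P (B i)\<close> acts on an eigenvector as the indicator of
      \<open>B i\<close> at its eigenvalue, so \<open>T\<close> is diagonal with entries
      \<open>c - s c\<close>.\<close>
    define T where "T x = A x - (\<Sum>i\<in>I. (\<epsilon> * of_int i) *\<^sub>R P (B i) x)" for x
    have "(LINT t|\<nu> x. s t) = (\<Sum>i\<in>I. \<epsilon> * of_int i * inner x (P (B i) x))"
      unfolding s_def by (subst Bochner_Integration.integral_sum)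
        (auto simp: measure_\<nu> less_top[symmetric] intro!: integrable_mult_right integrable_real_indicator)
    then have 2: "inner x (A x) - (LINT t|\<nu> x. s t) = inner x (T x)"
      by (simp add: T_def inner_diff_right inner_sum_right)
    have 3: "\<bar>inner x (T x)\<bar> \<le> \<epsilon> * (norm x)\<^sup>2"
    proof (rule diagonal_bound[where \<tau> = "\<lambda>c. c - s c"])
      show "bounded_linear T" unfolding T_def
        by (intro bounded_linear_sub bounded_linear_A bounded_linear_sum
            bounded_linear_scaleR_right[THEN bounded_linear_compose] bounded_linear_P)
      show "\<bar>c - s c\<bar> \<le> \<epsilon>" if "A x = c *\<^sub>R x" "x \<noteq> 0" for x c
        using M(2)[OF that] by (simp add: s_def step near)
      show "T x = (c - s c) *\<^sub>R x" if "A x = c *\<^sub>R x" for x c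
        unfolding T_def s_def
        by (auto simp: that P_eigen[OF that] scaleR_diff_left scaleR_sum_left indicator_def intro!: sum.cong)
    qed
    from 1 2 3 show ?thesis by linarith
  qed
  show "(LINT t|\<nu> x. t) = inner x (A x)"
  proof (rule ccontr)
    assume ne: "(LINT t|\<nu> x. t) \<noteq> inner x (A x)"
    let ?d = "\<bar>(LINT t|\<nu> x. t) - inner x (A x)\<bar>"
    \<comment> \<open>Makes \<open>2 * e * (norm x)\<^sup>2\<close> at most half of
      \<open>?d\<close>; the added 1 covers \<open>x = 0\<close>.\<close>
    define e where "e = ?d / (4 * ((norm x)\<^sup>2 + 1))"
    have "(norm x)\<^sup>2 + 1 > 0" by (smt (verit) zero_le_power2)
    then have "e > 0" "4 * e * ((norm x)\<^sup>2 + 1) = ?d" using ne unfolding e_def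
      by (auto simp del: distrib_left_numeral)
    moreover have "2 * e * (norm x)\<^sup>2 \<le> 2 * e * ((norm x)\<^sup>2 + 1)"
      using \<open>e > 0\<close> by simp
    moreover have "?d > 0" using ne by simp
    ultimately show False using bound[OF \<open>e > 0\<close>] by linarith
  qed
qed

end


section \<open>Discreteness of the spectrum from finiteness of orthonormal families\<close>

text \<open>Bolzano-Weierstrass one index at a time, each time passing to a further subsequence,
  along which the earlier coordinates still converge.\<close>

lemma bounded_family_convergent_subseq:
  fixes c :: "nat \<Rightarrow> 'i \<Rightarrow> real"
  assumes "finite I" "\<And>n i. \<bar>c n i\<bar> \<le> K"
  shows "\<exists>r. strict_mono (r :: nat \<Rightarrow> nat) \<and> (\<forall>i\<in>I. convergent (\<lambda>n. c (r n) i))"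
  using assms(1)
proof (induction I)
  case empty
  show ?case by (intro exI[of _ id]) (auto simp: strict_mono_id)
next
  case (insert i I)
  then obtain r where r: "strict_mono (r :: nat \<Rightarrow> nat)" "\<forall>i\<in>I. convergent (\<lambda>n. c (r n) i)"
    by blast
  have "bounded (range (\<lambda>n. c (r n) i))"
    unfolding bounded_iff using assms(2) by auto
  then obtain l s where s: "strict_mono (s :: nat \<Rightarrow> nat)" "((\<lambda>n. c (r n) i) \<circ> s) \<longlonglongrightarrow> l"
    using bounded_imp_convergent_subsequence by blast
  have "convergent (\<lambda>n. c (r (s n)) j)" if "j \<in> I" for j
    using r(2) that s(1) convergent_subseq_convergent[of "\<lambda>n. c (r n) j" s] by (auto simp: o_def)
  moreover have "convergent (\<lambda>n. c (r (s n)) i)"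
    using s(2) by (auto simp: convergent_def o_def)
  ultimately show ?case
    using strict_mono_o[OF r(1) s(1)] by (intro exI[of _ "\<lambda>n. r (s n)"]) (auto simp: o_def)
qed

text \<open>A nonzero linear term would win over the quadratic one for small \<open>t\<close> of the
  opposite sign; \<open>t = - b / (c + 1)\<close> is small enough, also when
  \<open>c = 0\<close>.\<close>

lemma quadratic_nonneg_imp_zero:
  fixes b c :: real
  assumes "\<And>t. 0 \<le> 2 * t * b + t\<^sup>2 * c" "c \<ge> 0"
  shows "b = 0"
proof (rule ccontr)
  assume b: "b \<noteq> 0"
  define s where "s = c + 1"
  have s: "s > 0" using assms(2) by (simp add: s_def)
  have "0 \<le> (2 * (- b / s) * b + (- b / s)\<^sup>2 * c) * s\<^sup>2"
    using assms(1)[of "- b / s"] by simp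
  also have "\<dots> = b\<^sup>2 * c - 2 * b\<^sup>2 * s"
    using s by (simp add: field_simps power2_eq_square)
  also have "\<dots> = - (b\<^sup>2 * (c + 2))" by (simp add: s_def algebra_simps)
  finally have "b\<^sup>2 * (c + 2) \<le> 0" by simp
  moreover have "b\<^sup>2 * (c + 2) > 0" using b assms(2) by simp
  ultimately show False by linarith
qed

text \<open>\<open>finite_above\<close> is a quantitative form of compactness that can be read off
  from a trace inequality: it speaks of arbitrary orthonormal families and can be verified before
  any eigenvector is known.\<close>

locale discrete_op =
  fixes A :: "'a::{real_inner, complete_space} \<Rightarrow> 'a"
  assumes bounded_linear_A: "bounded_linear A"
    and symmetric: "inner (A x) y = inner x (A y)"
    and nonneg: "inner x (A x) \<ge> 0"
    and finite_above: "\<nu> > 0 \<Longrightarrow> \<exists>m. \<forall>X. finite X \<longrightarrow> pairwise orthogonal X \<longrightarrow>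
      (\<forall>x\<in>X. norm x = 1 \<and> \<nu> \<le> inner x (A x)) \<longrightarrow> card X \<le> m"
begin

interpretation A: bounded_linear A by (rule bounded_linear_A)

text \<open>The difference of the two sides is the sum of \<open>Q\<close> over the three pairwise
  differences, as for the square of a sum of three numbers; on \<open>N\<close> these terms are
  nonnegative.\<close>

lemma form_triangle:
  fixes u v w :: 'a
  assumes N: "subspace N" "u \<in> N" "v \<in> N" "w \<in> N"
    and Q: "\<And>y. y \<in> N \<Longrightarrow> inner y (A y) \<le> L * inner y y"
  defines "Q \<equiv> \<lambda>y. L * inner y y - inner y (A y)"
  shows "Q (u + v + w) \<le> 3 * (Q u + Q v + Q w)"
proof -
  have "0 \<le> Q (u - v)" "0 \<le> Q (v - w)" "0 \<le> Q (u - w)"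
    unfolding Q_def using Q N(2-4) subspace_diff[OF N(1)] by auto
  moreover have "3 * (Q u + Q v + Q w) = Q (u + v + w) + (Q (u - v) + Q (v - w) + Q (u - w))"
  proof -
    have s: "inner v (A u) = inner u (A v)" "inner w (A u) = inner u (A w)"
      "inner w (A v) = inner v (A w)" using symmetric by (simp_all add: inner_commute)
    show ?thesis unfolding Q_def
      by (simp add: A.add A.diff inner_add_left inner_add_right inner_diff_left inner_diff_right
          s inner_commute[of v u] inner_commute[of w u] inner_commute[of w v] algebra_simps)
  qed
  ultimately show ?thesis by linarith
qed

text \<open>The form of \<open>L - A\<close> is semidefinite on \<open>N\<close>, so a vector on
  which it vanishes lies in its radical: along \<open>u + t *\<^sub>R v\<close> the term linear in
  \<open>t\<close> has to vanish.\<close>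

lemma form_null:
  fixes u v :: 'a
  assumes N: "subspace N" "u \<in> N" "v \<in> N"
    and Q: "\<And>y. y \<in> N \<Longrightarrow> inner y (A y) \<le> L * inner y y"
    and u: "inner u (A u) = L * inner u u"
  shows "inner v (A u) = L * inner v u"
proof -
  define B where "B = L * inner v u - inner v (A u)"
  define C where "C = L * inner v v - inner v (A v)"
  have C: "C \<ge> 0" using Q[OF N(3)] by (simp add: C_def)
  have "0 \<le> 2 * t * B + t\<^sup>2 * C" for t
  proof -
    have "u + t *\<^sub>R v \<in> N" using N by (intro subspace_add subspace_scale)
    from Q[OF this] have "0 \<le> L * inner (u + t *\<^sub>R v) (u + t *\<^sub>R v) - inner (u + t *\<^sub>R v) (A (u + t *\<^sub>R v))"
      by simp
    also have "\<dots> = 2 * t * B + t\<^sup>2 * C"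
    proof -
      have "inner u (A v) = inner v (A u)" using symmetric by (simp add: inner_commute)
      then show ?thesis unfolding B_def C_def
        by (simp add: A.add A.scaleR inner_add_left inner_add_right u inner_commute[of u v]
            algebra_simps power2_eq_square)
    qed
    finally show ?thesis .
  qed
  from quadratic_nonneg_imp_zero[OF this C] show ?thesis by (simp add: B_def)
qed

text \<open>A maximizing sequence of the form splits into its component along a maximal finite
  orthonormal family on which the form is at least half its supremum $L$, and the rest.  The former
  converges along a subsequence; on the latter $L - A$ is coercive, so it is Cauchy as well.\<close>

lemma eigenvector_exists:
  assumes N: "subspace N" "closed N" "\<And>x. x \<in> N \<Longrightarrow> A x \<in> N"
    and x: "x \<in> N" "inner x (A x) > 0"
  shows "\<exists>v\<in>N. v \<noteq> 0 \<and> (\<exists>c. A v = c *\<^sub>R v)"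
proof -
  let ?R = "(\<lambda>y. inner y (A y)) ` {y\<in>N. norm y = 1}"
  define L where "L = Sup ?R"
  obtain K where K: "K \<ge> 0" "\<And>x. norm (A x) \<le> norm x * K"
    using A.nonneg_bounded by blast
  have bdd: "bdd_above ?R"
  proof (rule bdd_aboveI2)
    fix y assume "y \<in> {y\<in>N. norm y = 1}"
    then show "inner y (A y) \<le> K"
      using norm_cauchy_schwarz[of y "A y"] K(2)[of y] by simp
  qed
  have normalize: "inner y (A y) = (norm y)\<^sup>2 * inner (sgn y) (A (sgn y))" for y
  proof (cases "y = 0")
    case False
    then show ?thesis by (simp add: sgn_div_norm A.scaleR power2_eq_square field_simps)
  qed (simp add: A.zero)
  have sgnN: "y \<in> N \<Longrightarrow> sgn y \<in> N" for y
    by (auto simp: sgn_div_norm intro: subspace_scale[OF N(1)])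
  have x0: "x \<noteq> 0" using x(2) by (auto simp: A.zero)
  have "inner (sgn x) (A (sgn x)) > 0"
    using normalize[of x] x(2) by (simp add: zero_less_mult_iff)
  moreover have "inner (sgn x) (A (sgn x)) \<le> L"
    unfolding L_def using bdd sgnN[OF x(1)] x0 by (intro cSUP_upper) (auto simp: norm_sgn)
  ultimately have L: "L > 0" by linarith
  have Q: "inner y (A y) \<le> L * inner y y" if y: "y \<in> N" for y
  proof (cases "y = 0")
    case False
    have "inner (sgn y) (A (sgn y)) \<le> L"
      unfolding L_def using bdd sgnN[OF y] False by (intro cSUP_upper) (auto simp: norm_sgn)
    then show ?thesis
      by (subst normalize) (simp add: power2_norm_eq_inner[symmetric] mult.commute[of "(norm y)\<^sup>2"] mult_right_mono)
  qed (simp add: A.zero)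
  \<comment> \<open>Such families have at most \<open>m\<close> members by
    \<open>finite_above\<close>, so one of largest size exists.\<close>
  define good where "good X \<longleftrightarrow> finite X \<and> pairwise orthogonal X \<and>
      (\<forall>x\<in>X. norm x = 1 \<and> L / 2 \<le> inner x (A x)) \<and> X \<subseteq> N" for X
  obtain m where m: "\<And>X. good X \<Longrightarrow> card X \<le> m"
    using finite_above[of "L/2"] L unfolding good_def by auto
  have "good {}" by (auto simp: good_def)
  then obtain X where X: "good X" "\<And>Y. good Y \<Longrightarrow> card Y \<le> card X"
    using ex_has_greatest_nat[of good "{}" card "Suc m"] m by (metis less_Suc_eq_le)
  have Xf: "finite X" and XN: "X \<subseteq> N" and X1: "\<And>x. x \<in> X \<Longrightarrow> norm x = 1"
    and Xo: "pairwise orthogonal X" using X(1) by (auto simp: good_def)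
  have Xin: "inner a b = (if a = b then 1 else 0)" if "a \<in> X" "b \<in> X" for a b
    using Xo X1[OF that(1)] that by (auto simp: pairwise_def orthogonal_def norm_eq_1)
  \<comment> \<open>Otherwise \<open>sgn y\<close> could be added to the maximal family
    \<open>X\<close>. Orthogonally to \<open>X\<close>, the form of \<open>L - A\<close> is thus at
    least \<open>L / 2\<close> times the squared norm.\<close>
  have half: "inner y (A y) \<le> L / 2 * inner y y" if y: "y \<in> N" "\<And>x. x \<in> X \<Longrightarrow> inner x y = 0" for y
  proof (cases "y = 0")
    case False
    have "\<not> L / 2 \<le> inner (sgn y) (A (sgn y))"
    proof
      assume *: "L / 2 \<le> inner (sgn y) (A (sgn y))"
      have orth: "inner z (sgn y) = 0" if "z \<in> X" for z
        using y(2)[OF that] by (simp add: sgn_div_norm)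
      then have nin: "sgn y \<notin> X" using Xin False by (metis sgn_zero_iff inner_eq_zero_iff)
      have "good (insert (sgn y) X)"
        using X(1) * sgnN[OF y(1)] False orth
        by (auto simp: good_def pairwise_insert orthogonal_def norm_sgn inner_commute)
      from X(2)[OF this] nin Xf show False by simp
    qed
    then have "inner (sgn y) (A (sgn y)) \<le> L / 2" by simp
    from mult_left_mono[OF this, of "(norm y)\<^sup>2"] show ?thesis
      by (subst normalize) (simp add: power2_norm_eq_inner[symmetric] mult.commute)
  qed (simp add: A.zero)
  have "\<exists>z\<in>N. norm z = 1 \<and> L - 1 / (real n + 1) < inner z (A z)" for n
  proof -
    have "L - 1 / (real n + 1) < L" by simp
    then have "\<exists>r\<in>?R. L - 1 / (real n + 1) < r"
      unfolding L_def using sgnN[OF x(1)] x0 bdd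
      by (subst (asm) less_cSup_iff) (auto simp: norm_sgn intro!: exI[of _ "sgn x"])
    then show ?thesis by auto
  qed
  then obtain z where z: "\<And>n. z n \<in> N" "\<And>n. norm (z n) = 1"
    "\<And>n. L - 1 / (real n + 1) < inner (z n) (A (z n))" by metis
  define p where "p n = (\<Sum>x\<in>X. inner x (z n) *\<^sub>R x)" for n
  have pN: "p n \<in> N" for n
    unfolding p_def using XN by (intro subspace_sum N subspace_scale) auto
  have zp: "inner x (z n - p n) = 0" if "x \<in> X" for x n
  proof -
    have "inner x (p n) = (\<Sum>y\<in>X. if x = y then inner y (z n) else 0)"
      unfolding p_def inner_sum_right using that by (intro sum.cong) (auto simp: Xin)
    then show ?thesis using that Xf by (simp add: inner_diff_right)
  qed
  have "\<exists>r. strict_mono (r :: nat \<Rightarrow> nat) \<and> (\<forall>x\<in>insert 0 X. convergent (\<lambda>n. inner x (z (r n))))"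
  proof -
    let ?c = "\<lambda>n y. if y \<in> X then inner y (z n) else 0"
    have "\<bar>?c n y\<bar> \<le> 1" for n y
      using Cauchy_Schwarz_ineq2[of y "z n"] X1 z(2) by auto
    from bounded_family_convergent_subseq[of X ?c 1, OF Xf this]
    obtain r where r: "strict_mono (r :: nat \<Rightarrow> nat)" "\<forall>i\<in>X. convergent (\<lambda>n. ?c (r n) i)" by blast
    show ?thesis
    proof (intro exI conjI ballI)
      show "strict_mono r" by fact
      fix x assume "x \<in> insert 0 X"
      then show "convergent (\<lambda>n. inner x (z (r n)))"
        using r(2) by (cases "x \<in> X") (force simp: convergent_const)+
    qed
  qed
  then obtain r where r: "strict_mono (r :: nat \<Rightarrow> nat)"
    and conv: "\<And>x. x \<in> X \<Longrightarrow> convergent (\<lambda>n. inner x (z (r n)))" by blast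
  have "convergent (\<lambda>n. p (r n))"
  proof -
    from conv obtain l where "\<And>x. x \<in> X \<Longrightarrow> (\<lambda>n. inner x (z (r n))) \<longlonglongrightarrow> l x"
      unfolding convergent_def by metis
    then have "(\<lambda>n. p (r n)) \<longlonglongrightarrow> (\<Sum>x\<in>X. l x *\<^sub>R x)"
      unfolding p_def by (intro tendsto_intros) auto
    then show ?thesis by (auto simp: convergent_def)
  qed
  then have Cp: "Cauchy (\<lambda>n. p (r n))" by (rule convergent_Cauchy)
  define Q' where "Q' y = L * inner y y - inner y (A y)" for y
  have Qz: "Q' (z n) \<le> 1 / (real n + 1)" for n
    using z(3)[of n] z(2)[of n] by (simp add: Q'_def norm_eq_1)
  have Qneg: "Q' (- y) = Q' y" for y by (simp add: Q'_def A.neg)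
  have Qle: "Q' y \<le> L * (norm y)\<^sup>2" for y
    using nonneg[of y] by (simp add: Q'_def power2_norm_eq_inner)
  \<comment> \<open>The residuals are orthogonal to \<open>X\<close>, where \<open>half\<close>
    makes \<open>L - A\<close> coercive. Their difference is \<open>z n - z m + (p m - p n)\<close>:
    \<open>Q'\<close> is small on the first two terms because \<open>z\<close> is maximizing, and on
    the third because the projections converge along \<open>r\<close>.\<close>
  have est: "(norm ((z n - p n) - (z m - p m)))\<^sup>2
      \<le> (6 / L) * (1 / (real n + 1) + 1 / (real m + 1) + L * (norm (p n - p m))\<^sup>2)" for n m
  proof -
    let ?q = "(z n - p n) - (z m - p m)"
    have qN: "?q \<in> N" by (intro subspace_diff N z pN)
    have "inner x ?q = 0" if "x \<in> X" for x
      using zp[OF that, of n] zp[OF that, of m] unfolding inner_diff_right[of _ "z n - p n"] by simp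
    from half[OF qN this] have "L / 2 * (norm ?q)\<^sup>2 \<le> Q' ?q"
      by (simp add: Q'_def power2_norm_eq_inner)
    also have "Q' ?q = Q' (z n + - z m + (p m - p n))" by (simp add: algebra_simps)
    also have "\<dots> \<le> 3 * (Q' (z n) + Q' (- z m) + Q' (p m - p n))"
      unfolding Q'_def
      by (rule form_triangle[OF N(1)]) (auto intro!: z subspace_neg subspace_diff N pN Q)
    also have "\<dots> \<le> 3 * (1 / (real n + 1) + 1 / (real m + 1) + L * (norm (p n - p m))\<^sup>2)"
      using Qz[of n] Qz[of m] Qle[of "p m - p n"] by (simp add: Qneg norm_minus_commute)
    finally show ?thesis using L by (simp add: field_simps)
  qed
  have "Cauchy (\<lambda>n. z (r n) - p (r n))"
  proof (rule metric_CauchyI)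
    fix e :: real assume e: "e > 0"
    \<comment> \<open>Three terms of size at most \<open>d\<close> give
      \<open>(6 / L) * (3 * d)\<close>, which is three quarters of \<open>e\<^sup>2\<close>.\<close>
    define d where "d = L * e\<^sup>2 / 24"
    have d: "d > 0" using L e by (simp add: d_def)
    obtain N1 :: nat where N1: "1 / d < real N1" using reals_Archimedean2 by blast
    have "0 < real N1" using N1 d by (smt (verit) divide_pos_pos)
    then have N1': "1 / real N1 < d" using N1 d by (simp add: field_simps)
    have "sqrt (d / L) > 0" using d L by simp
    then obtain N2 where N2: "\<And>m n. m \<ge> N2 \<Longrightarrow> n \<ge> N2 \<Longrightarrow> norm (p (r n) - p (r m)) < sqrt (d / L)"
      using CauchyD[OF Cp] by blast
    show "\<exists>M. \<forall>m\<ge>M. \<forall>n\<ge>M. dist (z (r m) - p (r m)) (z (r n) - p (r n)) < e"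
    proof (intro exI allI impI)
      fix m n assume mn: "max N1 N2 \<le> m" "max N1 N2 \<le> n"
      have small: "1 / (real (r k) + 1) < d" if "max N1 N2 \<le> k" for k
      proof -
        have "N1 \<le> r k" using that seq_suble[OF r, of k] by simp
        then have "1 / (real (r k) + 1) \<le> 1 / real N1"
          using \<open>0 < real N1\<close> by (intro divide_left_mono) auto
        with N1' show ?thesis by simp
      qed
      have "(norm (p (r m) - p (r n)))\<^sup>2 \<le> (sqrt (d / L))\<^sup>2"
        using N2[of n m] mn by (intro power_mono) auto
      then have "L * (norm (p (r m) - p (r n)))\<^sup>2 \<le> d"
        using L d by (simp add: field_simps)
      then have "(norm ((z (r m) - p (r m)) - (z (r n) - p (r n))))\<^sup>2 \<le> (6 / L) * (d + d + d)"
        using small[OF mn(1)] small[OF mn(2)] L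
        by (intro order_trans[OF est] mult_left_mono) auto
      also have "\<dots> < e\<^sup>2" using L e by (simp add: d_def field_simps)
      finally show "dist (z (r m) - p (r m)) (z (r n) - p (r n)) < e"
        using e by (simp add: dist_norm power2_less_imp_less)
    qed
  qed
  with Cp have "convergent (\<lambda>n. (z (r n) - p (r n)) + p (r n))"
    by (intro convergent_add Cauchy_convergent)
  then obtain v where v: "(\<lambda>n. z (r n)) \<longlonglongrightarrow> v"
    by (auto simp: convergent_def)
  have vN: "v \<in> N" using closed_sequentially[OF N(2) _ v] z(1) by blast
  have "norm v = 1"
    using tendsto_norm[OF v] z(2) by (simp add: LIMSEQ_const_iff)
  have "L \<le> inner v (A v)"
  proof (rule LIMSEQ_le)
    show "(\<lambda>n. L - 1 / (real (r n) + 1)) \<longlonglongrightarrow> L"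
      using LIMSEQ_subseq_LIMSEQ[OF LIMSEQ_inverse_real_of_nat_add_minus[of L] r]
      by (simp add: o_def inverse_eq_divide add.commute)
    show "(\<lambda>n. inner (z (r n)) (A (z (r n)))) \<longlonglongrightarrow> inner v (A v)"
      by (intro tendsto_intros v A.tendsto)
    show "\<exists>N. \<forall>n\<ge>N. L - 1 / (real (r n) + 1) \<le> inner (z (r n)) (A (z (r n)))"
      using z(3) less_imp_le by blast
  qed
  then have "inner v (A v) = L * inner v v" using Q[OF vN] \<open>norm v = 1\<close> by (simp add: norm_eq_1)
  \<comment> \<open>\<open>v\<close> attains the supremum and is thus a null vector of
    \<open>L - A\<close> on \<open>N\<close>. As \<open>N\<close> is invariant,
    \<open>A v - L *\<^sub>R v\<close> lies in \<open>N\<close> and is also orthogonal to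
    \<open>N\<close>.\<close>
  from form_null[OF N(1) vN _ Q this]
  have "inner y (A v - L *\<^sub>R v) = 0" if "y \<in> N" for y
    using that by (simp add: inner_diff_right)
  moreover have "A v - L *\<^sub>R v \<in> N" using vN N by (intro subspace_diff subspace_scale) auto
  ultimately have "A v = L *\<^sub>R v" by (metis inner_eq_zero_iff right_minus_eq)
  then show ?thesis using vN \<open>norm v = 1\<close> by (intro bexI[of _ v]) auto
qed

text \<open>The orthogonal complement \<open>N\<close> of the eigenvectors is closed and invariant.
  A vector of \<open>N\<close> with positive form would yield an eigenvector in \<open>N\<close> by
  \<open>eigenvector_exists\<close>; a vector with zero form is in the kernel of the nonnegative
  \<open>A\<close>, hence an eigenvector itself. So \<open>N\<close> is trivial.\<close>

lemma eigenvectors_dense: "closure (span {x. \<exists>c. A x = c *\<^sub>R x}) = UNIV"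
proof -
  define E where "E = {x. \<exists>c. A x = c *\<^sub>R x}"
  define N where "N = {x. \<forall>e\<in>E. inner x e = 0}"
  have subN: "subspace N" by (auto simp: N_def subspace_def inner_add_left)
  have "closed N"
  proof -
    have "N = (\<Inter>e\<in>E. {x. inner x e = 0})" by (auto simp: N_def)
    moreover have "closed {x. inner x e = 0}" for e
      by (intro closed_Collect_eq continuous_intros)
    ultimately show ?thesis by auto
  qed
  have inv: "A x \<in> N" if "x \<in> N" for x
    using that by (auto simp: N_def E_def symmetric)
  have "x = 0" if x: "x \<in> N" for x
  proof (rule ccontr)
    assume x0: "x \<noteq> 0"
    have "inner x (A x) \<noteq> 0"
    proof
      assume 0: "inner x (A x) = 0"
      have "inner v (A x) = 0" for v
      proof (rule quadratic_nonneg_imp_zero[OF _ nonneg[of v]])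
        fix t
        have "0 \<le> inner (x + t *\<^sub>R v) (A (x + t *\<^sub>R v))" by (rule nonneg)
        moreover have "inner x (A v) = inner v (A x)" using symmetric by (simp add: inner_commute)
        ultimately show "0 \<le> 2 * t * inner v (A x) + t\<^sup>2 * inner v (A v)" using 0
          by (simp add: A.add A.scaleR inner_add_left inner_add_right power2_eq_square algebra_simps)
      qed
      then have "A x = 0" by (metis inner_eq_zero_iff)
      then have "x \<in> E" by (auto simp: E_def intro: exI[of _ 0])
      then show False using x x0 by (auto simp: N_def)
    qed
    then have "inner x (A x) > 0" using nonneg[of x] by simp
    from eigenvector_exists[OF subN \<open>closed N\<close> inv x this]
    obtain v where v: "v \<in> N" "v \<noteq> 0" "v \<in> E" by (auto simp: E_def)
    then have "inner v v = 0" unfolding N_def by blast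
    with v(2) show False by simp
  qed
  moreover have "x - proj_on (closure (span E)) x \<in> N" for x
    unfolding N_def
    by (auto intro!: proj_on_orthogonal closure_of_span_closed_subspace
        subsetD[OF closure_subset] span_base)
  ultimately have "x = proj_on (closure (span E)) x" for x by (metis right_minus_eq)
  then have "x \<in> closure (span E)" for x
    using proj_on_in[OF closure_of_span_closed_subspace] by metis
  then show ?thesis unfolding E_def by blast
qed

lemma diagonal_op_shift: "diagonal_op (\<lambda>x. A x - c *\<^sub>R x)"
proof (rule diagonal_op.intro)
  show "bounded_linear (\<lambda>x. A x - c *\<^sub>R x)"
    by (intro bounded_linear_sub bounded_linear_A bounded_linear_scaleR_right)
  show "inner (A x - c *\<^sub>R x) y = inner x (A y - c *\<^sub>R y)" for x y
    by (simp add: inner_diff_left inner_diff_right symmetric)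
  have "(\<exists>d. A x = d *\<^sub>R x) \<longleftrightarrow> (\<exists>d. A x - c *\<^sub>R x = d *\<^sub>R x)" for x
  proof safe
    fix d
    show "\<exists>e. A x - c *\<^sub>R x = e *\<^sub>R x" if "A x = d *\<^sub>R x"
      using that by (intro exI[of _ "d - c"]) (simp add: scaleR_diff_left)
    show "\<exists>e. A x = e *\<^sub>R x" if "A x - c *\<^sub>R x = d *\<^sub>R x"
      using that by (intro exI[of _ "d + c"]) (simp add: scaleR_add_left diff_eq_eq)
  qed
  then show "closure (span {x. \<exists>d. A x - c *\<^sub>R x = d *\<^sub>R x}) = UNIV"
    using eigenvectors_dense by simp
qed

end

section \<open>The quotient Hilbert space\<close>

lemma L2_measurable: "u \<in> L2 \<Longrightarrow> u \<in> borel_measurable lebesgue"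
  and L2_integrable: "u \<in> L2 \<Longrightarrow> integrable lebesgue (\<lambda>x. (cmod (u x))\<^sup>2)"
  by (auto simp: L2_def)

lemma L2_bound:
  assumes "v \<in> borel_measurable lebesgue" "integrable lebesgue g"
    "AE x in lebesgue. (cmod (v x))\<^sup>2 \<le> g x"
  shows "v \<in> L2"
proof -
  have "integrable lebesgue (\<lambda>x. (cmod (v x))\<^sup>2)"
    by (rule Bochner_Integration.integrable_bound[OF assms(2)])
      (use assms in \<open>auto elim!: eventually_mono\<close>)
  then show ?thesis using assms(1) by (simp add: L2_def)
qed

lemma L2_0: "(\<lambda>x. 0) \<in> L2"
  by (auto simp: L2_def)

lemma L2_add: "u \<in> L2 \<Longrightarrow> v \<in> L2 \<Longrightarrow> (\<lambda>x. u x + v x) \<in> L2"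
proof (rule L2_bound[where g = "\<lambda>x. 2 * (cmod (u x))\<^sup>2 + 2 * (cmod (v x))\<^sup>2"])
  have "(cmod (a + b))\<^sup>2 \<le> 2 * (cmod a)\<^sup>2 + 2 * (cmod b)\<^sup>2" for a b :: complex
  proof -
    have "(cmod (a + b))\<^sup>2 \<le> (cmod a + cmod b)\<^sup>2"
      by (intro power_mono norm_triangle_ineq) auto
    also have "\<dots> \<le> 2 * (cmod a)\<^sup>2 + 2 * (cmod b)\<^sup>2"
      using zero_le_power2[of "cmod a - cmod b"] by (simp add: power2_eq_square algebra_simps)
    finally show ?thesis .
  qed
  then show "AE x in lebesgue. (cmod (u x + v x))\<^sup>2 \<le> 2 * (cmod (u x))\<^sup>2 + 2 * (cmod (v x))\<^sup>2"
    by simp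
qed (auto intro!: borel_measurable_add simp: L2_def)

lemma L2_cmult: "u \<in> L2 \<Longrightarrow> (\<lambda>x. c * u x) \<in> L2"
  by (auto simp: L2_def norm_mult power_mult_distrib)

lemma L2_minus: "u \<in> L2 \<Longrightarrow> (\<lambda>x. - u x) \<in> L2"
  using L2_cmult[of u "-1"] by simp

lemma L2_diff: "u \<in> L2 \<Longrightarrow> v \<in> L2 \<Longrightarrow> (\<lambda>x. u x - v x) \<in> L2"
  using L2_add[OF _ L2_minus[of v], of u] by simp

lemma L2_scaleR: "u \<in> L2 \<Longrightarrow> (\<lambda>x. r *\<^sub>R u x) \<in> L2"
  using L2_cmult[of u "of_real r"] by (simp add: scaleR_conv_of_real)

lemma L2_norm: "u \<in> L2 \<Longrightarrow> (\<lambda>x. complex_of_real (cmod (u x))) \<in> L2"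
  by (auto simp: L2_def intro!: borel_measurable_of_real borel_measurable_norm)

lemma L2_sum: "(\<And>i. i \<in> I \<Longrightarrow> f i \<in> L2) \<Longrightarrow> (\<lambda>x. \<Sum>i\<in>I. f i x) \<in> L2"
  by (induction I rule: infinite_finite_induct) (auto intro: L2_0 L2_add)

lemma L2_ae_eq: "u \<in> L2 \<Longrightarrow> v \<in> borel_measurable lebesgue \<Longrightarrow> ae_eq u v \<Longrightarrow> v \<in> L2"
  by (rule L2_bound[where g = "\<lambda>x. (cmod (u x))\<^sup>2"])
    (auto simp: L2_def ae_eq_def elim!: eventually_mono)

lemma integrable_inner_L2:
  assumes "u \<in> L2" "v \<in> L2"
  shows "integrable lebesgue (\<lambda>x. cnj (u x) * v x)"
proof (rule Bochner_Integration.integrable_bound[where f="\<lambda>x. (cmod (u x))\<^sup>2 + (cmod (v x))\<^sup>2"])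
  have "a * b \<le> a\<^sup>2 + b\<^sup>2" if "a \<ge> 0" "b \<ge> 0" for a b :: real
  proof -
    have "2 * (a * b) \<le> a\<^sup>2 + b\<^sup>2"
      using zero_le_power2[of "a - b"] by (simp add: power2_eq_square algebra_simps)
    moreover have "0 \<le> a * b" using that by simp
    ultimately show ?thesis by linarith
  qed
  then show "AE x in lebesgue. norm (cnj (u x) * v x) \<le> norm ((cmod (u x))\<^sup>2 + (cmod (v x))\<^sup>2)"
    by (simp add: norm_mult)
  show "integrable lebesgue (\<lambda>x. (cmod (u x))\<^sup>2 + (cmod (v x))\<^sup>2)"
    using assms by (intro Bochner_Integration.integrable_add L2_integrable)
  show "(\<lambda>x. cnj (u x) * v x) \<in> borel_measurable lebesgue"
    using L2_measurable[OF assms(1)] L2_measurable[OF assms(2)]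
    by (intro borel_measurable_times) (auto intro: measurable_compose simp: borel_measurable_continuous_onI)
qed

lemma ae_eq_refl [simp]: "ae_eq u u"
  and ae_eq_sym: "ae_eq u v \<Longrightarrow> ae_eq v u"
  by (auto simp: ae_eq_def elim: eventually_mono)

lemma ae_eq_trans: "ae_eq u v \<Longrightarrow> ae_eq v w \<Longrightarrow> ae_eq u w"
  unfolding ae_eq_def by (erule (1) eventually_elim2) simp

\<comment> \<open>Only square-integrable functions have a class, so the quotient is partial. Classes
  turn almost everywhere equality into equality, which the type classes for Hilbert spaces
  presuppose.\<close>
quotient_type 'n l2 = "'n::finite wave" / partial: "\<lambda>u v. u \<in> L2 \<and> v \<in> L2 \<and> ae_eq u v"
proof (rule part_equivpI)
  show "\<exists>u :: 'n wave. u \<in> L2 \<and> u \<in> L2 \<and> ae_eq u u"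
    by (rule exI[of _ "\<lambda>x. 0"]) (simp add: L2_0)
qed (auto simp: symp_def transp_def intro: ae_eq_sym ae_eq_trans)

abbreviation cls :: "'n::finite wave \<Rightarrow> 'n l2" where "cls \<equiv> abs_l2"
abbreviation rep :: "'n::finite l2 \<Rightarrow> 'n wave" where "rep \<equiv> rep_l2"

lemma rep_L2 [simp, intro]: "rep x \<in> L2"
  using Quotient_rep_reflp[OF Quotient_l2, of x] by simp

lemma cls_rep [simp]: "cls (rep x) = x"
  by (rule Quotient_abs_rep[OF Quotient_l2])

lemma cls_eq_iff: "u \<in> L2 \<Longrightarrow> v \<in> L2 \<Longrightarrow> cls u = cls v \<longleftrightarrow> ae_eq u v"
  using Quotient_rel[OF Quotient_l2, of u v] by auto

lemma cls_eqI: "u \<in> L2 \<Longrightarrow> v \<in> L2 \<Longrightarrow> (AE x in lebesgue. u x = v x) \<Longrightarrow> cls u = cls v"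
  by (simp add: cls_eq_iff ae_eq_def)

lemma rep_cls: "u \<in> L2 \<Longrightarrow> ae_eq (rep (cls u)) u"
  by (simp add: cls_eq_iff[symmetric])

lemma AE_rep_cls: "u \<in> L2 \<Longrightarrow> AE x in lebesgue. rep (cls u) x = u x"
  using rep_cls ae_eq_def by blast

lemma cls_cases [cases type: l2]: obtains u where "x = cls u" "u \<in> L2"
  using rep_L2 cls_rep by metis

lemma l2_inner_cong:
  assumes "ae_eq u u'" "ae_eq v v'" "u \<in> L2" "v \<in> L2" "u' \<in> L2" "v' \<in> L2"
  shows "l2_inner u v = l2_inner u' v'"
  unfolding l2_inner_def
proof (rule integral_cong_AE)
  show "AE x in lebesgue. cnj (u x) * v x = cnj (u' x) * v' x"
    using assms(1,2) unfolding ae_eq_def by eventually_elim simp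
qed (intro borel_measurable_integrable integrable_inner_L2 assms)+

lemma l2_inner_commute: "l2_inner v u = cnj (l2_inner u v)"
proof -
  have "cnj (l2_inner u v) = (LINT x|lebesgue. cnj (cnj (u x) * v x))"
    unfolding l2_inner_def by (rule Bochner_Integration.integral_cnj[symmetric])
  then show ?thesis by (simp add: l2_inner_def mult.commute)
qed

lemma l2_inner_self: "l2_inner u u = of_real (LINT x|lebesgue. (cmod (u x))\<^sup>2)"
proof -
  have "cnj (u x) * u x = of_real ((cmod (u x))\<^sup>2)" for x
    by (simp only: complex_norm_square mult.commute)
  then show ?thesis unfolding l2_inner_def by (simp only: integral_complex_of_real)
qed

lemma l2_inner_add_left: "u \<in> L2 \<Longrightarrow> v \<in> L2 \<Longrightarrow> w \<in> L2 \<Longrightarrow>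
    l2_inner (\<lambda>x. u x + v x) w = l2_inner u w + l2_inner v w"
  unfolding l2_inner_def by (simp add: distrib_right integrable_inner_L2)

lemma l2_inner_cmult_left: "l2_inner (\<lambda>x. c * u x) w = cnj c * l2_inner u w"
  unfolding l2_inner_def by (simp add: mult.assoc)

lemma l2_inner_cmult_right: "l2_inner u (\<lambda>x. c * w x) = c * l2_inner u w"
  unfolding l2_inner_def by (simp add: mult.left_commute)

text \<open>The quotient is made a real Hilbert space, with the real part of the complex inner product.
  The complex structure is recovered below from the operator \<open>J\<close> of multiplication by $i$: since
  $\langle \cdot, \cdot \rangle$ is antilinear in its first argument,
  $\mathrm{Im} \langle x, y \rangle = \mathrm{Re} \langle J x, y \rangle$.\<close>

instantiation l2 :: (finite) real_inner
begin

definition zero_l2 :: "'a l2" where "0 = cls (\<lambda>x. 0)"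
definition plus_l2 :: "'a l2 \<Rightarrow> 'a l2 \<Rightarrow> 'a l2" where "x + y = cls (\<lambda>t. rep x t + rep y t)"
definition minus_l2 :: "'a l2 \<Rightarrow> 'a l2 \<Rightarrow> 'a l2" where "x - y = cls (\<lambda>t. rep x t - rep y t)"
definition uminus_l2 :: "'a l2 \<Rightarrow> 'a l2" where "- x = cls (\<lambda>t. - rep x t)"
definition scaleR_l2 :: "real \<Rightarrow> 'a l2 \<Rightarrow> 'a l2" where "scaleR_l2 r x = cls (\<lambda>t. r *\<^sub>R rep x t)"
definition inner_l2 :: "'a l2 \<Rightarrow> 'a l2 \<Rightarrow> real" where "inner x y = Re (l2_inner (rep x) (rep y))"
definition norm_l2 :: "'a l2 \<Rightarrow> real" where "norm_l2 x = l2_norm (rep x)"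
definition sgn_l2 :: "'a l2 \<Rightarrow> 'a l2" where "sgn_l2 x = cls (\<lambda>t. inverse (l2_norm (rep x)) *\<^sub>R rep x t)"
definition dist_l2 :: "'a l2 \<Rightarrow> 'a l2 \<Rightarrow> real" where "dist_l2 x y = l2_norm (rep (x - y))"
definition uniformity_l2 :: "('a l2 \<times> 'a l2) filter"
  where "uniformity = (INF e\<in>{0 <..}. principal {(x, y). l2_norm (rep (x - y)) < e})"
definition open_l2 :: "'a l2 set \<Rightarrow> bool"
  where "open_l2 U \<longleftrightarrow> (\<forall>x\<in>U. \<forall>\<^sub>F (x', y) in
    (INF e\<in>{0 <..}. principal {(x, y). l2_norm (rep (x - y)) < e}). x' = x \<longrightarrow> y \<in> U)"

lemma cls_add: "u \<in> L2 \<Longrightarrow> v \<in> L2 \<Longrightarrow> cls u + cls v = cls (\<lambda>x. u x + v x)"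
  unfolding plus_l2_def
  by (rule cls_eqI) (auto intro!: L2_add elim: eventually_elim2[OF AE_rep_cls AE_rep_cls])

lemma cls_diff: "u \<in> L2 \<Longrightarrow> v \<in> L2 \<Longrightarrow> cls u - cls v = cls (\<lambda>x. u x - v x)"
  unfolding minus_l2_def
  by (rule cls_eqI) (auto intro!: L2_diff elim: eventually_elim2[OF AE_rep_cls AE_rep_cls])

lemma cls_minus: "u \<in> L2 \<Longrightarrow> - cls u = cls (\<lambda>x. - u x)"
  unfolding uminus_l2_def
  by (rule cls_eqI) (auto intro!: L2_minus elim: eventually_mono[OF AE_rep_cls])

lemma cls_scaleR: "u \<in> L2 \<Longrightarrow> r *\<^sub>R cls u = cls (\<lambda>x. r *\<^sub>R u x)"
  unfolding scaleR_l2_def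
  by (rule cls_eqI) (auto intro!: L2_scaleR elim: eventually_mono[OF AE_rep_cls])

lemma inner_cls: "u \<in> L2 \<Longrightarrow> v \<in> L2 \<Longrightarrow> inner (cls u) (cls v) = Re (l2_inner u v)"
  unfolding inner_l2_def using l2_inner_cong[OF rep_cls rep_cls] by (metis rep_L2)

instance
proof
  fix x y z :: "'a l2" and r s :: real
  show "x + y + z = x + (y + z)"
    by (cases x; cases y; cases z) (simp add: cls_add L2_add add.assoc)
  show "x + y = y + x"
    by (cases x; cases y) (simp add: cls_add add.commute)
  show "0 + x = x"
    by (cases x) (simp add: zero_l2_def cls_add L2_0)
  show "- x + x = 0"
    by (cases x) (simp add: zero_l2_def cls_add cls_minus L2_minus)
  show "x - y = x + - y"
    by (cases x; cases y) (simp add: cls_add cls_minus cls_diff L2_minus)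
  show "r *\<^sub>R (x + y) = r *\<^sub>R x + r *\<^sub>R y"
    by (cases x; cases y) (simp add: cls_add cls_scaleR L2_scaleR L2_add scaleR_add_right)
  show "(r + s) *\<^sub>R x = r *\<^sub>R x + s *\<^sub>R x"
    by (cases x) (simp add: cls_add cls_scaleR L2_scaleR L2_add scaleR_add_left)
  show "r *\<^sub>R s *\<^sub>R x = (r * s) *\<^sub>R x"
    by (cases x) (simp add: cls_scaleR L2_scaleR)
  show "1 *\<^sub>R x = x"
    by (cases x) (simp add: cls_scaleR L2_scaleR)
  show "inner x y = inner y x"
    unfolding inner_l2_def by (subst l2_inner_commute) simp
  show "inner (x + y) z = inner x z + inner y z"
    by (cases x; cases y; cases z) (simp add: cls_add inner_cls L2_add l2_inner_add_left)
  show "inner (r *\<^sub>R x) y = r * inner x y"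
    by (cases x; cases y)
      (simp add: cls_scaleR inner_cls L2_scaleR scaleR_conv_of_real l2_inner_cmult_left L2_cmult)
  show "0 \<le> inner x x"
    unfolding inner_l2_def l2_inner_self by simp
  show "inner x x = 0 \<longleftrightarrow> x = 0"
  proof (cases x)
    case (1 u)
    have "inner x x = 0 \<longleftrightarrow> (LINT x|lebesgue. (cmod (u x))\<^sup>2) = 0"
      unfolding 1 by (simp add: inner_cls 1 l2_inner_self)
    also have "\<dots> \<longleftrightarrow> (AE x in lebesgue. (cmod (u x))\<^sup>2 = 0)"
      by (rule integral_nonneg_eq_0_iff_AE) (auto intro: L2_integrable 1)
    also have "\<dots> \<longleftrightarrow> x = 0"
      unfolding 1 zero_l2_def by (simp add: cls_eq_iff 1 L2_0 ae_eq_def)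
    finally show ?thesis .
  qed
  show "dist x y = norm (x - y)"
    unfolding dist_l2_def norm_l2_def ..
  show "norm x = sqrt (inner x x)"
    unfolding norm_l2_def inner_l2_def by (simp add: l2_norm_def l2_inner_self)
  show "sgn x = inverse (norm x) *\<^sub>R x"
    unfolding sgn_l2_def norm_l2_def scaleR_l2_def ..
  show "uniformity = (INF e\<in>{0<..}. principal {(x :: 'a l2, y). dist x y < e})"
    unfolding uniformity_l2_def dist_l2_def ..
  show "open U \<longleftrightarrow> (\<forall>x\<in>U. \<forall>\<^sub>F (x', y) in uniformity. x' = x \<longrightarrow> y \<in> U)" for U :: "'a l2 set"
    unfolding open_l2_def uniformity_l2_def ..
qed

end

lemma norm_cls: "u \<in> L2 \<Longrightarrow> norm (cls u) = l2_norm u"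
  by (simp add: norm_eq_sqrt_inner inner_cls l2_inner_self l2_norm_def)

lemma norm_cls_power2: "u \<in> L2 \<Longrightarrow> (norm (cls u))\<^sup>2 = (LINT x|lebesgue. (cmod (u x))\<^sup>2)"
  by (simp add: power2_norm_eq_inner inner_cls l2_inner_self)

lemma nn_integral_L2: "u \<in> L2 \<Longrightarrow> (\<integral>\<^sup>+x. ennreal ((cmod (u x))\<^sup>2) \<partial>lebesgue) = ennreal ((norm (cls u))\<^sup>2)"
  by (simp add: norm_cls_power2 nn_integral_eq_integral L2_integrable)

lemma L2_I_nn_integral:
  assumes "u \<in> borel_measurable lebesgue" "(\<integral>\<^sup>+x. ennreal ((cmod (u x))\<^sup>2) \<partial>lebesgue) < \<infinity>"
  shows "u \<in> L2"
  unfolding L2_def using assms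
  by (auto intro!: integrableI_bounded borel_measurable_power borel_measurable_norm)

lemma norm_cls_le:
  assumes "u \<in> L2" "(\<integral>\<^sup>+x. ennreal ((cmod (u x))\<^sup>2) \<partial>lebesgue) \<le> ennreal (C\<^sup>2)" "C \<ge> 0"
  shows "norm (cls u) \<le> C"
proof (rule power2_le_imp_le)
  show "(norm (cls u))\<^sup>2 \<le> C\<^sup>2"
    using assms(2) unfolding nn_integral_L2[OF assms(1)] by (subst (asm) ennreal_le_iff) auto
qed fact

lemma cls_sum: "(\<And>i. i \<in> I \<Longrightarrow> f i \<in> L2) \<Longrightarrow> (\<Sum>i\<in>I. cls (f i)) = cls (\<lambda>x. \<Sum>i\<in>I. f i x)"
  by (induction I rule: infinite_finite_induct) (auto simp: zero_l2_def cls_add L2_sum)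

lemma L2_tendsto_iff:
  "L2_tendsto f u \<longleftrightarrow> (\<forall>n. f n \<in> L2) \<and> u \<in> L2 \<and> (\<lambda>n. cls (f n)) \<longlonglongrightarrow> cls u"
proof -
  have "(\<lambda>n. l2_norm (\<lambda>x. f n x - u x)) \<longlonglongrightarrow> 0 \<longleftrightarrow> (\<lambda>n. cls (f n)) \<longlonglongrightarrow> cls u"
    if "\<forall>n. f n \<in> L2" "u \<in> L2"
  proof -
    have "l2_norm (\<lambda>x. f n x - u x) = dist (cls (f n)) (cls u)" for n
      using that by (simp add: dist_norm cls_diff norm_cls L2_diff)
    then show ?thesis by (simp add: tendsto_dist_iff[of _ "cls u"])
  qed
  then show ?thesis unfolding L2_tendsto_def by blast
qed

text \<open>Riesz--Fischer: a rapidly Cauchy subsequence converges almost everywhere, and by Fatou's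
  lemma its pointwise limit is the limit in the mean of the whole sequence.\<close>

instance l2 :: (finite) complete_space
proof
  fix X :: "nat \<Rightarrow> 'a l2"
  assume X: "Cauchy X"
  have "\<exists>N. \<forall>m\<ge>N. \<forall>n\<ge>N. norm (X m - X n) < (1/2) ^ k" for k
    using CauchyD[OF X, of "(1/2)^k"] by simp
  then obtain M where M: "\<And>k m n. m \<ge> M k \<Longrightarrow> n \<ge> M k \<Longrightarrow> norm (X m - X n) < (1/2) ^ k"
    by metis
  \<comment> \<open>Summing the \<open>M i\<close>, instead of taking \<open>M k\<close> itself,
    makes \<open>r k\<close> at least every \<open>M j\<close> with
    \<open>j \<le> k\<close>.\<close>
  define r where "r k = (\<Sum>i\<le>k. M i)" for k
  have r: "M k \<le> r k" "M k \<le> r (Suc k)" for k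
    unfolding r_def by (auto intro: member_le_sum trans_le_add1)
  define u where "u n = rep (X n)" for n
  define d where "d k x = u (r (Suc k)) x - u (r k) x" for k x
  have uL: "u n \<in> L2" for n by (simp add: u_def)
  have dL: "d k \<in> L2" for k unfolding d_def by (intro L2_diff uL)
  have [measurable]: "u n \<in> borel_measurable lebesgue" "d n \<in> borel_measurable lebesgue" for n
    using uL dL L2_measurable by auto
  have nd: "norm (cls (d k)) \<le> (1/2) ^ k" for k
  proof -
    have "cls (d k) = X (r (Suc k)) - X (r k)"
      unfolding d_def using uL by (simp add: cls_diff[symmetric]) (simp add: u_def)
    then show ?thesis using M[OF r(2) r(1), of k] by simp
  qed
  \<comment> \<open>Partial sums of the absolute increments. Their norms are at most 2, the sum of
    the geometric series, so by monotone convergence the full series is finite almost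
    everywhere.\<close>
  define S where "S N x = (\<Sum>k<N. cmod (d k x))" for N x
  have SL: "(\<lambda>x. complex_of_real (S N x)) \<in> L2" for N
    unfolding S_def of_real_sum by (intro L2_sum L2_norm dL)
  have [measurable]: "S n \<in> borel_measurable lebesgue" for n
    unfolding S_def by measurable
  have "norm (cls (\<lambda>x. complex_of_real (S N x))) \<le> 2" for N
  proof -
    have "cls (\<lambda>x. complex_of_real (S N x)) = (\<Sum>k<N. cls (\<lambda>x. complex_of_real (cmod (d k x))))"
      unfolding S_def of_real_sum by (rule cls_sum[symmetric]) (intro L2_norm dL)
    also have "norm \<dots> \<le> (\<Sum>k<N. norm (cls (\<lambda>x. complex_of_real (cmod (d k x)))))"
      by (rule norm_sum)
    also have "\<dots> = (\<Sum>k<N. norm (cls (d k)))"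
      by (simp add: norm_cls L2_norm dL l2_norm_def)
    also have "\<dots> \<le> (\<Sum>k<N. (1/2) ^ k)" by (intro sum_mono nd)
    also have "\<dots> \<le> 2" by (simp add: geometric_sum)
    finally show ?thesis .
  qed
  then have nS: "norm (cls (\<lambda>x. complex_of_real (S N x))) \<le> 2" for N .
  have S_le: "(\<integral>\<^sup>+x. ennreal ((S N x)\<^sup>2) \<partial>lebesgue) \<le> 4" for N
  proof -
    have "(\<integral>\<^sup>+x. ennreal ((S N x)\<^sup>2) \<partial>lebesgue)
        = (\<integral>\<^sup>+x. ennreal ((cmod (complex_of_real (S N x)))\<^sup>2) \<partial>lebesgue)"
      unfolding norm_of_real power2_abs ..
    also have "\<dots> = ennreal ((norm (cls (\<lambda>x. complex_of_real (S N x))))\<^sup>2)"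
      by (rule nn_integral_L2[OF SL])
    also have "\<dots> \<le> ennreal (2\<^sup>2)" by (intro ennreal_leI power_mono nS) auto
    finally show ?thesis by simp
  qed
  have "(\<integral>\<^sup>+x. (SUP N. ennreal ((S N x)\<^sup>2)) \<partial>lebesgue) = (SUP N. (\<integral>\<^sup>+x. ennreal ((S N x)\<^sup>2) \<partial>lebesgue))"
  proof (rule nn_integral_monotone_convergence_SUP)
    show "incseq (\<lambda>N x. ennreal ((S N x)\<^sup>2))"
      by (intro incseq_SucI le_funI ennreal_leI power_mono) (auto simp: S_def sum_nonneg)
  qed measurable
  also have "\<dots> \<le> 4" by (intro SUP_least S_le)
  finally have "(\<integral>\<^sup>+x. (SUP N. ennreal ((S N x)\<^sup>2)) \<partial>lebesgue) \<noteq> \<infinity>"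
    by (auto simp: top_unique)
  from nn_integral_PInf_AE[OF _ this]
  have "AE x in lebesgue. (SUP N. ennreal ((S N x)\<^sup>2)) \<noteq> \<infinity>" by simp
  then have AE: "AE x in lebesgue. convergent (\<lambda>k. u (r k) x)"
  proof eventually_elim
    case (elim x)
    then obtain c where c: "(SUP N. ennreal ((S N x)\<^sup>2)) = ennreal c" "c \<ge> 0"
      by (metis ennreal_cases infinity_ennreal_def)
    have "S N x \<le> sqrt c" for N
    proof -
      have "ennreal ((S N x)\<^sup>2) \<le> ennreal c" unfolding c(1)[symmetric] by (rule SUP_upper) simp
      then show ?thesis using c(2) by (simp add: real_le_rsqrt)
    qed
    then have "summable (\<lambda>k. cmod (d k x))"
      unfolding S_def by (intro summableI_nonneg_bounded[where x="sqrt c"]) auto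
    then have "summable (\<lambda>k. d k x)" by (rule summable_norm_cancel)
    then have "convergent (\<lambda>N. u (r 0) x + (\<Sum>k<N. d k x))"
      by (intro convergent_add convergent_const) (simp add: summable_iff_convergent)
    moreover have "u (r 0) x + (\<Sum>k<N. d k x) = u (r N) x" for N
      unfolding d_def by (simp add: sum_lessThan_telescope[of "\<lambda>k. u (r k) x"])
    ultimately show ?case by simp
  qed
  define l where "l x = lim (\<lambda>k. u (r k) x)" for x
  have [measurable]: "l \<in> borel_measurable lebesgue"
    unfolding l_def by (rule borel_measurable_lim_metric) measurable
  have lim: "AE x in lebesgue. (\<lambda>k. u (r k) x) \<longlonglongrightarrow> l x"
    using AE unfolding l_def by eventually_elim (simp add: convergent_LIMSEQ_iff)
  have r_ge: "k \<ge> j \<Longrightarrow> r k \<ge> M j" for j k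
    using member_le_sum[of j "{..k}" M] unfolding r_def by simp
  have est: "(\<integral>\<^sup>+x. ennreal ((cmod (l x - u n x))\<^sup>2) \<partial>lebesgue) \<le> ennreal (((1/2) ^ j)\<^sup>2)"
    if n: "n \<ge> M j" for n j
  proof -
    have "(\<integral>\<^sup>+x. ennreal ((cmod (l x - u n x))\<^sup>2) \<partial>lebesgue)
        = (\<integral>\<^sup>+x. liminf (\<lambda>k. ennreal ((cmod (u (r k) x - u n x))\<^sup>2)) \<partial>lebesgue)"
    proof (rule nn_integral_cong_AE)
      show "AE x in lebesgue. ennreal ((cmod (l x - u n x))\<^sup>2)
          = liminf (\<lambda>k. ennreal ((cmod (u (r k) x - u n x))\<^sup>2))"
        using lim
      proof eventually_elim
        case (elim x)
        then have "(\<lambda>k. ennreal ((cmod (u (r k) x - u n x))\<^sup>2)) \<longlonglongrightarrow> ennreal ((cmod (l x - u n x))\<^sup>2)"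
          by (intro tendsto_intros) auto
        then show ?case by (rule lim_imp_Liminf[OF trivial_limit_sequentially, symmetric])
      qed
    qed
    also have "\<dots> \<le> liminf (\<lambda>k. (\<integral>\<^sup>+x. ennreal ((cmod (u (r k) x - u n x))\<^sup>2) \<partial>lebesgue))"
      by (rule nn_integral_liminf) measurable
    also have "\<dots> \<le> ennreal (((1/2) ^ j)\<^sup>2)"
    proof (rule Liminf_le)
      show "\<forall>\<^sub>F k in sequentially. (\<integral>\<^sup>+x. ennreal ((cmod (u (r k) x - u n x))\<^sup>2) \<partial>lebesgue)
          \<le> ennreal (((1/2) ^ j)\<^sup>2)"
        unfolding eventually_sequentially
      proof (intro exI allI impI)
        fix k assume "j \<le> k"
        then have "norm (X (r k) - X n) < (1/2) ^ j" using M n r_ge by simp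
        moreover have "cls (\<lambda>x. u (r k) x - u n x) = X (r k) - X n"
          using cls_diff[OF uL uL] by (simp add: u_def)
        ultimately show "(\<integral>\<^sup>+x. ennreal ((cmod (u (r k) x - u n x))\<^sup>2) \<partial>lebesgue) \<le> ennreal (((1/2) ^ j)\<^sup>2)"
          using nn_integral_L2[OF L2_diff[OF uL uL], of "r k" n]
          by (auto intro!: ennreal_leI power_mono)
      qed
    qed simp
    finally show ?thesis .
  qed
  have diffL: "(\<lambda>x. l x - u n x) \<in> L2" if "n \<ge> M j" for n j
    by (intro L2_I_nn_integral le_less_trans[OF est[OF that]]) measurable
  from L2_add[OF diffL[of 0 "M 0"] uL[of "M 0"]] have lL: "l \<in> L2" by simp
  have "X \<longlonglongrightarrow> cls l"
  proof (rule LIMSEQ_I)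
    fix e :: real assume "e > 0"
    then obtain j where j: "(1/2) ^ j < e"
      using real_arch_pow_inv[of e "1/2"] by auto
    have "norm (X n - cls l) < e" if n: "n \<ge> M j" for n
    proof -
      have "cls l - X n = cls (\<lambda>x. l x - u n x)"
        using cls_diff[OF lL uL, of n] by (simp add: u_def)
      then have "norm (X n - cls l) \<le> (1/2) ^ j"
        using norm_cls_le[OF diffL[OF n] est[OF n]] by (simp add: norm_minus_commute)
      then show ?thesis using j by simp
    qed
    then show "\<exists>N. \<forall>n\<ge>N. norm (X n - cls l) < e" by blast
  qed
  then show "convergent X" by (auto simp: convergent_def)
qed

section \<open>The complex structure of the quotient space\<close>

definition J :: "'n::finite l2 \<Rightarrow> 'n l2" where
  "J x = cls (\<lambda>t. \<i> * rep x t)"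

lemma J_cls: "u \<in> L2 \<Longrightarrow> J (cls u) = cls (\<lambda>x. \<i> * u x)"
  unfolding J_def by (rule cls_eqI) (auto intro!: L2_cmult elim: eventually_mono[OF AE_rep_cls])

lemma inner_J: "inner (J x) (J y) = inner x y"
  by (cases x; cases y)
    (simp add: J_cls inner_cls L2_cmult l2_inner_cmult_left l2_inner_cmult_right)

lemma norm_J [simp]: "norm (J x) = norm x"
  by (simp add: norm_eq_sqrt_inner inner_J)

lemma bounded_linear_J: "bounded_linear J"
proof (rule bounded_linear_intro[where K=1])
  fix x y :: "'a l2" and r :: real
  show "J (x + y) = J x + J y"
    by (cases x; cases y) (simp add: J_cls cls_add L2_add L2_cmult distrib_left)
  show "J (r *\<^sub>R x) = r *\<^sub>R J x"
    by (cases x) (simp add: J_cls cls_scaleR L2_scaleR L2_cmult mult.left_commute)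
qed simp

lemma J_J: "J (J x) = - x"
  by (cases x) (simp add: J_cls L2_cmult cls_minus flip: mult.assoc)

definition cinner :: "'n::finite l2 \<Rightarrow> 'n l2 \<Rightarrow> complex" where
  "cinner x y = Complex (inner x y) (inner (J x) y)"

lemma cinner_cls:
  assumes "u \<in> L2" "v \<in> L2"
  shows "cinner (cls u) (cls v) = l2_inner u v"
  using assms
  by (simp add: cinner_def J_cls inner_cls L2_cmult l2_inner_cmult_left complex_eq_iff)

section \<open>The Gaussian kernel\<close>

text \<open>The centred Gaussian probability density with standard deviation \<sigma> in every
  direction; the product form lets its integrals factor over the coordinates.\<close>

definition gauss :: "real \<Rightarrow> 'a::euclidean_space \<Rightarrow> real" where
  "gauss \<sigma> x = (\<Prod>b\<in>Basis. normal_density 0 \<sigma> (x \<bullet> b))"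

lemma gauss_eq:
  assumes "\<sigma> > 0"
  shows "gauss \<sigma> (x :: 'a::euclidean_space)
    = exp (- (norm x)\<^sup>2 / (2 * \<sigma>\<^sup>2)) / (sqrt (2 * pi) * \<sigma>) ^ DIM('a)"
proof -
  have "gauss \<sigma> x = (\<Prod>b\<in>Basis. exp (- (x \<bullet> b)\<^sup>2 / (2 * \<sigma>\<^sup>2)) / (sqrt (2 * pi) * \<sigma>))"
    using assms unfolding gauss_def normal_density_def by (simp add: real_sqrt_mult)
  also have "\<dots> = exp (\<Sum>b\<in>Basis. - (x \<bullet> b)\<^sup>2 / (2 * \<sigma>\<^sup>2)) / (sqrt (2 * pi) * \<sigma>) ^ DIM('a)"
    by (simp add: prod_dividef exp_sum)
  also have "(\<Sum>b\<in>Basis. - (x \<bullet> b)\<^sup>2 / (2 * \<sigma>\<^sup>2)) = - (norm x)\<^sup>2 / (2 * \<sigma>\<^sup>2)"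
    unfolding power2_norm_eq_inner euclidean_inner[of x x]
    by (simp add: sum_divide_distrib[symmetric] sum_negf power2_eq_square)
  finally show ?thesis .
qed

lemma gauss_nonneg: "gauss \<sigma> x \<ge> 0"
  unfolding gauss_def by (intro prod_nonneg) simp

lemma gauss_minus_commute: "gauss \<sigma> (x - y) = gauss \<sigma> (y - x)"
  unfolding gauss_def normal_density_def by (simp add: inner_diff_left power2_commute)

lemma borel_measurable_gauss [measurable]: "gauss \<sigma> \<in> borel_measurable borel"
  unfolding gauss_def by measurable

lemma integral_cis_normal_density:
  assumes "\<sigma> > 0"
  shows "integrable lborel (\<lambda>x. cis (t * x) * normal_density 0 \<sigma> x)"
    and "(LINT x|lborel. cis (t * x) * normal_density 0 \<sigma> x) = exp (- (\<sigma> * t)\<^sup>2 / 2)"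
proof -
  have int: "integrable lborel (normal_density 0 \<sigma>)"
    using assms by simp
  have "integrable lborel (\<lambda>x. normal_density 0 \<sigma> x *\<^sub>R cis (t * x))"
    by (rule Bochner_Integration.integrable_bound[OF int])
      (auto simp: cis_conv_exp intro!: borel_measurable_scaleR)
  then show "integrable lborel (\<lambda>x. cis (t * x) * normal_density 0 \<sigma> x)"
    by (simp add: scaleR_conv_of_real mult.commute)
  have std: "(LINT x|lborel. cis (s * x) * std_normal_density x) = exp (- s\<^sup>2 / 2)" for s
  proof -
    have "char std_normal_distribution s = (LINT x|lborel. std_normal_density x *\<^sub>R iexp (s * x))"
      unfolding char_def by (subst integral_density) auto
    then show ?thesis
      unfolding char_std_normal_distribution
      by (simp add: cis_conv_exp scaleR_conv_of_real mult.commute exp_of_real[symmetric])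
  qed
  have "(LINT x|lborel. cis (t * x) * normal_density 0 \<sigma> x)
      = \<bar>\<sigma>\<bar> *\<^sub>R (LINT x|lborel. cis (t * (0 + \<sigma> * x)) * normal_density 0 \<sigma> (0 + \<sigma> * x))"
    by (rule lborel_integral_real_affine) (use assms in simp)
  also have "\<dots> = (LINT x|lborel. \<sigma> *\<^sub>R (cis (t * (\<sigma> * x)) * normal_density 0 \<sigma> (\<sigma> * x)))"
    using assms by simp
  also have "\<dots> = (LINT x|lborel. cis ((\<sigma> * t) * x) * std_normal_density x)"
  proof (rule Bochner_Integration.integral_cong[OF refl])
    fix x
    have "\<sigma> * normal_density 0 \<sigma> (\<sigma> * x) = std_normal_density x"
      using assms unfolding normal_density_def by (simp add: real_sqrt_mult power_mult_distrib)
    then show "\<sigma> *\<^sub>R (cis (t * (\<sigma> * x)) * normal_density 0 \<sigma> (\<sigma> * x)) = cis ((\<sigma> * t) * x) * std_normal_density x"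
      by (simp add: scaleR_conv_of_real mult.left_commute mult.assoc flip: of_real_mult)
  qed
  finally show "(LINT x|lborel. cis (t * x) * normal_density 0 \<sigma> x) = exp (- (\<sigma> * t)\<^sup>2 / 2)"
    by (simp add: std)
qed

lemma cis_sum: "cis (\<Sum>i\<in>I. f i) = (\<Prod>i\<in>I. cis (f i))"
  by (induction I rule: infinite_finite_induct) (auto simp: cis_mult[symmetric])

text \<open>Lebesgue measure is the image of a product measure indexed by the basis, so the integral
  is a product of one-dimensional characteristic functions.\<close>

lemma integral_cis_gauss:
  fixes \<xi> :: "'a::euclidean_space"
  assumes "\<sigma> > 0"
  shows "integrable lborel (\<lambda>x. cis (\<xi> \<bullet> x) * gauss \<sigma> x)"
    and "(LINT x|lborel. cis (\<xi> \<bullet> x) * gauss \<sigma> x) = exp (- (\<sigma> * norm \<xi>)\<^sup>2 / 2)"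
proof -
  interpret product_sigma_finite "\<lambda>_::'a. lborel :: real measure" ..
  let ?T = "\<lambda>f. \<Sum>b\<in>Basis. f b *\<^sub>R b :: 'a"
  let ?P = "\<lambda>y. \<Prod>b\<in>Basis. cis ((\<xi> \<bullet> b) * y b) * complex_of_real (normal_density 0 \<sigma> (y b))"
  have T: "?T \<in> measurable (Pi\<^sub>M Basis (\<lambda>_. lborel)) borel"
    by measurable
  have m: "(\<lambda>x. cis (\<xi> \<bullet> x) * complex_of_real (gauss \<sigma> x)) \<in> borel_measurable borel"
    unfolding cis_conv_exp by measurable
  have eq: "cis (\<xi> \<bullet> x) * complex_of_real (gauss \<sigma> x)
      = (\<Prod>b\<in>Basis. cis ((\<xi> \<bullet> b) * (x \<bullet> b)) * complex_of_real (normal_density 0 \<sigma> (x \<bullet> b)))" for x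
    unfolding gauss_def euclidean_inner[of \<xi> x] cis_sum by (simp add: prod.distrib)
  have eqT: "cis (\<xi> \<bullet> ?T y) * complex_of_real (gauss \<sigma> (?T y)) = ?P y" for y
    unfolding eq by (intro prod.cong refl) (simp add: inner_sum_left inner_Basis if_distrib cong: if_cong)
  have "integrable (Pi\<^sub>M Basis (\<lambda>_. lborel)) ?P"
    by (rule product_integrable_prod) (auto intro: integral_cis_normal_density assms)
  then show "integrable lborel (\<lambda>x. cis (\<xi> \<bullet> x) * gauss \<sigma> x)"
    by (subst lborel_eq) (simp add: integrable_distr_eq[OF T m] eqT)
  have "(LINT x|lborel. cis (\<xi> \<bullet> x) * gauss \<sigma> x) = (LINT y|Pi\<^sub>M Basis (\<lambda>_. lborel). ?P y)"
    by (subst lborel_eq) (simp add: integral_distr[OF T m] eqT)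
  also have "\<dots> = (\<Prod>b\<in>Basis. of_real (exp (- (\<sigma> * (\<xi> \<bullet> b))\<^sup>2 / 2)))"
    by (subst product_integral_prod)
      (auto intro: integral_cis_normal_density assms simp: integral_cis_normal_density(2)[OF assms])
  also have "\<dots> = of_real (exp (\<Sum>b\<in>Basis. - (\<sigma> * (\<xi> \<bullet> b))\<^sup>2 / 2))"
    by (simp add: exp_sum)
  also have "(\<Sum>b\<in>Basis. - (\<sigma> * (\<xi> \<bullet> b))\<^sup>2 / 2) = - (\<sigma> * norm \<xi>)\<^sup>2 / 2"
    unfolding power_mult_distrib power2_norm_eq_inner euclidean_inner[of \<xi> \<xi>]
    by (simp add: sum_divide_distrib[symmetric] sum_negf power2_eq_square sum_distrib_left)
  finally show "(LINT x|lborel. cis (\<xi> \<bullet> x) * gauss \<sigma> x) = exp (- (\<sigma> * norm \<xi>)\<^sup>2 / 2)"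
    by (simp add: exp_of_real)
qed

lemma integrable_gauss:
  assumes "\<sigma> > 0"
  shows "integrable lborel (gauss \<sigma> :: 'a::euclidean_space \<Rightarrow> real)"
    and "(LINT x|lborel. gauss \<sigma> (x :: 'a)) = 1"
proof -
  have "integrable lborel (\<lambda>x :: 'a. complex_of_real (gauss \<sigma> x))"
    using integral_cis_gauss(1)[OF assms, of "0 :: 'a"] by simp
  then show "integrable lborel (gauss \<sigma> :: 'a \<Rightarrow> real)"
    by (simp add: complex_of_real_integrable_eq)
  have "complex_of_real (LINT x|lborel. gauss \<sigma> (x :: 'a)) = 1"
    using integral_cis_gauss(2)[OF assms, of "0 :: 'a"] by simp
  then show "(LINT x|lborel. gauss \<sigma> (x :: 'a)) = 1" by (simp only: of_real_eq_1_iff)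
qed

lemma nn_integral_gauss_translate:
  fixes y :: "'a::euclidean_space"
  assumes "\<sigma> > 0"
  shows "(\<integral>\<^sup>+x. ennreal (gauss \<sigma> (x - y)) \<partial>lebesgue) = 1"
proof -
  have "(\<integral>\<^sup>+x. ennreal (gauss \<sigma> (x - y)) \<partial>lebesgue) = (\<integral>\<^sup>+x. ennreal (gauss \<sigma> (x - y)) \<partial>lborel)"
    by (simp add: nn_integral_completion)
  also have "\<dots> = (\<integral>\<^sup>+x. ennreal (gauss \<sigma> (x - y)) \<partial>distr lborel borel ((+) y))"
    by (simp add: lborel_distr_plus)
  also have "\<dots> = (\<integral>\<^sup>+x. ennreal (gauss \<sigma> (x :: 'a)) \<partial>lborel)"
    by (subst nn_integral_distr) auto
  also have "\<dots> = ennreal (LINT x|lborel. gauss \<sigma> (x :: 'a))"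
    by (intro nn_integral_eq_integral integrable_gauss assms) (simp add: gauss_nonneg)
  also have "\<dots> = 1" by (simp add: integrable_gauss(2)[OF assms])
  finally show ?thesis .
qed

section \<open>The Fourier integral on integrable functions\<close>

lemma sigma_finite_lebesgue: "sigma_finite_measure (lebesgue :: 'a::euclidean_space measure)"
proof -
  obtain A :: "'a set set" where A: "countable A" "A \<subseteq> sets lborel" "\<Union>A = space lborel"
    "\<forall>a\<in>A. emeasure lborel a \<noteq> \<infinity>"
    using sigma_finite_lborel[where 'a='a] unfolding sigma_finite_measure_def by auto
  show ?thesis
    unfolding sigma_finite_measure_def
    by (rule exI[of _ A]) (use A in auto)
qed

lemma pair_sigma_finite_lebesgue:
  "pair_sigma_finite (lebesgue :: 'a::euclidean_space measure) (lebesgue :: 'b::euclidean_space measure)"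
  by (intro pair_sigma_finite.intro sigma_finite_lebesgue)

lemma borel_measurable_lebesgueI: "f \<in> borel \<rightarrow>\<^sub>M N \<Longrightarrow> f \<in> lebesgue \<rightarrow>\<^sub>M N"
  by (simp add: measurable_completion)

lemma measurable_fst_snd_lebesgue:
  "fst \<in> lebesgue \<Otimes>\<^sub>M M \<rightarrow>\<^sub>M borel" "snd \<in> M \<Otimes>\<^sub>M lebesgue \<rightarrow>\<^sub>M borel"
  using measurable_compose[OF measurable_fst borel_measurable_lebesgueI[OF measurable_ident]]
    measurable_compose[OF measurable_snd borel_measurable_lebesgueI[OF measurable_ident]]
  by auto

lemma Fubini_bounded_kernel:
  fixes A B :: "real ^ 'n \<Rightarrow> complex"
  assumes A: "integrable lebesgue A" and B: "integrable lebesgue B"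
    and \<phi>: "case_prod \<phi> \<in> borel_measurable (borel \<Otimes>\<^sub>M borel)" "\<And>x y. norm (\<phi> x y) \<le> 1"
  shows "(LINT x|lebesgue. A x * (LINT y|lebesgue. \<phi> x y * B y))
       = (LINT y|lebesgue. B y * (LINT x|lebesgue. \<phi> x y * A x))"
proof -
  interpret L: pair_sigma_finite "lebesgue :: (real ^ 'n) measure" "lebesgue :: (real ^ 'n) measure"
    by (rule pair_sigma_finite_lebesgue)
  have [measurable]: "A \<in> borel_measurable lebesgue" "B \<in> borel_measurable lebesgue"
    using A B by auto
  have "(\<lambda>p. (\<lambda>(x, y). \<phi> x y) (fst p, snd p)) \<in> borel_measurable (lebesgue \<Otimes>\<^sub>M lebesgue)"
    by (intro measurable_compose[OF _ \<phi>(1)] measurable_Pair measurable_fst_snd_lebesgue)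
  then have [measurable]: "(\<lambda>p. \<phi> (fst p) (snd p)) \<in> borel_measurable (lebesgue \<Otimes>\<^sub>M lebesgue)"
    by simp
  let ?f = "\<lambda>x y. A x * (\<phi> x y * B y)"
  have "integrable (lebesgue \<Otimes>\<^sub>M lebesgue) (\<lambda>p. norm (A (fst p)) * norm (B (snd p)))"
    by (rule L.Fubini_integrable) (use A B in \<open>auto intro!: integrable_mult_left\<close>)
  then have int: "integrable (lebesgue \<Otimes>\<^sub>M lebesgue) (case_prod ?f)"
  proof (rule Bochner_Integration.integrable_bound)
    show "case_prod ?f \<in> borel_measurable (lebesgue \<Otimes>\<^sub>M lebesgue)"
      unfolding case_prod_beta by measurable
    have "norm (A x * (\<phi> x y * B y)) \<le> norm (A x) * norm (B y)" for x y
      using mult_right_mono[OF \<phi>(2)[of x y], of "norm (B y)"]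
      by (auto simp: norm_mult intro!: mult_left_mono)
    then show "AE p in lebesgue \<Otimes>\<^sub>M lebesgue. norm (case p of (x, y) \<Rightarrow> ?f x y) \<le> norm (norm (A (fst p)) * norm (B (snd p)))"
      by (auto simp: case_prod_beta)
  qed
  have "(LINT x|lebesgue. A x * (LINT y|lebesgue. \<phi> x y * B y))
      = (LINT x|lebesgue. LINT y|lebesgue. ?f x y)" by simp
  also have "\<dots> = (LINT y|lebesgue. LINT x|lebesgue. ?f x y)"
    by (rule L.Fubini_integral[OF int, symmetric])
  also have "\<dots> = (LINT y|lebesgue. B y * (LINT x|lebesgue. \<phi> x y * A x))"
    by (simp add: mult_ac flip: Bochner_Integration.integral_mult_right_zero)
  finally show ?thesis .
qed

lemma norm_integral_le_nn_integral:
  fixes f :: "'a \<Rightarrow> 'b::{banach, second_countable_topology}"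
  shows "ennreal (norm (integral\<^sup>L M f)) \<le> (\<integral>\<^sup>+x. ennreal (norm (f x)) \<partial>M)"
  by (cases "integrable M f") (auto simp: integral_norm_bound_ennreal not_integrable_integral_eq)

text \<open>The parameter $s = \pm 1$ selects the inverse transform or the transform.\<close>

definition ft :: "real \<Rightarrow> 'n::finite wave \<Rightarrow> 'n wave" where
  "ft s u \<xi> = complex_of_real ((2 * pi) powr (- real CARD('n) / 2)) *
     (LINT x|lebesgue. cis (s * (\<xi> \<bullet> x)) * u x)"

lemma fourier_integral_eq_ft: "fourier_integral = ft (- 1)"
  by (intro ext) (simp add: fourier_integral_def ft_def cis_conv_exp)

lemma borel_measurable_cis [measurable (raw)]:
  "f \<in> borel_measurable M \<Longrightarrow> (\<lambda>x. cis (f x)) \<in> borel_measurable M"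
  unfolding cis_conv_exp by measurable

lemma integrable_cis_mult:
  fixes u :: "real ^ 'n::finite \<Rightarrow> complex"
  assumes u: "integrable lebesgue u" and f: "f \<in> borel_measurable borel"
  shows "integrable lebesgue (\<lambda>x. cis (f x) * u x)"
proof (rule Bochner_Integration.integrable_bound[OF u])
  have [measurable]: "u \<in> borel_measurable lebesgue" using u by auto
  have [measurable]: "f \<in> borel_measurable lebesgue" using f by (simp add: measurable_completion)
  show "(\<lambda>x. cis (f x) * u x) \<in> borel_measurable lebesgue" by measurable
qed (simp add: norm_mult)

lemma integrable_ft_kernel:
  fixes u :: "real ^ 'n::finite \<Rightarrow> complex"
  shows "integrable lebesgue u \<Longrightarrow> integrable lebesgue (\<lambda>x. cis (s * (\<xi> \<bullet> x)) * u x)"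
  by (rule integrable_cis_mult) measurable

lemma ft_add: "integrable lebesgue u \<Longrightarrow> integrable lebesgue v \<Longrightarrow>
    ft s (\<lambda>x. u x + v x) = (\<lambda>\<xi>. ft s u \<xi> + ft s v \<xi>)"
  by (intro ext) (simp add: ft_def integrable_ft_kernel distrib_left)

lemma ft_cmult: "ft s (\<lambda>x. c * u x) = (\<lambda>\<xi>. c * ft s u \<xi>)"
  by (intro ext) (simp add: ft_def mult.left_commute)

lemma ft_diff: "integrable lebesgue u \<Longrightarrow> integrable lebesgue v \<Longrightarrow>
    ft s (\<lambda>x. u x - v x) = (\<lambda>\<xi>. ft s u \<xi> - ft s v \<xi>)"
  by (intro ext) (simp add: ft_def integrable_ft_kernel right_diff_distrib)

lemma norm_ft_le:
  fixes u :: "'n::finite wave"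
  shows "norm (ft s u \<xi>) \<le> (2 * pi) powr (- real CARD('n) / 2) * (LINT x|lebesgue. norm (u x))"
proof -
  have "norm (LINT x|lebesgue. cis (s * (\<xi> \<bullet> x)) * u x) \<le> (LINT x|lebesgue. norm (cis (s * (\<xi> \<bullet> x)) * u x))"
    by (rule integral_norm_bound)
  then show ?thesis unfolding ft_def norm_mult by (simp add: mult_left_mono)
qed

lemma continuous_ft:
  fixes u :: "'n::finite wave"
  assumes u: "integrable lebesgue u"
  shows "continuous_on UNIV (ft s u)"
  unfolding continuous_on_sequentially
proof (intro allI ballI impI, elim conjE)
  fix x and a :: "real ^ 'n" assume x: "x \<longlonglongrightarrow> a"
  have m: "u \<in> borel_measurable lebesgue" using u by auto
  have "(\<lambda>n. LINT t|lebesgue. cis (s * (x n \<bullet> t)) * u t) \<longlonglongrightarrow> (LINT t|lebesgue. cis (s * (a \<bullet> t)) * u t)"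
  proof (rule integral_dominated_convergence[where w="\<lambda>t. norm (u t)"])
    show "AE t in lebesgue. (\<lambda>n. cis (s * (x n \<bullet> t)) * u t) \<longlonglongrightarrow> cis (s * (a \<bullet> t)) * u t"
      unfolding cis_conv_exp by (intro AE_I2 tendsto_intros x)
  qed (use u in \<open>auto simp: norm_mult intro: integrable_ft_kernel borel_measurable_integrable\<close>)
  then show "(ft s u \<circ> x) \<longlonglongrightarrow> ft s u a"
    unfolding ft_def o_def by (intro tendsto_intros)
qed

lemma borel_measurable_ft: "integrable lebesgue u \<Longrightarrow> ft s u \<in> borel_measurable borel"
  by (intro borel_measurable_continuous_onI continuous_ft)

lemma borel_measurable_ft_lebesgue: "integrable lebesgue u \<Longrightarrow> ft s u \<in> borel_measurable lebesgue"
  by (simp add: borel_measurable_ft measurable_completion)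

text \<open>The transform of an integrable function need not be integrable, so inversion is done
  with this factor inserted. Up to constants it is the Fourier transform of
  \<open>gauss \<sigma>\<close>; it tends to 1 as \<sigma> tends to 0.\<close>

definition damp :: "real \<Rightarrow> 'a::real_normed_vector \<Rightarrow> real" where
  "damp \<sigma> \<xi> = exp (- (\<sigma> * norm \<xi>)\<^sup>2 / 2)"

lemma damp_bounds: "damp \<sigma> \<xi> > 0" "damp \<sigma> \<xi> \<le> 1"
  unfolding damp_def by auto

lemma borel_measurable_damp [measurable]: "damp \<sigma> \<in> borel_measurable borel"
  unfolding damp_def by measurable

lemma damp_eq_gauss:
  assumes "\<sigma> > 0"
  shows "damp \<sigma> (\<xi> :: 'a::euclidean_space) = (sqrt (2 * pi) / \<sigma>) ^ DIM('a) * gauss (1 / \<sigma>) \<xi>"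
proof -
  have "1 / \<sigma> > 0" using assms by simp
  note * = gauss_eq[OF this, of \<xi>]
  have "(sqrt (2 * pi) / \<sigma>) ^ DIM('a) \<noteq> 0" using assms by simp
  moreover have "- (norm \<xi>)\<^sup>2 / (2 * (1 / \<sigma>)\<^sup>2) = - (\<sigma> * norm \<xi>)\<^sup>2 / 2"
    using assms by (simp add: power_mult_distrib power_divide)
  ultimately show ?thesis unfolding * damp_def by simp
qed

lemma integrable_damp:
  assumes "\<sigma> > 0"
  shows "integrable lebesgue (damp \<sigma> :: 'a::euclidean_space \<Rightarrow> real)"
proof -
  have "1 / \<sigma> > 0" using assms by simp
  from integrable_gauss(1)[OF this, where 'a='a]
  have "integrable lborel (damp \<sigma> :: 'a \<Rightarrow> real)"
    unfolding damp_eq_gauss[OF assms] by (rule integrable_mult_right)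
  then show ?thesis by (simp add: integrable_completion)
qed

lemma ft_const_power2:
  "(complex_of_real ((2 * pi) powr (- real n / 2)))\<^sup>2 * (of_real (sqrt (2 * pi) / \<sigma>)) ^ n
    = of_real (1 / (sqrt (2 * pi) * \<sigma>) ^ n)"
proof -
  have "((2 * pi) powr (- real n / 2))\<^sup>2 = (2 * pi) powr (- real n)"
    by (simp add: power2_eq_square flip: powr_add)
  also have "\<dots> = 1 / (2 * pi) ^ n" by (simp add: powr_minus powr_realpow field_simps)
  also have "(2 * pi) ^ n = sqrt (2 * pi) ^ n * sqrt (2 * pi) ^ n"
    using power_mult_distrib[of "sqrt (2 * pi)" "sqrt (2 * pi)" n] by simp
  finally have "((2 * pi) powr (- real n / 2))\<^sup>2 * (sqrt (2 * pi) / \<sigma>) ^ n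
      = 1 / (sqrt (2 * pi) ^ n * sqrt (2 * pi) ^ n) * (sqrt (2 * pi) ^ n / \<sigma> ^ n)"
    by (simp add: power_divide)
  also have "\<dots> = 1 / (sqrt (2 * pi) * \<sigma>) ^ n"
    by (simp add: power_mult_distrib)
  finally have "complex_of_real (((2 * pi) powr (- real n / 2))\<^sup>2 * (sqrt (2 * pi) / \<sigma>) ^ n)
      = of_real (1 / (sqrt (2 * pi) * \<sigma>) ^ n)" by simp
  then show ?thesis by (simp only: of_real_power of_real_mult)
qed

lemma ft_damp:
  fixes z :: "real ^ 'n::finite"
  assumes \<sigma>: "\<sigma> > 0" and s: "\<bar>s\<bar> = 1"
  shows "(complex_of_real ((2 * pi) powr (- real CARD('n) / 2)))\<^sup>2 *
      (LINT \<xi>|lebesgue. cis (s * (\<xi> \<bullet> z)) * damp \<sigma> \<xi>) = gauss \<sigma> z"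
proof -
  have "1 / \<sigma> > 0" using \<sigma> by simp
  note * = integral_cis_gauss[OF this, of "s *\<^sub>R z"]
  have "(LINT \<xi>|lebesgue. cis (s * (\<xi> \<bullet> z)) * damp \<sigma> \<xi>) = (LINT \<xi>|lborel. cis (s * (\<xi> \<bullet> z)) * damp \<sigma> \<xi>)"
    by (rule integral_completion) (auto intro!: borel_measurable_times borel_measurable_cis)
  also have "\<dots> = (LINT \<xi>|lborel. (of_real (sqrt (2 * pi) / \<sigma>)) ^ CARD('n) * (cis ((s *\<^sub>R z) \<bullet> \<xi>) * gauss (1 / \<sigma>) \<xi>))"
    by (simp add: damp_eq_gauss[OF \<sigma>] inner_commute mult_ac)
  also have "\<dots> = (complex_of_real (sqrt (2 * pi) / \<sigma>)) ^ CARD('n) * complex_of_real (exp (- (1 / \<sigma> * norm (s *\<^sub>R z))\<^sup>2 / 2))"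
    unfolding integral_mult_right_zero *(2) ..
  also have "- (1 / \<sigma> * norm (s *\<^sub>R z))\<^sup>2 / 2 = - (norm z)\<^sup>2 / (2 * \<sigma>\<^sup>2)"
    using s by (simp add: power_divide)
  finally show ?thesis
    using ft_const_power2[of "CARD('n)" \<sigma>]
    by (simp add: gauss_eq[OF \<sigma>] mult.assoc[symmetric])
qed


section \<open>The Fourier transform is a contraction\<close>

text \<open>Interchanging the integrations moves the second transform onto the damping factor and
  turns it into the kernel \<open>gauss \<sigma>\<close>. This regularized inversion formula serves
  twice: for the norm bound and for inversion itself.\<close>

lemma ft_damp_ft:
  fixes u :: "'n::finite wave"
  assumes \<sigma>: "\<sigma> > 0" and s: "\<bar>s\<bar> = 1" and u: "integrable lebesgue u"
  shows "ft (- s) (\<lambda>\<xi>. damp \<sigma> \<xi> * ft s u \<xi>) x = (LINT y|lebesgue. gauss \<sigma> (y - x) * u y)"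
proof -
  let ?c = "complex_of_real ((2 * pi) powr (- real CARD('n) / 2))"
  let ?h = "\<lambda>\<xi>. complex_of_real (damp \<sigma> \<xi>)"
  have h: "integrable lebesgue (\<lambda>\<xi> :: real ^ 'n. ?h \<xi>)"
    using integrable_damp[OF \<sigma>] by (simp add: complex_of_real_integrable_eq)
  have "ft (- s) (\<lambda>\<xi>. damp \<sigma> \<xi> * ft s u \<xi>) x
      = ?c\<^sup>2 * (LINT \<xi>|lebesgue. ?h \<xi> * (LINT y|lebesgue. cis (s * (\<xi> \<bullet> (y - x))) * u y))"
  proof -
    have "cis (- s * (x \<bullet> \<xi>)) * (?h \<xi> * ft s u \<xi>)
        = ?c * (?h \<xi> * (LINT y|lebesgue. cis (s * (\<xi> \<bullet> (y - x))) * u y))" for \<xi>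
    proof -
      have "cis (s * (\<xi> \<bullet> (y - x))) = cis (- s * (x \<bullet> \<xi>)) * cis (s * (\<xi> \<bullet> y))" for y
        unfolding cis_mult by (simp add: inner_diff_right inner_commute[of x] right_diff_distrib)
      then have "cis (s * (\<xi> \<bullet> (y - x))) * u y = cis (- s * (x \<bullet> \<xi>)) * (cis (s * (\<xi> \<bullet> y)) * u y)" for y
        by (simp only: mult.assoc)
      then have "(LINT y|lebesgue. cis (s * (\<xi> \<bullet> (y - x))) * u y)
          = cis (- s * (x \<bullet> \<xi>)) * (LINT y|lebesgue. cis (s * (\<xi> \<bullet> y)) * u y)"
        by (simp only: integral_mult_right_zero)
      then show ?thesis unfolding ft_def by (simp add: mult_ac)
    qed
    then show ?thesis
      unfolding ft_def[of "- s"] by (simp only: integral_mult_right_zero power2_eq_square mult.assoc)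
  qed
  also have "(LINT \<xi>|lebesgue. ?h \<xi> * (LINT y|lebesgue. cis (s * (\<xi> \<bullet> (y - x))) * u y))
      = (LINT y|lebesgue. u y * (LINT \<xi>|lebesgue. cis (s * (\<xi> \<bullet> (y - x))) * ?h \<xi>))"
    by (rule Fubini_bounded_kernel[OF h u]) 
      (auto simp: case_prod_beta intro!: borel_measurable_cis borel_measurable_times
        borel_measurable_inner borel_measurable_diff)
  also have "?c\<^sup>2 * \<dots> = (LINT y|lebesgue. u y * (?c\<^sup>2 * (LINT \<xi>|lebesgue. cis (s * (\<xi> \<bullet> (y - x))) * ?h \<xi>)))"
    unfolding mult.left_commute[of _ "?c\<^sup>2"] by (rule integral_mult_right_zero[symmetric])
  also have "\<dots> = (LINT y|lebesgue. gauss \<sigma> (y - x) * u y)"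
    unfolding ft_damp[OF \<sigma> s] by (simp add: mult.commute)
  finally show ?thesis .
qed

lemma integrable_damp_mult:
  fixes f :: "'n::finite wave"
  assumes "\<sigma> > 0" "f \<in> borel_measurable lebesgue" "\<And>x. norm (f x) \<le> K"
  shows "integrable lebesgue (\<lambda>\<xi>. damp \<sigma> \<xi> * f \<xi>)"
proof (rule Bochner_Integration.integrable_bound)
  show "integrable lebesgue (\<lambda>\<xi> :: real ^ 'n. K * damp \<sigma> \<xi>)"
    by (intro integrable_mult_right integrable_damp assms)
  have [measurable]: "f \<in> borel_measurable lebesgue" "damp \<sigma> \<in> borel_measurable lebesgue"
    using assms by (auto intro: borel_measurable_lebesgueI)
  show "(\<lambda>\<xi>. damp \<sigma> \<xi> * f \<xi>) \<in> borel_measurable lebesgue" by measurable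
  have "norm (damp \<sigma> \<xi> * f \<xi>) \<le> \<bar>K * damp \<sigma> \<xi>\<bar>" for \<xi>
    using mult_right_mono[OF assms(3)[of \<xi>], of "damp \<sigma> \<xi>"] damp_bounds(1)[of \<sigma> \<xi>]
    by (simp add: norm_mult mult.commute abs_mult)
  then show "AE \<xi> in lebesgue. norm (complex_of_real (damp \<sigma> \<xi>) * f \<xi>) \<le> norm (K * damp \<sigma> \<xi>)"
    by simp
qed

text \<open>Schur's test: the product of \<open>cmod (u y)\<close> and \<open>cmod (u z)\<close> is
  at most the mean of their squares, and the kernel has integral 1 in each variable.\<close>

lemma gauss_convolution_form_le:
  fixes u :: "'n::finite wave"
  assumes \<sigma>: "\<sigma> > 0" and u: "u \<in> borel_measurable lebesgue"
  shows "(\<integral>\<^sup>+y. (\<integral>\<^sup>+z. ennreal (cmod (u y) * cmod (u z) * gauss \<sigma> (z - y)) \<partial>lebesgue) \<partial>lebesgue)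
    \<le> (\<integral>\<^sup>+y. ennreal ((cmod (u y))\<^sup>2) \<partial>lebesgue)"
proof -
  interpret L: pair_sigma_finite "lebesgue :: (real ^ 'n) measure" "lebesgue :: (real ^ 'n) measure"
    by (rule pair_sigma_finite_lebesgue)
  have [measurable]: "u \<in> borel_measurable lebesgue" by fact
  have [measurable]: "(\<lambda>p. gauss \<sigma> (snd p - fst p)) \<in> borel_measurable ((lebesgue :: (real ^ 'n) measure) \<Otimes>\<^sub>M lebesgue)"
    by (intro measurable_compose[OF _ borel_measurable_gauss] borel_measurable_diff measurable_fst_snd_lebesgue)
  have [measurable]: "(\<lambda>z. gauss \<sigma> (z - y)) \<in> borel_measurable lebesgue" for y :: "real ^ 'n"
    by (intro borel_measurable_lebesgueI) measurable
  let ?f = "\<lambda>y z. ennreal ((cmod (u y))\<^sup>2 / 2 * gauss \<sigma> (z - y))"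
  let ?g = "\<lambda>y z. ennreal ((cmod (u z))\<^sup>2 / 2 * gauss \<sigma> (z - y))"
  let ?I = "\<integral>\<^sup>+y. ennreal ((cmod (u y))\<^sup>2 / 2) \<partial>lebesgue"
  have f: "(\<integral>\<^sup>+y. (\<integral>\<^sup>+z. ?f y z \<partial>lebesgue) \<partial>lebesgue) = ?I"
  proof (rule nn_integral_cong)
    fix y
    show "(\<integral>\<^sup>+z. ?f y z \<partial>lebesgue) = ennreal ((cmod (u y))\<^sup>2 / 2)"
      by (subst ennreal_mult) (auto simp: gauss_nonneg nn_integral_cmult nn_integral_gauss_translate[OF \<sigma>])
  qed
  have "(\<integral>\<^sup>+y. (\<integral>\<^sup>+z. ?g y z \<partial>lebesgue) \<partial>lebesgue) = (\<integral>\<^sup>+z. (\<integral>\<^sup>+y. ?g y z \<partial>lebesgue) \<partial>lebesgue)"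
    using L.Fubini'[of ?g] by (simp add: case_prod_beta)
  also have "\<dots> = ?I"
  proof (rule nn_integral_cong)
    fix z
    have "(\<integral>\<^sup>+y. ?g y z \<partial>lebesgue) = (\<integral>\<^sup>+y. ennreal ((cmod (u z))\<^sup>2 / 2) * ennreal (gauss \<sigma> (y - z)) \<partial>lebesgue)"
      by (subst ennreal_mult[symmetric]) (auto simp: gauss_nonneg gauss_minus_commute[of \<sigma> z])
    then show "(\<integral>\<^sup>+y. ?g y z \<partial>lebesgue) = ennreal ((cmod (u z))\<^sup>2 / 2)"
      by (simp add: nn_integral_cmult nn_integral_gauss_translate[OF \<sigma>])
  qed
  finally have g: "(\<integral>\<^sup>+y. (\<integral>\<^sup>+z. ?g y z \<partial>lebesgue) \<partial>lebesgue) = ?I" .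
  have "(\<integral>\<^sup>+y. (\<integral>\<^sup>+z. ennreal (cmod (u y) * cmod (u z) * gauss \<sigma> (z - y)) \<partial>lebesgue) \<partial>lebesgue)
      \<le> (\<integral>\<^sup>+y. (\<integral>\<^sup>+z. ?f y z + ?g y z \<partial>lebesgue) \<partial>lebesgue)"
  proof (intro nn_integral_mono)
    fix y z
    have "2 * (cmod (u y) * cmod (u z)) \<le> (cmod (u y))\<^sup>2 + (cmod (u z))\<^sup>2"
      using zero_le_power2[of "cmod (u y) - cmod (u z)"] by (simp add: power2_eq_square algebra_simps)
    then have "cmod (u y) * cmod (u z) \<le> (cmod (u y))\<^sup>2 / 2 + (cmod (u z))\<^sup>2 / 2" by simp
    from ennreal_leI[OF mult_right_mono[OF this gauss_nonneg[of \<sigma> "z - y"]]]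
    show "ennreal (cmod (u y) * cmod (u z) * gauss \<sigma> (z - y)) \<le> ?f y z + ?g y z"
      unfolding distrib_right by (subst (asm) ennreal_plus) (auto simp: gauss_nonneg)
  qed
  also have "\<dots> = (\<integral>\<^sup>+y. (\<integral>\<^sup>+z. ?f y z \<partial>lebesgue) + (\<integral>\<^sup>+z. ?g y z \<partial>lebesgue) \<partial>lebesgue)"
    by (intro nn_integral_cong nn_integral_add) measurable
  also have "\<dots> = (\<integral>\<^sup>+y. (\<integral>\<^sup>+z. ?f y z \<partial>lebesgue) \<partial>lebesgue) + (\<integral>\<^sup>+y. (\<integral>\<^sup>+z. ?g y z \<partial>lebesgue) \<partial>lebesgue)"
  proof (rule nn_integral_add)
    note measurable_fst_snd_lebesgue[measurable]
    show "(\<lambda>y. \<integral>\<^sup>+z. ?f y z \<partial>lebesgue) \<in> borel_measurable lebesgue"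
      by (rule sigma_finite_measure.borel_measurable_nn_integral[OF sigma_finite_lebesgue])
        (unfold case_prod_beta, measurable)
    show "(\<lambda>y. \<integral>\<^sup>+z. ?g y z \<partial>lebesgue) \<in> borel_measurable lebesgue"
      by (rule sigma_finite_measure.borel_measurable_nn_integral[OF sigma_finite_lebesgue])
        (unfold case_prod_beta, measurable)
  qed
  also have "\<dots> = (\<integral>\<^sup>+y. ennreal ((cmod (u y))\<^sup>2 / 2) + ennreal ((cmod (u y))\<^sup>2 / 2) \<partial>lebesgue)"
    unfolding f g by (rule nn_integral_add[symmetric]) measurable
  also have "\<dots> = (\<integral>\<^sup>+y. ennreal ((cmod (u y))\<^sup>2) \<partial>lebesgue)"
    by (intro nn_integral_cong) (simp flip: ennreal_plus)
  finally show ?thesis .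
qed

text \<open>A Gaussian weight turns the squared norm of the transform into the quadratic form of the
  convolution with a Gaussian probability density, which is at most the squared norm of $u$.\<close>

lemma ft_damped_norm_le:
  fixes u :: "'n::finite wave"
  assumes \<sigma>: "\<sigma> > 0" and s: "\<bar>s\<bar> = 1" and u: "integrable lebesgue u" "u \<in> L2"
  shows "(\<integral>\<^sup>+\<xi>. ennreal (damp \<sigma> \<xi> * (cmod (ft s u \<xi>))\<^sup>2) \<partial>lebesgue)
    \<le> (\<integral>\<^sup>+x. ennreal ((cmod (u x))\<^sup>2) \<partial>lebesgue)"
proof -
  let ?c = "complex_of_real ((2 * pi) powr (- real CARD('n) / 2))"
  have [measurable]: "u \<in> borel_measurable lebesgue" using u by auto
  have [measurable]: "ft s u \<in> borel_measurable lebesgue" "damp \<sigma> \<in> borel_measurable lebesgue"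
    using u(1) by (auto intro: borel_measurable_lebesgueI borel_measurable_ft)
  have [measurable]: "(\<lambda>z. gauss \<sigma> (z - y)) \<in> borel_measurable lebesgue" for y :: "real ^ 'n"
    by (intro borel_measurable_lebesgueI) measurable
  obtain K where K: "\<And>\<xi>. norm (ft s u \<xi>) \<le> K" using norm_ft_le by blast
  have A: "integrable lebesgue (\<lambda>\<xi>. damp \<sigma> \<xi> * ft s u \<xi>)"
    by (rule integrable_damp_mult[OF \<sigma> _ K]) measurable
  have int: "integrable lebesgue (\<lambda>\<xi>. damp \<sigma> \<xi> * (cmod (ft s u \<xi>))\<^sup>2)"
  proof (rule Bochner_Integration.integrable_bound)
    show "integrable lebesgue (\<lambda>\<xi> :: real ^ 'n. K\<^sup>2 * damp \<sigma> \<xi>)"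
      by (intro integrable_mult_right integrable_damp \<sigma>)
    have "\<bar>damp \<sigma> \<xi> * (cmod (ft s u \<xi>))\<^sup>2\<bar> \<le> \<bar>K\<^sup>2 * damp \<sigma> \<xi>\<bar>" for \<xi>
      using mult_right_mono[OF power_mono[OF K[of \<xi>], of 2], of "damp \<sigma> \<xi>"] damp_bounds(1)[of \<sigma> \<xi>]
      by (simp add: mult.commute abs_mult)
    then show "AE \<xi> in lebesgue. norm (damp \<sigma> \<xi> * (cmod (ft s u \<xi>))\<^sup>2) \<le> norm (K\<^sup>2 * damp \<sigma> \<xi>)"
      by simp
  qed measurable
  have cu: "integrable lebesgue (\<lambda>y. cnj (u y))" using u(1) by simp
  have cnj_ft: "cnj (ft s u \<xi>) = ?c * (LINT y|lebesgue. cis (- s * (\<xi> \<bullet> y)) * cnj (u y))" for \<xi>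
    unfolding ft_def by (simp add: cis_cnj flip: Bochner_Integration.integral_cnj)
  have "complex_of_real (LINT \<xi>|lebesgue. damp \<sigma> \<xi> * (cmod (ft s u \<xi>))\<^sup>2)
      = (LINT \<xi>|lebesgue. damp \<sigma> \<xi> * ft s u \<xi> * cnj (ft s u \<xi>))"
    unfolding integral_complex_of_real[symmetric]
    by (intro Bochner_Integration.integral_cong refl) (simp only: of_real_mult complex_norm_square mult.assoc)
  also have "\<dots> = ?c * (LINT \<xi>|lebesgue. damp \<sigma> \<xi> * ft s u \<xi> * (LINT y|lebesgue. cis (- s * (\<xi> \<bullet> y)) * cnj (u y)))"
    unfolding cnj_ft mult.left_commute[of _ ?c] by (rule integral_mult_right_zero)
  also have "(LINT \<xi>|lebesgue. damp \<sigma> \<xi> * ft s u \<xi> * (LINT y|lebesgue. cis (- s * (\<xi> \<bullet> y)) * cnj (u y)))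
      = (LINT y|lebesgue. cnj (u y) * (LINT \<xi>|lebesgue. cis (- s * (\<xi> \<bullet> y)) * (damp \<sigma> \<xi> * ft s u \<xi>)))"
    by (rule Fubini_bounded_kernel[OF A cu]) 
      (auto simp: case_prod_beta intro!: borel_measurable_cis borel_measurable_times
        borel_measurable_inner borel_measurable_diff)
  also have "?c * \<dots> = (LINT y|lebesgue. cnj (u y) * ft (- s) (\<lambda>\<xi>. damp \<sigma> \<xi> * ft s u \<xi>) y)"
    unfolding ft_def[of "- s"] mult.left_commute[of _ ?c] integral_mult_right_zero
    by (simp add: inner_commute)
  also have "\<dots> = (LINT y|lebesgue. cnj (u y) * (LINT z|lebesgue. gauss \<sigma> (z - y) * u z))"
    unfolding ft_damp_ft[OF \<sigma> s u(1)] ..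
  finally have eq: "complex_of_real (LINT \<xi>|lebesgue. damp \<sigma> \<xi> * (cmod (ft s u \<xi>))\<^sup>2)
      = (LINT y|lebesgue. cnj (u y) * (LINT z|lebesgue. gauss \<sigma> (z - y) * u z))" .
  have pos: "(LINT \<xi>|lebesgue. damp \<sigma> \<xi> * (cmod (ft s u \<xi>))\<^sup>2) \<ge> 0"
    by (intro Bochner_Integration.integral_nonneg mult_nonneg_nonneg zero_le_power2
        less_imp_le[OF damp_bounds(1)])
  have "(\<integral>\<^sup>+\<xi>. ennreal (damp \<sigma> \<xi> * (cmod (ft s u \<xi>))\<^sup>2) \<partial>lebesgue)
      = ennreal (LINT \<xi>|lebesgue. damp \<sigma> \<xi> * (cmod (ft s u \<xi>))\<^sup>2)"
    by (intro nn_integral_eq_integral int AE_I2 mult_nonneg_nonneg zero_le_power2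
        less_imp_le[OF damp_bounds(1)])
  also have "(LINT \<xi>|lebesgue. damp \<sigma> \<xi> * (cmod (ft s u \<xi>))\<^sup>2)
      = norm (LINT y|lebesgue. cnj (u y) * (LINT z|lebesgue. gauss \<sigma> (z - y) * u z))"
    unfolding eq[symmetric] using pos by (simp only: norm_of_real abs_of_nonneg)
  also have "ennreal \<dots> \<le> (\<integral>\<^sup>+y. ennreal (norm (cnj (u y) * (LINT z|lebesgue. gauss \<sigma> (z - y) * u z))) \<partial>lebesgue)"
    by (rule norm_integral_le_nn_integral)
  also have "\<dots> \<le> (\<integral>\<^sup>+y. (\<integral>\<^sup>+z. ennreal (cmod (u y) * cmod (u z) * gauss \<sigma> (z - y)) \<partial>lebesgue) \<partial>lebesgue)"
  proof (rule nn_integral_mono)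
    fix y
    have "ennreal (norm (cnj (u y) * (LINT z|lebesgue. gauss \<sigma> (z - y) * u z)))
        = ennreal (cmod (u y)) * ennreal (norm (LINT z|lebesgue. gauss \<sigma> (z - y) * u z))"
      by (simp add: norm_mult ennreal_mult)
    also have "\<dots> \<le> ennreal (cmod (u y)) * (\<integral>\<^sup>+z. ennreal (norm (gauss \<sigma> (z - y) * u z)) \<partial>lebesgue)"
      by (intro mult_left_mono norm_integral_le_nn_integral) auto
    also have "\<dots> = (\<integral>\<^sup>+z. ennreal (cmod (u y)) * ennreal (norm (gauss \<sigma> (z - y) * u z)) \<partial>lebesgue)"
      by (rule nn_integral_cmult[symmetric]) measurable
    also have "\<dots> = (\<integral>\<^sup>+z. ennreal (cmod (u y) * cmod (u z) * gauss \<sigma> (z - y)) \<partial>lebesgue)"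
      by (intro nn_integral_cong)
        (simp add: norm_mult gauss_nonneg mult_ac flip: ennreal_mult)
    finally show "ennreal (norm (cnj (u y) * (LINT z|lebesgue. gauss \<sigma> (z - y) * u z)))
        \<le> (\<integral>\<^sup>+z. ennreal (cmod (u y) * cmod (u z) * gauss \<sigma> (z - y)) \<partial>lebesgue)" .
  qed
  also have "\<dots> \<le> (\<integral>\<^sup>+x. ennreal ((cmod (u x))\<^sup>2) \<partial>lebesgue)"
    by (rule gauss_convolution_form_le[OF \<sigma>]) measurable
  finally show ?thesis .
qed

lemma damp_tendsto_1: "(\<lambda>n. damp (1 / (real n + 1)) \<xi>) \<longlonglongrightarrow> 1"
proof -
  have "(\<lambda>n. 1 / (real n + 1)) \<longlonglongrightarrow> 0"
    using LIMSEQ_inverse_real_of_nat by (simp add: inverse_eq_divide add.commute)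
  then have "(\<lambda>n. exp (- ((1 / (real n + 1)) * norm \<xi>)\<^sup>2 / 2)) \<longlonglongrightarrow> exp (- (0 * norm \<xi>)\<^sup>2 / 2)"
    by (intro tendsto_intros) auto
  then show ?thesis by (simp add: damp_def)
qed

text \<open>Fatou's lemma as the damping is removed. This yields only a contraction; the isometry
  follows in \<open>norm_Fou\<close> from the inversion formula.\<close>

lemma ft_norm_le:
  fixes u :: "'n::finite wave"
  assumes s: "\<bar>s\<bar> = 1" and u: "integrable lebesgue u" "u \<in> L2"
  shows "(\<integral>\<^sup>+\<xi>. ennreal ((cmod (ft s u \<xi>))\<^sup>2) \<partial>lebesgue) \<le> (\<integral>\<^sup>+x. ennreal ((cmod (u x))\<^sup>2) \<partial>lebesgue)"
proof -
  let ?f = "\<lambda>n \<xi>. ennreal (damp (1 / (real n + 1)) \<xi> * (cmod (ft s u \<xi>))\<^sup>2)"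
  have [measurable]: "ft s u \<in> borel_measurable lebesgue" "damp \<sigma> \<in> borel_measurable lebesgue" for \<sigma>
    using u(1) by (auto intro: borel_measurable_lebesgueI borel_measurable_ft)
  have "(\<lambda>n. ?f n \<xi>) \<longlonglongrightarrow> ennreal (1 * (cmod (ft s u \<xi>))\<^sup>2)" for \<xi>
    by (intro tendsto_ennrealI tendsto_mult damp_tendsto_1 tendsto_const)
  then have "(\<integral>\<^sup>+\<xi>. ennreal ((cmod (ft s u \<xi>))\<^sup>2) \<partial>lebesgue) = (\<integral>\<^sup>+\<xi>. liminf (\<lambda>n. ?f n \<xi>) \<partial>lebesgue)"
    by (intro nn_integral_cong lim_imp_Liminf[symmetric]) auto
  also have "\<dots> \<le> liminf (\<lambda>n. \<integral>\<^sup>+\<xi>. ?f n \<xi> \<partial>lebesgue)"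
    by (rule nn_integral_liminf) measurable
  also have "\<dots> \<le> (\<integral>\<^sup>+x. ennreal ((cmod (u x))\<^sup>2) \<partial>lebesgue)"
    by (intro Liminf_le always_eventually allI ft_damped_norm_le s u) auto
  finally show ?thesis .
qed

lemma ft_L2:
  assumes "\<bar>s\<bar> = 1" "integrable lebesgue u" "u \<in> L2"
  shows "ft s u \<in> L2" "norm (cls (ft s u)) \<le> norm (cls u)"
proof -
  have le: "(\<integral>\<^sup>+\<xi>. ennreal ((cmod (ft s u \<xi>))\<^sup>2) \<partial>lebesgue) \<le> ennreal ((norm (cls u))\<^sup>2)"
    using ft_norm_le[OF assms] by (simp only: nn_integral_L2[OF assms(3)])
  show "ft s u \<in> L2"
    using le by (intro L2_I_nn_integral borel_measurable_ft_lebesgue assms)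
      (auto intro: le_less_trans)
  then show "norm (cls (ft s u)) \<le> norm (cls u)"
    by (rule norm_cls_le[OF _ le]) simp
qed

section \<open>The Fourier transform on the Hilbert space\<close>

text \<open>Fatou's lemma for the distances from \<open>rep y\<close>. Identifying a limit in the
  mean with a pointwise one carries explicit formulas over to limits of classes.\<close>

lemma l2_pointwise_limit:
  fixes f :: "nat \<Rightarrow> 'n::finite wave"
  assumes f: "\<And>n. f n \<in> L2" and y: "(\<lambda>n. cls (f n)) \<longlonglongrightarrow> y"
    and u: "u \<in> borel_measurable lebesgue" and lim: "AE x in lebesgue. (\<lambda>n. f n x) \<longlonglongrightarrow> u x"
  shows "u \<in> L2" "cls u = y"
proof -
  have [measurable]: "f n \<in> borel_measurable lebesgue" "rep y \<in> borel_measurable lebesgue" for n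
    using f by (auto intro: L2_measurable)
  have [measurable]: "u \<in> borel_measurable lebesgue" by fact
  have "(\<integral>\<^sup>+x. ennreal ((cmod (u x - rep y x))\<^sup>2) \<partial>lebesgue)
      = (\<integral>\<^sup>+x. liminf (\<lambda>n. ennreal ((cmod (f n x - rep y x))\<^sup>2)) \<partial>lebesgue)"
  proof (rule nn_integral_cong_AE)
    show "AE x in lebesgue. ennreal ((cmod (u x - rep y x))\<^sup>2)
        = liminf (\<lambda>n. ennreal ((cmod (f n x - rep y x))\<^sup>2))"
      using lim
    proof eventually_elim
      case (elim x)
      then have "(\<lambda>n. ennreal ((cmod (f n x - rep y x))\<^sup>2)) \<longlonglongrightarrow> ennreal ((cmod (u x - rep y x))\<^sup>2)"
        by (intro tendsto_intros) auto
      then show ?case by (rule lim_imp_Liminf[OF trivial_limit_sequentially, symmetric])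
    qed
  qed
  also have "\<dots> \<le> liminf (\<lambda>n. \<integral>\<^sup>+x. ennreal ((cmod (f n x - rep y x))\<^sup>2) \<partial>lebesgue)"
    by (rule nn_integral_liminf) measurable
  also have "\<dots> = 0"
  proof (rule lim_imp_Liminf[OF trivial_limit_sequentially])
    have "(\<integral>\<^sup>+x. ennreal ((cmod (f n x - rep y x))\<^sup>2) \<partial>lebesgue) = ennreal ((norm (cls (f n) - y))\<^sup>2)" for n
      using nn_integral_L2[OF L2_diff[OF f rep_L2], of n y] cls_diff[OF f rep_L2, of n y] by simp
    moreover have "(\<lambda>n. ennreal ((norm (cls (f n) - y))\<^sup>2)) \<longlonglongrightarrow> ennreal ((norm (y - y))\<^sup>2)"
      by (intro tendsto_intros y)
    ultimately show "(\<lambda>n. \<integral>\<^sup>+x. ennreal ((cmod (f n x - rep y x))\<^sup>2) \<partial>lebesgue) \<longlonglongrightarrow> 0" by simp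
  qed
  finally have "(\<integral>\<^sup>+x. ennreal ((cmod (u x - rep y x))\<^sup>2) \<partial>lebesgue) = 0" by simp
  then have "AE x in lebesgue. ennreal ((cmod (u x - rep y x))\<^sup>2) = 0"
    by (subst (asm) nn_integral_0_iff_AE) auto
  then have ae: "AE x in lebesgue. rep y x = u x" by eventually_elim simp
  then show "u \<in> L2" by (intro L2_ae_eq[OF rep_L2[of y]]) (auto simp: ae_eq_def)
  then have "cls (rep y) = cls u" using ae by (intro cls_eqI) auto
  then show "cls u = y" by simp
qed

lemma l2_dominated_convergence:
  fixes f :: "nat \<Rightarrow> 'n::finite wave" and g :: "real ^ 'n \<Rightarrow> real"
  assumes [measurable]: "\<And>n. f n \<in> borel_measurable lebesgue" "u \<in> borel_measurable lebesgue"
    and g: "integrable lebesgue (\<lambda>x. (g x)\<^sup>2)"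
    and bound: "\<And>n. AE x in lebesgue. cmod (f n x) \<le> g x"
    and lim: "AE x in lebesgue. (\<lambda>n. f n x) \<longlonglongrightarrow> u x"
  shows "f n \<in> L2" "u \<in> L2" "(\<lambda>n. cls (f n)) \<longlonglongrightarrow> cls u"
proof -
  have fL: "f n \<in> L2" for n
    by (rule L2_bound[OF _ g]) (use bound[of n] in \<open>auto elim!: eventually_mono intro!: power_mono\<close>)
  then show "f n \<in> L2" .
  have bu: "AE x in lebesgue. cmod (u x) \<le> g x"
  proof -
    have "AE x in lebesgue. \<forall>n. cmod (f n x) \<le> g x" using bound by (simp add: AE_all_countable)
    with lim show ?thesis
    proof eventually_elim
      case (elim x)
      then show ?case by (intro LIMSEQ_le_const2[OF tendsto_norm]) auto
    qed
  qed
  then show uL: "u \<in> L2"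
    by (intro L2_bound[OF _ g]) (auto elim!: eventually_mono intro!: power_mono)
  have "(\<lambda>n. LINT x|lebesgue. (cmod (f n x - u x))\<^sup>2) \<longlonglongrightarrow> (LINT x|(lebesgue :: (real ^ 'n) measure). 0)"
  proof (rule integral_dominated_convergence[where w="\<lambda>x. 4 * (g x)\<^sup>2"])
    show "integrable lebesgue (\<lambda>x. 4 * (g x)\<^sup>2)" using g by simp
    show "AE x in lebesgue. (\<lambda>n. (cmod (f n x - u x))\<^sup>2) \<longlonglongrightarrow> 0"
      using lim
    proof eventually_elim
      case (elim x)
      then have "(\<lambda>n. (cmod (f n x - u x))\<^sup>2) \<longlonglongrightarrow> (cmod (u x - u x))\<^sup>2" by (intro tendsto_intros)
      then show ?case by simp
    qed
    show "AE x in lebesgue. norm ((cmod (f n x - u x))\<^sup>2) \<le> 4 * (g x)\<^sup>2" for n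
      using bound[of n] bu
    proof eventually_elim
      case (elim x)
      then have "cmod (f n x - u x) \<le> 2 * g x" using norm_triangle_ineq4[of "f n x" "u x"] by simp
      then have "(cmod (f n x - u x))\<^sup>2 \<le> (2 * g x)\<^sup>2" by (intro power_mono) auto
      then show ?case by (simp add: power_mult_distrib)
    qed
  qed auto
  then have "(\<lambda>n. (norm (cls (f n) - cls u))\<^sup>2) \<longlonglongrightarrow> 0"
    using fL uL by (simp add: cls_diff norm_cls_power2 L2_diff)
  then have "(\<lambda>n. norm (cls (f n) - cls u)) \<longlonglongrightarrow> 0"
    using tendsto_real_sqrt[of "\<lambda>n. (norm (cls (f n) - cls u))\<^sup>2" 0] by simp
  then show "(\<lambda>n. cls (f n)) \<longlonglongrightarrow> cls u"
    by (simp add: tendsto_norm_zero_iff LIM_zero_iff)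
qed

definition restrict_to :: "'a set \<Rightarrow> ('a \<Rightarrow> complex) \<Rightarrow> 'a \<Rightarrow> complex" where
  "restrict_to S u x = (if x \<in> S then u x else 0)"

lemma borel_measurable_restrict_to [measurable (raw)]:
  assumes "u \<in> borel_measurable lebesgue" "S \<in> sets lebesgue"
  shows "restrict_to S u \<in> borel_measurable lebesgue"
  unfolding restrict_to_def using assms by measurable

lemma norm_restrict_to_le: "cmod (restrict_to S u x) \<le> cmod (u x)"
  by (simp add: restrict_to_def)

lemma restrict_to_L2:
  assumes "u \<in> L2" "S \<in> sets lebesgue"
  shows "restrict_to S u \<in> L2"
  by (rule L2_bound[OF _ L2_integrable[OF assms(1)]])
    (use assms L2_measurable in \<open>auto intro!: borel_measurable_restrict_to AE_I2 power_mono norm_restrict_to_le\<close>)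

lemma restrict_to_tendsto:
  assumes u: "u \<in> L2" and S: "\<And>n. S n \<in> sets lebesgue"
    and ev: "\<And>x. \<forall>\<^sub>F n in sequentially. x \<in> S n"
  shows "(\<lambda>n. cls (restrict_to (S n) u)) \<longlonglongrightarrow> cls u"
proof (rule l2_dominated_convergence(3)[where g="\<lambda>x. cmod (u x)"])
  show "AE x in lebesgue. (\<lambda>n. restrict_to (S n) u x) \<longlonglongrightarrow> u x"
  proof (rule AE_I2)
    fix x
    show "(\<lambda>n. restrict_to (S n) u x) \<longlonglongrightarrow> u x"
      by (intro tendsto_eventually eventually_mono[OF ev[of x]]) (simp add: restrict_to_def)
  qed
qed (use u S L2_measurable in \<open>auto intro: L2_integrable borel_measurable_restrict_to norm_restrict_to_le\<close>)

lemma cball_eventually: "\<forall>\<^sub>F n in sequentially. (x :: 'a::real_normed_vector) \<in> cball 0 (real n)"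
  using eventually_ge_at_top[of "nat \<lceil>norm x\<rceil>"]
  by eventually_elim (auto simp: nat_le_iff ceiling_le_iff)

lemma integrable_L2_of_finite_support:
  fixes u :: "'n::finite wave"
  assumes u: "u \<in> L2" and S: "S \<in> sets lebesgue" "emeasure lebesgue S < \<infinity>"
    and supp: "\<And>x. x \<notin> S \<Longrightarrow> u x = 0"
  shows "integrable lebesgue u"
proof (rule Bochner_Integration.integrable_bound)
  show "integrable lebesgue (\<lambda>x. indicat_real S x + (cmod (u x))\<^sup>2)"
    using S by (intro Bochner_Integration.integrable_add L2_integrable u) auto
  have "cmod (u x) \<le> indicator S x + (cmod (u x))\<^sup>2" for x
  proof (cases "x \<in> S")
    case True
    have "2 * cmod (u x) \<le> 1 + (cmod (u x))\<^sup>2"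
      using zero_le_power2[of "1 - cmod (u x)"] by (simp add: power2_eq_square algebra_simps)
    then show ?thesis using True by simp (smt (verit) norm_ge_zero)
  qed (simp add: supp)
  then show "AE x in lebesgue. norm (u x) \<le> norm (indicat_real S x + (cmod (u x))\<^sup>2)"
    by (intro AE_I2) (smt (verit) real_norm_def)
qed (use u L2_measurable in auto)

lemma cball_lebesgue:
  "cball (0 :: 'a::euclidean_space) r \<in> sets lebesgue" "emeasure lebesgue (cball (0 :: 'a) r) < \<infinity>"
  using emeasure_bounded_finite[OF bounded_cball, of "0 :: 'a" r] by auto

lemma integrable_restrict_cball: "u \<in> L2 \<Longrightarrow> integrable lebesgue (restrict_to (cball 0 r) u)"
  by (rule integrable_L2_of_finite_support[OF restrict_to_L2 cball_lebesgue])
    (auto simp: restrict_to_def cball_lebesgue)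

section \<open>Extension of the transform to all square-integrable functions\<close>

definition F_trunc :: "real \<Rightarrow> nat \<Rightarrow> 'n::finite l2 \<Rightarrow> 'n l2" where
  "F_trunc s n x = cls (ft s (restrict_to (cball 0 (real n)) (rep x)))"

text \<open>Restriction to a ball makes a square-integrable function integrable; as
  \<open>ft s\<close> is a contraction for \<open>\<bar>s\<bar> = 1\<close>, the transforms of the
  restrictions then form a Cauchy sequence and the limit exists.\<close>

definition Fou :: "real \<Rightarrow> 'n::finite l2 \<Rightarrow> 'n l2" where
  "Fou s x = lim (\<lambda>n. F_trunc s n x)"

lemma ft_cong_AE:
  assumes "integrable lebesgue u" "integrable lebesgue v" "AE x in lebesgue. u x = v x"
  shows "ft s u = ft s v"
proof
  fix \<xi>
  have "(LINT x|lebesgue. cis (s * (\<xi> \<bullet> x)) * u x) = (LINT x|lebesgue. cis (s * (\<xi> \<bullet> x)) * v x)"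
    using assms by (intro integral_cong_AE) (auto intro: borel_measurable_integrable integrable_ft_kernel elim: eventually_mono)
  then show "ft s u \<xi> = ft s v \<xi>" by (simp add: ft_def)
qed

context
  fixes s :: real
  assumes s: "\<bar>s\<bar> = 1"
begin

lemma norm_cls_ft_diff_le:
  assumes "integrable lebesgue u" "u \<in> L2" "integrable lebesgue v" "v \<in> L2"
  shows "norm (cls (ft s u) - cls (ft s v)) \<le> norm (cls u - cls v)"
proof -
  have "cls (ft s u) - cls (ft s v) = cls (ft s (\<lambda>x. u x - v x))"
    using assms by (simp add: cls_diff ft_L2[OF s] ft_diff)
  also have "norm \<dots> \<le> norm (cls (\<lambda>x. u x - v x))"
    using assms by (intro ft_L2 s L2_diff) auto
  also have "\<dots> = norm (cls u - cls v)" using assms by (simp add: cls_diff)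
  finally show ?thesis .
qed

lemma cls_restrict_rep_tendsto: "(\<lambda>n. cls (restrict_to (cball 0 (real n)) (rep x))) \<longlonglongrightarrow> x"
  using restrict_to_tendsto[OF rep_L2 cball_lebesgue(1) cball_eventually, of x] by simp

lemma F_trunc_tendsto: "(\<lambda>n. F_trunc s n x) \<longlonglongrightarrow> Fou s x"
proof -
  let ?t = "\<lambda>n. restrict_to (cball 0 (real n)) (rep x)"
  have t: "integrable lebesgue (?t n)" "?t n \<in> L2" for n
    by (auto intro: integrable_restrict_cball restrict_to_L2 cball_lebesgue)
  have C: "Cauchy (\<lambda>n. cls (?t n))"
    by (intro convergent_Cauchy convergentI[OF cls_restrict_rep_tendsto])
  have "Cauchy (\<lambda>n. F_trunc s n x)"
  proof (rule CauchyI)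
    fix e :: real assume "e > 0"
    then obtain M where M: "\<And>m n. m \<ge> M \<Longrightarrow> n \<ge> M \<Longrightarrow> norm (cls (?t m) - cls (?t n)) < e"
      using CauchyD[OF C] by blast
    show "\<exists>M. \<forall>m\<ge>M. \<forall>n\<ge>M. norm (F_trunc s m x - F_trunc s n x) < e"
      unfolding F_trunc_def using M norm_cls_ft_diff_le[OF t t] by (meson le_less_trans)
  qed
  then show ?thesis unfolding Fou_def by (simp add: Cauchy_convergent convergent_LIMSEQ_iff[symmetric])
qed

lemma Fou_cls:
  assumes "integrable lebesgue u" "u \<in> L2"
  shows "Fou s (cls u) = cls (ft s u)"
proof -
  let ?t = "\<lambda>n. restrict_to (cball 0 (real n)) (rep (cls u))"
  have "(\<lambda>n. F_trunc s n (cls u) - cls (ft s u)) \<longlonglongrightarrow> 0"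
  proof (rule Lim_null_comparison)
    show "\<forall>\<^sub>F n in sequentially. norm (F_trunc s n (cls u) - cls (ft s u)) \<le> norm (cls (?t n) - cls u)"
      unfolding F_trunc_def
      by (intro always_eventually allI norm_cls_ft_diff_le assms)
        (auto intro: integrable_restrict_cball restrict_to_L2 cball_lebesgue)
    show "(\<lambda>n. norm (cls (?t n) - cls u)) \<longlonglongrightarrow> 0"
      using cls_restrict_rep_tendsto[of "cls u"] by (simp add: LIM_zero tendsto_norm_zero)
  qed
  then have "(\<lambda>n. F_trunc s n (cls u)) \<longlonglongrightarrow> cls (ft s u)" by (simp add: LIM_zero_cancel)
  then show ?thesis using F_trunc_tendsto LIMSEQ_unique by blast
qed

lemma l2_dense_induct:
  assumes "closed {x. Q x}" "\<And>u. integrable lebesgue u \<Longrightarrow> u \<in> L2 \<Longrightarrow> Q (cls u)"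
  shows "Q (x :: 'n::finite l2)"
proof -
  have "cls (restrict_to (cball 0 (real n)) (rep x)) \<in> {x. Q x}" for n
    by (auto intro!: assms(2) integrable_restrict_cball restrict_to_L2 cball_lebesgue)
  from closed_sequentially[OF assms(1) this cls_restrict_rep_tendsto] show ?thesis by simp
qed

lemma bounded_linear_Fou: "bounded_linear (Fou s :: 'n::finite l2 \<Rightarrow> 'n l2)"
  and norm_Fou_le: "norm (Fou s x) \<le> norm (x :: 'n l2)"
proof -
  let ?t = "\<lambda>n x. restrict_to (cball 0 (real n)) (rep x)"
  have le: "norm (Fou s x) \<le> norm (x :: 'n l2)" for x
  proof (rule LIMSEQ_le)
    show "(\<lambda>n. norm (F_trunc s n x)) \<longlonglongrightarrow> norm (Fou s x)"
      by (intro tendsto_norm F_trunc_tendsto)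
    show "(\<lambda>n. norm (cls (?t n x))) \<longlonglongrightarrow> norm x"
      by (intro tendsto_norm cls_restrict_rep_tendsto)
    show "\<exists>N. \<forall>n\<ge>N. norm (F_trunc s n x) \<le> norm (cls (?t n x))"
      unfolding F_trunc_def
      by (auto intro: ft_L2 s integrable_restrict_cball restrict_to_L2 cball_lebesgue)
  qed
  then show "norm (Fou s x) \<le> norm (x :: 'n l2)" .
  show "bounded_linear (Fou s :: 'n l2 \<Rightarrow> 'n l2)"
  proof (rule bounded_linear_intro[where K=1])
    have tI: "integrable lebesgue (?t n x)" and tL: "?t n x \<in> L2" for n and x :: "'n l2"
      by (auto intro: integrable_restrict_cball restrict_to_L2 cball_lebesgue)
    fix x y :: "'n l2" and r :: real
    have "F_trunc s n (x + y) = F_trunc s n x + F_trunc s n y" for n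
    proof -
      have "AE t in lebesgue. rep (x + y) t = rep x t + rep y t"
        using AE_rep_cls[OF L2_add[OF rep_L2 rep_L2], of x y] cls_add[OF rep_L2 rep_L2, of x y] by simp
      then have "AE t in lebesgue. ?t n (x + y) t = ?t n x t + ?t n y t"
        by eventually_elim (simp add: restrict_to_def)
      from ft_cong_AE[OF tI Bochner_Integration.integrable_add[OF tI tI] this, of s] show ?thesis
        unfolding F_trunc_def by (simp add: ft_add tI cls_add ft_L2[OF s tI tL])
    qed
    then have "(\<lambda>n. F_trunc s n (x + y)) \<longlonglongrightarrow> Fou s x + Fou s y"
      by (simp add: tendsto_add F_trunc_tendsto)
    then show "Fou s (x + y) = Fou s x + Fou s y"
      using F_trunc_tendsto LIMSEQ_unique by blast
    have "F_trunc s n (r *\<^sub>R x) = r *\<^sub>R F_trunc s n x" for n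
    proof -
      have "AE t in lebesgue. rep (r *\<^sub>R x) t = of_real r * rep x t"
        using AE_rep_cls[OF L2_scaleR[OF rep_L2], of r x] cls_scaleR[OF rep_L2, of r x]
        by (simp add: scaleR_conv_of_real)
      then have "AE t in lebesgue. ?t n (r *\<^sub>R x) t = of_real r * ?t n x t"
        by eventually_elim (simp add: restrict_to_def)
      from ft_cong_AE[OF tI integrable_mult_right[OF tI] this, of s] show ?thesis
        unfolding F_trunc_def by (simp add: ft_cmult cls_scaleR ft_L2[OF s tI tL] scaleR_conv_of_real)
    qed
    then have "(\<lambda>n. F_trunc s n (r *\<^sub>R x)) \<longlonglongrightarrow> r *\<^sub>R Fou s x"
      by (simp add: tendsto_scaleR F_trunc_tendsto)
    then show "Fou s (r *\<^sub>R x) = r *\<^sub>R Fou s x"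
      using F_trunc_tendsto LIMSEQ_unique by blast
  qed (simp add: le)
qed

lemma Fou_J: "Fou s (J x) = J (Fou s (x :: 'n::finite l2))"
proof (rule l2_dense_induct[where Q="\<lambda>x. Fou s (J x) = J (Fou s x)"])
  show "closed {x :: 'n l2. Fou s (J x) = J (Fou s x)}"
    by (intro closed_Collect_eq linear_continuous_on bounded_linear_compose[OF bounded_linear_Fou bounded_linear_J]
        bounded_linear_compose[OF bounded_linear_J bounded_linear_Fou])
  fix u :: "'n wave" assume "integrable lebesgue u" "u \<in> L2"
  then show "Fou s (J (cls u)) = J (Fou s (cls u))"
    by (simp add: J_cls Fou_cls L2_cmult ft_L2[OF s] ft_cmult)
qed

text \<open>Centring at \<open>x\<close> and rescaling turns the kernel into the fixed density
  \<open>gauss 1\<close>, with \<open>u\<close> evaluated at points that tend to \<open>x\<close>;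
  dominated convergence applies because \<open>u\<close> is bounded.\<close>

lemma convolution_gauss_tendsto:
  fixes u :: "'n::finite wave"
  assumes u: "continuous_on UNIV u" "\<And>x. norm (u x) \<le> K"
  shows "(\<lambda>n. LINT y|lebesgue. gauss (1 / (real n + 1)) (y - x) * u y) \<longlonglongrightarrow> u x"
proof -
  have [measurable]: "u \<in> borel_measurable borel"
    using u(1) by (rule borel_measurable_continuous_onI)
  define c where "c n = 1 / (real n + 1)" for n
  have c: "c n > 0" for n by (simp add: c_def)
  have c0: "c \<longlonglongrightarrow> 0"
    unfolding c_def using LIMSEQ_inverse_real_of_nat by (simp add: inverse_eq_divide add.commute)
  have eq: "(LINT y|lebesgue. gauss (c n) (y - x) * u y)
      = (LINT y|lborel. gauss 1 y *\<^sub>R u (x + c n *\<^sub>R y))" for n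
  proof -
    have g: "\<bar>c n\<bar> ^ DIM(real ^ 'n) * gauss (c n) (c n *\<^sub>R y) = gauss 1 y" for y :: "real ^ 'n"
      using c[of n] by (simp add: gauss_eq power_mult_distrib)
    have "(LINT y|lebesgue. gauss (c n) (y - x) * u y) = (LINT y|lborel. gauss (c n) (y - x) * u y)"
      by (rule integral_completion) measurable
    also have "\<dots> = (LINT y|density (distr lborel borel (\<lambda>y. x + c n *\<^sub>R y)) (\<lambda>_. \<bar>c n\<bar> ^ DIM(real ^ 'n)). gauss (c n) (y - x) * u y)"
      using lborel_affine[of "c n" x] c[of n] by simp
    also have "\<dots> = (LINT y|lborel. \<bar>c n\<bar> ^ DIM(real ^ 'n) *\<^sub>R (gauss (c n) (c n *\<^sub>R y) * u (x + c n *\<^sub>R y)))"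
      by (subst integral_density) (auto simp: integral_distr)
    also have "\<dots> = (LINT y|lborel. gauss 1 y *\<^sub>R u (x + c n *\<^sub>R y))"
      unfolding g[symmetric] by (simp add: scaleR_conv_of_real mult_ac)
    finally show ?thesis .
  qed
  have "(\<lambda>n. LINT y|lborel. gauss 1 y *\<^sub>R u (x + c n *\<^sub>R y)) \<longlonglongrightarrow> (LINT y|lborel. gauss 1 (y :: real ^ 'n) *\<^sub>R u x)"
  proof (rule integral_dominated_convergence[where w="\<lambda>y. K * gauss 1 y"])
    show "AE y in lborel. (\<lambda>n. gauss 1 y *\<^sub>R u (x + c n *\<^sub>R y)) \<longlonglongrightarrow> gauss 1 y *\<^sub>R u x"
    proof (intro AE_I2 tendsto_scaleR tendsto_const)
      fix y
      have "(\<lambda>n. x + c n *\<^sub>R y) \<longlonglongrightarrow> x + 0 *\<^sub>R y" by (intro tendsto_intros c0)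
      then show "(\<lambda>n. u (x + c n *\<^sub>R y)) \<longlonglongrightarrow> u x"
        using u(1) by (intro continuous_on_tendsto_compose[OF u(1)]) auto
    qed
    show "AE y in lborel. norm (gauss 1 y *\<^sub>R u (x + c n *\<^sub>R y)) \<le> K * gauss 1 y" for n
    proof (rule AE_I2)
      fix y
      have "norm (gauss 1 y *\<^sub>R u (x + c n *\<^sub>R y)) = norm (u (x + c n *\<^sub>R y)) * gauss 1 y"
        by (simp add: gauss_nonneg)
      also have "\<dots> \<le> K * gauss 1 y" by (intro mult_right_mono u(2) gauss_nonneg)
      finally show "norm (gauss 1 y *\<^sub>R u (x + c n *\<^sub>R y)) \<le> K * gauss 1 y" .
    qed
  qed (auto intro!: integrable_mult_right integrable_gauss)
  also have "(LINT y|lborel. gauss 1 (y :: real ^ 'n) *\<^sub>R u x) = u x"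
    by (simp add: integrable_gauss)
  finally show ?thesis unfolding eq[symmetric] unfolding c_def .
qed

end

section \<open>Fourier inversion and the isometry\<close>

text \<open>The damped transforms converge in the mean to \<open>ft s u\<close>. Their inverse
  transforms are Gaussian averages of \<open>u\<close>, which converge pointwise because
  \<open>u\<close> is continuous; by \<open>l2_pointwise_limit\<close> the two limits
  coincide.\<close>

lemma Fou_inverse_continuous:
  fixes u :: "'n::finite wave"
  assumes s: "\<bar>s\<bar> = 1" and u: "continuous_on UNIV u" "\<And>x. norm (u x) \<le> K" "integrable lebesgue u" "u \<in> L2"
  shows "Fou (- s) (Fou s (cls u)) = cls u"
proof -
  have s': "\<bar>- s\<bar> = 1" using s by simp
  let ?d = "\<lambda>n \<xi>. damp (1 / (real n + 1)) \<xi> * ft s u \<xi>"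
  have mft: "ft s u \<in> borel_measurable lebesgue" using u(3) by (rule borel_measurable_ft_lebesgue)
  have ftL: "ft s u \<in> L2" by (rule ft_L2(1)[OF s u(3,4)])
  obtain C where C: "\<And>\<xi>. norm (ft s u \<xi>) \<le> C" using norm_ft_le by blast
  have mdamp: "damp \<sigma> \<in> borel_measurable (lebesgue :: (real ^ 'n) measure)" for \<sigma>
    by (rule borel_measurable_lebesgueI) measurable
  have di: "integrable lebesgue (?d n)" for n
    by (rule integrable_damp_mult[OF _ mft C]) simp
  have dle: "cmod (?d n \<xi>) \<le> cmod (ft s u \<xi>)" for n \<xi>
    using mult_right_mono[OF damp_bounds(2), of "cmod (ft s u \<xi>)"]
    by (simp add: norm_mult abs_of_pos[OF damp_bounds(1)])
  have md: "?d n \<in> borel_measurable lebesgue" for n by (rule borel_measurable_integrable[OF di])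
  have lim: "AE \<xi> in lebesgue. (\<lambda>n. ?d n \<xi>) \<longlonglongrightarrow> ft s u \<xi>"
  proof (rule AE_I2)
    fix \<xi>
    have "(\<lambda>n. ?d n \<xi>) \<longlonglongrightarrow> complex_of_real 1 * ft s u \<xi>"
      by (intro tendsto_mult tendsto_of_real damp_tendsto_1 tendsto_const)
    then show "(\<lambda>n. ?d n \<xi>) \<longlonglongrightarrow> ft s u \<xi>" by simp
  qed
  note D = l2_dominated_convergence[OF md mft L2_integrable[OF ftL] AE_I2[OF dle] lim]
  have "(\<lambda>n. Fou (- s) (cls (?d n))) \<longlonglongrightarrow> Fou (- s) (cls (ft s u))"
    by (intro bounded_linear.tendsto[OF bounded_linear_Fou[OF s']] D(3))
  then have "(\<lambda>n. cls (ft (- s) (?d n))) \<longlonglongrightarrow> Fou (- s) (Fou s (cls u))"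
    by (simp add: Fou_cls[OF s'] Fou_cls[OF s] di D(1) u)
  moreover have "AE x in lebesgue. (\<lambda>n. ft (- s) (?d n) x) \<longlonglongrightarrow> u x"
  proof (rule AE_I2)
    fix x
    have "ft (- s) (?d n) x = (LINT y|lebesgue. gauss (1 / (real n + 1)) (y - x) * u y)" for n
      by (rule ft_damp_ft[OF _ s u(3)]) simp
    then show "(\<lambda>n. ft (- s) (?d n) x) \<longlonglongrightarrow> u x"
      using convolution_gauss_tendsto[OF s u(1,2)] by simp
  qed
  ultimately show ?thesis
    using u(4) by (intro l2_pointwise_limit(2)[symmetric, of "\<lambda>n. ft (- s) (?d n)"])
      (auto intro!: ft_L2(1)[OF s'] di D(1) L2_measurable)
qed

text \<open>A measurable function is an almost everywhere limit of continuous ones, but without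
  control of their size. \<open>clamp\<close>, the nearest-point map onto the disc of radius
  \<open>K\<close>, and the cutoff \<open>cut\<close> supply a square-integrable majorant and do not
  change the limit.\<close>

lemma continuous_dense:
  fixes v :: "'n::finite wave"
  assumes v: "v \<in> borel_measurable lebesgue" "\<And>x. cmod (v x) \<le> K" "\<And>x. norm x > r \<Longrightarrow> v x = 0"
  shows "\<exists>f. (\<forall>n. continuous_on UNIV (f n) \<and> (\<forall>x. cmod (f n x) \<le> K) \<and> integrable lebesgue (f n) \<and> f n \<in> L2)
    \<and> (\<lambda>n. cls (f n)) \<longlonglongrightarrow> cls v"
proof -
  have K: "K \<ge> 0" using v(2) norm_ge_zero order_trans by blast
  obtain N g where N: "negligible N" and g: "\<And>n. continuous_on UNIV (g n)"
    and gv: "\<And>x. x \<notin> N \<Longrightarrow> (\<lambda>n. g n x) \<longlonglongrightarrow> v x"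
    using lebesgue_measurable_imp_measurable_on[OF v(1), of UNIV] unfolding measurable_on_def by auto
  define clamp where "clamp = closest_point (cball (0 :: complex) K)"
  have clamp: "continuous_on UNIV clamp" "norm (clamp w) \<le> K" "norm w \<le> K \<Longrightarrow> clamp w = w" for w
    using continuous_on_closest_point[of "cball (0 :: complex) K" UNIV] K
      closest_point_in_set[of "cball (0 :: complex) K" w] closest_point_self[of w "cball 0 K"]
    unfolding clamp_def by auto
  define cut where "cut x = max 0 (min 1 (r + 1 - norm x))" for x :: "real ^ 'n"
  define f where "f n x = cut x *\<^sub>R clamp (g n x)" for n x
  have cut: "0 \<le> cut x" "cut x \<le> 1" "norm x \<le> r \<Longrightarrow> cut x = 1" "x \<notin> cball 0 (r + 1) \<Longrightarrow> cut x = 0" for x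
    unfolding cut_def by auto
  have cont: "continuous_on UNIV (f n)" for n
    unfolding f_def cut_def
    by (intro continuous_intros continuous_on_compose2[OF clamp(1) g]) auto
  have bound: "cmod (f n x) \<le> K" for n x
  proof -
    have "cut x * cmod (clamp (g n x)) \<le> 1 * K" by (intro mult_mono cut clamp) auto
    then show ?thesis using cut(1)[of x] by (simp add: f_def)
  qed
  have supp: "x \<notin> cball 0 (r + 1) \<Longrightarrow> f n x = 0" for n x by (drule cut(4)) (simp add: f_def)
  have mf: "f n \<in> borel_measurable lebesgue" for n
    by (intro borel_measurable_lebesgueI borel_measurable_continuous_onI cont)
  have ind: "integrable lebesgue (indicat_real (cball (0 :: real ^ 'n) (r + 1)))"
    by (intro integrable_real_indicator cball_lebesgue)
  have int: "integrable lebesgue (\<lambda>x :: real ^ 'n. (K * indicator (cball 0 (r + 1)) x)\<^sup>2)"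
  proof -
    have "(K * indicat_real (cball 0 (r + 1)) x)\<^sup>2 = K\<^sup>2 * indicat_real (cball 0 (r + 1)) x" for x :: "real ^ 'n"
      by (simp add: indicator_def)
    then show ?thesis using integrable_mult_right[OF ind, of "K\<^sup>2"] by simp
  qed
  have le: "AE x in lebesgue. cmod (f n x) \<le> K * indicator (cball 0 (r + 1)) x" for n
  proof (rule AE_I2)
    fix x show "cmod (f n x) \<le> K * indicator (cball 0 (r + 1)) x"
      using bound[of n x] supp[of x n] by (cases "x \<in> cball 0 (r + 1)") auto
  qed
  have "AE x in lebesgue. x \<notin> N"
    using N by (intro AE_not_in) (simp add: negligible_iff_null_sets)
  then have lim: "AE x in lebesgue. (\<lambda>n. f n x) \<longlonglongrightarrow> v x"
  proof eventually_elim
    case (elim x)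
    have "(\<lambda>n. f n x) \<longlonglongrightarrow> cut x *\<^sub>R clamp (v x)"
      unfolding f_def
      by (intro tendsto_intros continuous_on_tendsto_compose[OF clamp(1) gv[OF elim]]) auto
    moreover have "cut x *\<^sub>R clamp (v x) = v x"
      unfolding clamp(3)[OF v(2)] using v(3)[of x] cut(3)[of x] by (cases "norm x > r") auto
    ultimately show ?case by simp
  qed
  note D = l2_dominated_convergence[OF mf v(1) int le lim]
  have "integrable lebesgue (f n)" for n
    by (rule integrable_L2_of_finite_support[OF D(1) cball_lebesgue supp])
  then show ?thesis
    using D(1,3) cont bound by (intro exI[of _ f]) auto
qed

text \<open>The vectors for which inversion holds form a closed set. It contains the classes of
  bounded functions of bounded support by \<open>continuous_dense\<close>, and these are dense: the
  sets \<open>S n\<close> truncate both the argument and the values.\<close>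

lemma Fou_inverse:
  assumes s: "\<bar>s\<bar> = 1"
  shows "Fou (- s) (Fou s x) = (x :: 'n::finite l2)"
proof -
  let ?Q = "\<lambda>x :: 'n l2. Fou (- s) (Fou s x) = x"
  have s': "\<bar>- s\<bar> = 1" using s by simp
  have cl: "closed {x. ?Q x}"
    by (intro closed_Collect_eq continuous_intros linear_continuous_on
        bounded_linear_compose[OF bounded_linear_Fou[OF s'] bounded_linear_Fou[OF s]])
  have 1: "?Q (cls v)" if v: "v \<in> borel_measurable lebesgue" "\<And>x. cmod (v x) \<le> K"
    "\<And>x. norm x > r \<Longrightarrow> v x = 0" for v K r
  proof -
    obtain f where f: "\<And>n. continuous_on UNIV (f n)" "\<And>n x. cmod (f n x) \<le> K"
      "\<And>n. integrable lebesgue (f n)" "\<And>n. f n \<in> L2" "(\<lambda>n. cls (f n)) \<longlonglongrightarrow> cls v"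
      using continuous_dense[OF v] by blast
    have "cls (f n) \<in> {x. ?Q x}" for n
      using Fou_inverse_continuous[OF s f(1,2,3,4)] by simp
    from closed_sequentially[OF cl this f(5)] show ?thesis by simp
  qed
  define S where "S n = {t. norm t \<le> real n \<and> cmod (rep x t) \<le> real n}" for n
  have [measurable]: "rep x \<in> borel_measurable lebesgue" by (intro L2_measurable rep_L2)
  have S: "S n \<in> sets lebesgue" for n
  proof -
    have "{t \<in> space lebesgue. cmod (rep x t) \<le> real n} \<in> sets lebesgue" by measurable
    moreover have "S n = cball 0 (real n) \<inter> {t \<in> space lebesgue. cmod (rep x t) \<le> real n}"
      by (auto simp: S_def)
    ultimately show ?thesis using cball_lebesgue(1) by auto
  qed
  have "\<forall>\<^sub>F n in sequentially. t \<in> S n" for t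
    using cball_eventually[of t] cball_eventually[of "rep x t"]
    by eventually_elim (simp add: S_def)
  from restrict_to_tendsto[OF rep_L2 S this]
  have lim: "(\<lambda>n. cls (restrict_to (S n) (rep x))) \<longlonglongrightarrow> x" by simp
  have "cls (restrict_to (S n) (rep x)) \<in> {x. ?Q x}" for n
  proof -
    have "?Q (cls (restrict_to (S n) (rep x)))"
    proof (rule 1)
      show "restrict_to (S n) (rep x) \<in> borel_measurable lebesgue"
        using S by (intro borel_measurable_restrict_to) measurable
      show "cmod (restrict_to (S n) (rep x) t) \<le> real n" for t
        by (simp add: restrict_to_def S_def)
      show "restrict_to (S n) (rep x) t = 0" if "norm t > real n" for t
        using that by (simp add: restrict_to_def S_def)
    qed
    then show ?thesis by simp
  qed
  from closed_sequentially[OF cl this lim] show ?thesis by simp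
qed

lemma norm_Fou [simp]:
  assumes s: "\<bar>s\<bar> = 1"
  shows "norm (Fou s x) = norm (x :: 'n::finite l2)"
proof (rule antisym)
  have s': "\<bar>- s\<bar> = 1" using s by simp
  show "norm (Fou s x) \<le> norm x" by (rule norm_Fou_le[OF s])
  show "norm x \<le> norm (Fou s x)"
    using norm_Fou_le[OF s', of "Fou s x"] by (simp add: Fou_inverse[OF s])
qed

text \<open>Every approximating sequence allowed in \<open>fourier_op\<close> leads to the same
  limit by continuity of \<open>Fou\<close>, and the restrictions to balls form such a
  sequence.\<close>

lemma fourier_op_iff:
  "(u, v) \<in> fourier_op \<longleftrightarrow> u \<in> L2 \<and> v \<in> L2 \<and> Fou (- 1) (cls u) = cls (v :: 'n::finite wave)"
proof
  have s: "\<bar>- 1 :: real\<bar> = 1" by simp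
  assume "(u, v) \<in> fourier_op"
  then obtain f where f: "\<And>n. integrable lebesgue (f n)" "L2_tendsto f u" "L2_tendsto (\<lambda>n. ft (- 1) (f n)) v"
    unfolding fourier_op_def fourier_integral_eq_ft by auto
  then have L: "\<And>n. f n \<in> L2" "u \<in> L2" "v \<in> L2" and lim: "(\<lambda>n. cls (f n)) \<longlonglongrightarrow> cls u"
    "(\<lambda>n. cls (ft (- 1) (f n))) \<longlonglongrightarrow> cls v"
    by (auto simp: L2_tendsto_iff)
  have "(\<lambda>n. Fou (- 1) (cls (f n))) \<longlonglongrightarrow> Fou (- 1) (cls u)"
    by (rule bounded_linear.tendsto[OF bounded_linear_Fou[OF s] lim(1)])
  then have "(\<lambda>n. cls (ft (- 1) (f n))) \<longlonglongrightarrow> Fou (- 1) (cls u)"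
    by (simp add: Fou_cls[OF s f(1) L(1)])
  then show "u \<in> L2 \<and> v \<in> L2 \<and> Fou (- 1) (cls u) = cls v"
    using L lim(2) LIMSEQ_unique by blast
next
  have s: "\<bar>- 1 :: real\<bar> = 1" by simp
  assume *: "u \<in> L2 \<and> v \<in> L2 \<and> Fou (- 1) (cls u) = cls v"
  let ?t = "\<lambda>n. restrict_to (cball 0 (real n)) u"
  have t: "integrable lebesgue (?t n)" "?t n \<in> L2" for n
    using * by (auto intro: integrable_restrict_cball restrict_to_L2 cball_lebesgue)
  have lim: "(\<lambda>n. cls (?t n)) \<longlonglongrightarrow> cls u"
    using * by (intro restrict_to_tendsto cball_lebesgue cball_eventually) auto
  have "(\<lambda>n. Fou (- 1) (cls (?t n))) \<longlonglongrightarrow> Fou (- 1) (cls u)"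
    by (rule bounded_linear.tendsto[OF bounded_linear_Fou[OF s] lim])
  then have "(\<lambda>n. cls (ft (- 1) (?t n))) \<longlonglongrightarrow> cls v"
    using * by (simp add: Fou_cls[OF s t])
  then show "(u, v) \<in> fourier_op"
    unfolding fourier_op_def fourier_integral_eq_ft
    using * t lim ft_L2(1)[OF s t]
    by (auto simp: L2_tendsto_iff intro!: exI[of _ ?t])
qed

section \<open>The inequality of Rumin\<close>

text \<open>The square of a sum is at most \<open>(cmod y)\<^sup>2 / (1 - t)\<close> plus
  \<open>(cmod w)\<^sup>2 / t\<close>; multiplying by \<open>1 - t\<close> admits
  \<open>t = 1\<close> as well. After the triangle inequality the defect is a square divided by
  \<open>t\<close>.\<close>

lemma power2_norm_add_le:
  fixes y w :: complex
  assumes t: "0 < t" "t \<le> 1"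
  shows "(1 - t) * (cmod (y + w))\<^sup>2 \<le> (cmod y)\<^sup>2 + (1 - t) / t * (cmod w)\<^sup>2"
proof -
  have "(cmod (y + w))\<^sup>2 \<le> (cmod y + cmod w)\<^sup>2"
    by (intro power_mono norm_triangle_ineq) auto
  then have "(1 - t) * (cmod (y + w))\<^sup>2 \<le> (1 - t) * (cmod y + cmod w)\<^sup>2"
    using t by (intro mult_left_mono) auto
  also have "\<dots> \<le> (cmod y)\<^sup>2 + (1 - t) / t * (cmod w)\<^sup>2"
  proof -
    have "0 \<le> (t * cmod y - (1 - t) * cmod w)\<^sup>2" by simp
    also have "\<dots> = t * ((cmod y)\<^sup>2 + (1 - t) / t * (cmod w)\<^sup>2 - (1 - t) * (cmod y + cmod w)\<^sup>2)"
      using t by (simp add: field_simps power2_eq_square)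
    finally show ?thesis using t by (simp add: zero_le_mult_iff)
  qed
  finally show ?thesis .
qed

lemma nn_integral_one_minus_powr:
  assumes T: "T > 0" and r: "r > 0" and \<rho>: "\<rho> \<ge> 0"
  shows "(\<integral>\<^sup>+E. ennreal ((1 - (E / T) powr r) * \<rho>) * indicator {0..T} E \<partial>lborel)
    = ennreal (\<rho> * T * r / (r + 1))"
proof (rule nn_integral_has_integral_lebesgue')
  have "((\<lambda>E. \<rho> * (1 - inverse (T powr r) * E powr r)) has_integral
      \<rho> * (T - inverse (T powr r) * (T powr (r + 1) / (r + 1)))) {0..T}"
    using r T has_integral_const_real[of "1 :: real" 0 T]
    by (intro has_integral_mult_right has_integral_diff has_integral_powr_from_0) auto
  moreover have "\<rho> * (T - inverse (T powr r) * (T powr (r + 1) / (r + 1))) = \<rho> * T * r / (r + 1)"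
    using T r by (simp add: powr_add field_simps)
  ultimately have *: "((\<lambda>E. \<rho> * (1 - inverse (T powr r) * E powr r)) has_integral \<rho> * T * r / (r + 1)) {0..T}"
    by simp
  have "\<rho> * (1 - inverse (T powr r) * E powr r) = (1 - (E / T) powr r) * \<rho>" if "E \<in> {0..T}" for E
    using that T by (simp add: powr_divide field_simps)
  from has_integral_eq[OF this *]
  show "((\<lambda>E. (1 - (E / T) powr r) * \<rho>) has_integral \<rho> * T * r / (r + 1)) {0..T}" .
  fix E assume E: "E \<in> {0..T}"
  have "(E / T) powr r \<le> 1 powr r"
    using E T r by (intro powr_mono2) auto
  then show "0 \<le> (1 - (E / T) powr r) * \<rho>" using \<rho> by simp
qed

text \<open>With \<open>t = (E / T) powr r\<close> the integrand is
  \<open>c * ((1 - t) / t) * E powr (2 * r)\<close>, the cost of the high part when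
  \<open>2 * r = p - 1\<close>.\<close>

lemma nn_integral_powr_diff:
  assumes T: "T > 0" and r: "r > 0" and c: "c \<ge> 0"
  shows "(\<integral>\<^sup>+E. ennreal (c * (T powr r * E powr r - E powr (2 * r))) * indicator {0..T} E \<partial>lborel)
    = ennreal (c * T powr (2 * r + 1) * (r / ((r + 1) * (2 * r + 1))))"
proof (rule nn_integral_has_integral_lebesgue')
  have "((\<lambda>E. c * (T powr r * E powr r - E powr (2 * r))) has_integral
      c * (T powr r * (T powr (r + 1) / (r + 1)) - T powr (2 * r + 1) / (2 * r + 1))) {0..T}"
    using r T by (intro has_integral_mult_right has_integral_diff has_integral_powr_from_0) auto
  moreover have "T powr r * T powr (r + 1) = T powr (2 * r + 1)"
    by (simp flip: powr_add)
  then have "c * (T powr r * (T powr (r + 1) / (r + 1)) - T powr (2 * r + 1) / (2 * r + 1))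
      = c * T powr (2 * r + 1) * (1 / (r + 1) - 1 / (2 * r + 1))"
    by (simp add: algebra_simps)
  moreover have "1 / (r + 1) - 1 / (2 * r + 1) = r / ((r + 1) * (2 * r + 1))"
    using r by (simp add: field_simps)
  ultimately show "((\<lambda>E. c * (T powr r * E powr r - E powr (2 * r))) has_integral
      c * T powr (2 * r + 1) * (r / ((r + 1) * (2 * r + 1)))) {0..T}" by simp
  fix E assume E: "E \<in> {0..T}"
  have "E powr (2 * r) = E powr r * E powr r" by (simp flip: powr_add)
  also have "\<dots> \<le> T powr r * E powr r"
    using E r by (intro mult_right_mono powr_mono2) auto
  finally show "0 \<le> c * (T powr r * E powr r - E powr (2 * r))" using c by simp
qed

section \<open>Weak-type bounds and truncated operators\<close>

text \<open>\<open>N\<close> stands for the p-th power of the weak norm of \<open>a\<close>, and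
  \<open>weak\<close> is its Chebyshev form. Nonnegativity is assumed at every point; the theorem
  reaches this by passing to absolute values.\<close>

locale cwikel =
  fixes a b :: "real ^ 'n::finite \<Rightarrow> real" and p N :: real
  assumes p: "p > 1"
    and a_measurable [measurable]: "a \<in> borel_measurable lebesgue"
    and a_nonneg: "0 \<le> a \<xi>"
    and N_nonneg: "0 \<le> N"
    and weak: "\<tau> > 0 \<Longrightarrow> emeasure lebesgue {\<xi>. \<tau> < a \<xi>} \<le> ennreal (N * \<tau> powr (- p))"
    and b_measurable [measurable]: "b \<in> borel_measurable lebesgue"
    and b_nonneg: "0 \<le> b x"
    and b_integrable: "integrable lebesgue (\<lambda>x. b x powr p)"
begin

lemma sets_a_above [measurable]: "{\<xi>. \<tau> < a \<xi>} \<in> sets lebesgue"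
proof -
  have "{\<xi> \<in> space lebesgue. \<tau> < a \<xi>} \<in> sets lebesgue" by measurable
  then show ?thesis by simp
qed

text \<open>Layer cake: the levels below \<open>t\<close> contribute \<open>t\<close> times the
  bound at \<open>t\<close>, those above it the integral of \<open>N * \<tau> powr (- p)\<close>,
  which converges as \<open>p > 1\<close>. Together they give the factor
  \<open>1 + 1 / (p - 1) = p / (p - 1)\<close>.\<close>

lemma nn_integral_a_above:
  assumes t: "t > 0"
  shows "(\<integral>\<^sup>+\<xi>. ennreal (a \<xi>) * indicator {\<xi>. t < a \<xi>} \<xi> \<partial>lebesgue)
    \<le> ennreal (N * (p / (p - 1)) * t powr (1 - p))"
proof -
  interpret L: pair_sigma_finite "lebesgue :: (real ^ 'n) measure" "lborel :: real measure"
    by (intro pair_sigma_finite.intro sigma_finite_lebesgue sigma_finite_lborel)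
  let ?f = "\<lambda>\<xi> \<tau>. indicator {0..} \<tau> * indicator {\<xi>. max \<tau> t < a \<xi>} \<xi> :: ennreal"
  have m: "case_prod ?f \<in> borel_measurable (lebesgue \<Otimes>\<^sub>M lborel)"
  proof -
    have "(\<lambda>q. indicator {0..} (snd q) * (if max (snd q) t < a (fst q) then 1 else 0) :: ennreal)
        \<in> borel_measurable (lebesgue \<Otimes>\<^sub>M lborel)" by measurable
    then show ?thesis by (simp add: case_prod_beta indicator_def cong: if_cong)
  qed
  have "(\<integral>\<^sup>+\<xi>. ennreal (a \<xi>) * indicator {\<xi>. t < a \<xi>} \<xi> \<partial>lebesgue)
      = (\<integral>\<^sup>+\<xi>. (\<integral>\<^sup>+\<tau>. ?f \<xi> \<tau> \<partial>lborel) \<partial>lebesgue)"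
  proof (rule nn_integral_cong)
    fix \<xi>
    have "(\<integral>\<^sup>+\<tau>. ?f \<xi> \<tau> \<partial>lborel) = (\<integral>\<^sup>+\<tau>. indicator {\<xi>. t < a \<xi>} \<xi> * indicator {0..<a \<xi>} \<tau> \<partial>lborel)"
      by (intro nn_integral_cong) (auto simp: indicator_def)
    also have "\<dots> = ennreal (a \<xi>) * indicator {\<xi>. t < a \<xi>} \<xi>"
      using a_nonneg[of \<xi>] by (subst nn_integral_cmult) (auto simp: mult.commute)
    finally show "ennreal (a \<xi>) * indicator {\<xi>. t < a \<xi>} \<xi> = (\<integral>\<^sup>+\<tau>. ?f \<xi> \<tau> \<partial>lborel)" ..
  qed
  also have "\<dots> = (\<integral>\<^sup>+\<tau>. (\<integral>\<^sup>+\<xi>. ?f \<xi> \<tau> \<partial>lebesgue) \<partial>lborel)"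
    by (rule L.Fubini'[OF m, symmetric])
  also have "\<dots> = (\<integral>\<^sup>+\<tau>. indicator {0..} \<tau> * emeasure lebesgue {\<xi>. max \<tau> t < a \<xi>} \<partial>lborel)"
    by (intro nn_integral_cong) (simp add: nn_integral_cmult del: max_less_iff_conj)
  also have "\<dots> \<le> (\<integral>\<^sup>+\<tau>. ennreal (N * t powr (- p)) * indicator {0..t} \<tau> +
      ennreal N * (ennreal (\<tau> powr (- p)) * indicator {t..} \<tau>) \<partial>lborel)"
  proof (rule nn_integral_mono)
    fix \<tau> :: real
    show "indicator {0..} \<tau> * emeasure lebesgue {\<xi>. max \<tau> t < a \<xi>} \<le> ennreal (N * t powr (- p)) * indicator {0..t} \<tau> +
      ennreal N * (ennreal (\<tau> powr (- p)) * indicator {t..} \<tau>)"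
    proof (cases "\<tau> \<le> t")
      case True
      then show ?thesis
        using weak[OF t] by (auto simp: max_absorb2 indicator_def intro: order_trans)
    next
      case False
      then show ?thesis
        using weak[of \<tau>] t N_nonneg by (auto simp: max_absorb1 indicator_def ennreal_mult)
    qed
  qed
  also have "\<dots> = ennreal (N * t powr (- p)) * ennreal t + ennreal N * ennreal (t powr (1 - p) / (p - 1))"
  proof -
    have "(\<integral>\<^sup>+\<tau>. ennreal (\<tau> powr (- p)) * indicator {t..} \<tau> \<partial>lborel) = ennreal (- (t powr (- p + 1)) / (- p + 1))"
      using p t by (intro nn_integral_has_integral_lebesgue' has_integral_powr_to_inf) auto
    also have "- (t powr (- p + 1)) / (- p + 1) = t powr (1 - p) / (p - 1)"
      using p by (simp add: field_simps)
    finally show ?thesis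
      using t by (subst nn_integral_add) (auto simp: nn_integral_cmult)
  qed
  also have "\<dots> = ennreal (N * (p / (p - 1)) * t powr (1 - p))"
  proof -
    have "t powr (1 - p) = t * t powr (- p)"
      using t by (simp add: powr_diff powr_minus divide_inverse)
    then have "N * t powr (- p) * t + N * (t powr (1 - p) / (p - 1)) = N * (p / (p - 1)) * t powr (1 - p)"
      using p by (simp add: field_simps)
    moreover have "0 \<le> N * t powr (- p) * t" "0 \<le> N * (t powr (1 - p) / (p - 1))"
      using N_nonneg t p by auto
    ultimately show ?thesis
      using N_nonneg t p by (simp flip: ennreal_mult ennreal_plus)
  qed
  finally show ?thesis .
qed

text \<open>On these bounded sets \<open>a\<close> is bounded, so \<open>sqrt a\<close> times a
  square-integrable function is integrable there and its Fourier integral has a value at each point.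
  They exhaust the space.\<close>

definition Om :: "nat \<Rightarrow> (real ^ 'n) set" where
  "Om n = {\<xi>. a \<xi> \<le> real n \<and> norm \<xi> \<le> real n}"

lemma Om_lebesgue: "Om n \<in> sets lebesgue"
proof -
  have "{\<xi> \<in> space lebesgue. a \<xi> \<le> real n} \<inter> cball 0 (real n) \<in> sets lebesgue"
    using cball_lebesgue(1) by (intro sets.Int) measurable
  moreover have "{\<xi> \<in> space lebesgue. a \<xi> \<le> real n} \<inter> cball 0 (real n) = Om n"
    by (auto simp: Om_def)
  ultimately show ?thesis by simp
qed

lemma Om_eventually: "\<forall>\<^sub>F n in sequentially. \<xi> \<in> Om n"
  using cball_eventually[of \<xi>] cball_eventually[of "a \<xi>"]
  by eventually_elim (auto simp: Om_def)

lemma emeasure_subset_Om: "S \<in> sets lebesgue \<Longrightarrow> S \<subseteq> Om n \<Longrightarrow> emeasure lebesgue S < \<infinity>"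
  by (rule le_less_trans[OF emeasure_mono cball_lebesgue(2)[of "real n"]])
    (auto simp: Om_def)

definition sqrt_a :: "(real ^ 'n) set \<Rightarrow> 'n l2 \<Rightarrow> 'n wave" where
  "sqrt_a S \<psi> = restrict_to S (\<lambda>\<xi>. complex_of_real (sqrt (a \<xi>)) * rep \<psi> \<xi>)"

text \<open>\<open>\<psi>\<close> is a function of the momentum variable. The result is kept as a
  function rather than a class, as it is evaluated at points below.\<close>

definition vel :: "(real ^ 'n) set \<Rightarrow> 'n l2 \<Rightarrow> 'n wave" where
  "vel S \<psi> = ft 1 (sqrt_a S \<psi>)"

lemma rep_measurable [measurable]: "rep \<psi> \<in> borel_measurable lebesgue"
  by (rule L2_measurable[OF rep_L2])

lemma sqrt_a_bounded:
  assumes S: "S \<in> sets lebesgue" "S \<subseteq> Om n"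
  shows "sqrt_a S \<psi> \<in> L2" "integrable lebesgue (sqrt_a S \<psi>)"
proof -
  have "sqrt_a S \<psi> \<in> borel_measurable lebesgue"
    unfolding sqrt_a_def using S(1) by (intro borel_measurable_restrict_to) measurable
  moreover have "(cmod (sqrt_a S \<psi> \<xi>))\<^sup>2 \<le> real n * (cmod (rep \<psi> \<xi>))\<^sup>2" for \<xi>
    using S(2) a_nonneg[of \<xi>]
    by (auto simp: sqrt_a_def restrict_to_def norm_mult power_mult_distrib Om_def intro!: mult_right_mono)
  ultimately show L: "sqrt_a S \<psi> \<in> L2"
    by (intro L2_bound[where g="\<lambda>\<xi>. real n * (cmod (rep \<psi> \<xi>))\<^sup>2"])
      (auto intro: L2_integrable)
  show "integrable lebesgue (sqrt_a S \<psi>)"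
    by (rule integrable_L2_of_finite_support[OF L S(1) emeasure_subset_Om[OF S]])
      (simp add: sqrt_a_def restrict_to_def)
qed

lemma vel_L2:
  assumes S: "S \<in> sets lebesgue" "S \<subseteq> Om n"
  shows "vel S \<psi> \<in> L2" "cls (vel S \<psi>) = Fou 1 (cls (sqrt_a S \<psi>))"
  unfolding vel_def using sqrt_a_bounded[OF S] by (auto simp: Fou_cls intro: ft_L2)

lemma nn_integral_vel:
  assumes S: "S \<in> sets lebesgue" "S \<subseteq> Om n"
  shows "(\<integral>\<^sup>+x. ennreal ((cmod (vel S \<psi> x))\<^sup>2) \<partial>lebesgue)
    = (\<integral>\<^sup>+\<xi>. ennreal (a \<xi> * (cmod (rep \<psi> \<xi>))\<^sup>2) * indicator S \<xi> \<partial>lebesgue)"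
proof -
  have "(\<integral>\<^sup>+x. ennreal ((cmod (vel S \<psi> x))\<^sup>2) \<partial>lebesgue) = ennreal ((norm (cls (sqrt_a S \<psi>)))\<^sup>2)"
    unfolding nn_integral_L2[OF vel_L2(1)[OF S]] vel_L2(2)[OF S] by simp
  also have "\<dots> = (\<integral>\<^sup>+\<xi>. ennreal ((cmod (sqrt_a S \<psi> \<xi>))\<^sup>2) \<partial>lebesgue)"
    by (rule nn_integral_L2[OF sqrt_a_bounded(1)[OF S], symmetric])
  also have "\<dots> = (\<integral>\<^sup>+\<xi>. ennreal (a \<xi> * (cmod (rep \<psi> \<xi>))\<^sup>2) * indicator S \<xi> \<partial>lebesgue)"
    by (intro nn_integral_cong)
      (auto simp: sqrt_a_def restrict_to_def norm_mult power_mult_distrib a_nonneg)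
  finally show ?thesis .
qed

lemma vel_split:
  assumes S: "S \<in> sets lebesgue" "S \<subseteq> Om n" and T: "T \<in> sets lebesgue" "T \<subseteq> Om n" and "S \<inter> T = {}"
  shows "vel (S \<union> T) \<psi> x = vel S \<psi> x + vel T \<psi> x"
proof -
  have "sqrt_a (S \<union> T) \<psi> = (\<lambda>\<xi>. sqrt_a S \<psi> \<xi> + sqrt_a T \<psi> \<xi>)"
    using assms(5) by (auto simp: sqrt_a_def restrict_to_def fun_eq_iff)
  then show ?thesis
    unfolding vel_def using sqrt_a_bounded(2)[OF S] sqrt_a_bounded(2)[OF T] by (simp add: ft_add)
qed

text \<open>Says that the sum of the operators |psi_j><psi_j| is at most the identity. Unlike
  orthonormality, this passes to images under complex linear contractions, and families orthonormal
  for the real inner product satisfy it after scaling.\<close>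

definition Bessel :: "'i set \<Rightarrow> ('i \<Rightarrow> 'n l2) \<Rightarrow> bool" where
  "Bessel I \<psi> \<longleftrightarrow> finite I \<and> (\<forall>h. (\<Sum>j\<in>I. (cmod (cinner h (\<psi> j)))\<^sup>2) \<le> (norm h)\<^sup>2)"

text \<open>The value at \<open>x\<close> is, up to the Fourier constant, the scalar product of
  \<open>\<psi> j\<close> with the fixed function \<open>h\<close>, a plane wave times
  \<open>sqrt a\<close> on \<open>S\<close>. The sum is thus bounded by the squared norm of
  \<open>h\<close>, from which the plane wave, and with it \<open>x\<close>, disappears.\<close>

lemma Bessel_pointwise:
  assumes S: "S \<in> sets lebesgue" "S \<subseteq> Om n" and B: "Bessel I \<psi>"
  shows "ennreal (\<Sum>j\<in>I. (cmod (vel S (\<psi> j) x))\<^sup>2)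
    \<le> ennreal ((2 * pi) powr (- real CARD('n))) * (\<integral>\<^sup>+\<xi>. ennreal (a \<xi>) * indicator S \<xi> \<partial>lebesgue)"
proof -
  let ?c = "(2 * pi) powr (- real CARD('n) / 2)"
  define h where "h = restrict_to S (\<lambda>\<xi>. cis (- (x \<bullet> \<xi>)) * complex_of_real (sqrt (a \<xi>)))"
  have [measurable]: "(\<lambda>\<xi>. cis (- (x \<bullet> \<xi>))) \<in> borel_measurable lebesgue"
    by (rule borel_measurable_lebesgueI) measurable
  have hm: "h \<in> borel_measurable lebesgue"
    unfolding h_def using S(1) by (intro borel_measurable_restrict_to) measurable
  have hn: "(cmod (h \<xi>))\<^sup>2 = a \<xi> * indicator S \<xi>" for \<xi>
    using a_nonneg[of \<xi>] by (auto simp: h_def restrict_to_def norm_mult)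
  have "(\<integral>\<^sup>+\<xi>. ennreal ((cmod (h \<xi>))\<^sup>2) \<partial>lebesgue) \<le> (\<integral>\<^sup>+\<xi>. ennreal (real n) * indicator S \<xi> \<partial>lebesgue)"
    unfolding hn using S(2) by (intro nn_integral_mono) (auto simp: Om_def indicator_def intro!: ennreal_leI)
  also have "\<dots> < \<infinity>"
    using S(1) emeasure_subset_Om[OF S] by (simp add: nn_integral_cmult ennreal_mult_less_top)
  finally have hL: "h \<in> L2" by (intro L2_I_nn_integral hm)
  have inner: "vel S (\<psi> j) x = ?c * cinner (cls h) (\<psi> j)" for j
  proof -
    have "cinner (cls h) (\<psi> j) = l2_inner h (rep (\<psi> j))"
      using cinner_cls[OF hL rep_L2, of "\<psi> j"] by simp
    also have "\<dots> = (LINT \<xi>|lebesgue. cis (1 * (x \<bullet> \<xi>)) * sqrt_a S (\<psi> j) \<xi>)"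
      unfolding l2_inner_def
      by (intro Bochner_Integration.integral_cong refl)
        (simp add: h_def sqrt_a_def restrict_to_def cis_cnj)
    finally show ?thesis by (simp add: vel_def ft_def)
  qed
  have "(\<Sum>j\<in>I. (cmod (vel S (\<psi> j) x))\<^sup>2) = ?c\<^sup>2 * (\<Sum>j\<in>I. (cmod (cinner (cls h) (\<psi> j)))\<^sup>2)"
    unfolding inner by (simp add: norm_mult power_mult_distrib sum_distrib_left)
  also have "\<dots> \<le> ?c\<^sup>2 * (norm (cls h))\<^sup>2"
    using B unfolding Bessel_def by (intro mult_left_mono) auto
  also have "?c\<^sup>2 = (2 * pi) powr (- real CARD('n))"
    by (simp add: power2_eq_square flip: powr_add)
  finally have "ennreal (\<Sum>j\<in>I. (cmod (vel S (\<psi> j) x))\<^sup>2)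
      \<le> ennreal ((2 * pi) powr (- real CARD('n))) * ennreal ((norm (cls h))\<^sup>2)"
    by (simp add: ennreal_leI flip: ennreal_mult)
  also have "ennreal ((norm (cls h))\<^sup>2) = (\<integral>\<^sup>+\<xi>. ennreal (a \<xi>) * indicator S \<xi> \<partial>lebesgue)"
    unfolding nn_integral_L2[OF hL, symmetric] hn
    by (intro nn_integral_cong) (auto simp: indicator_def)
  finally show ?thesis .
qed

definition low :: "nat \<Rightarrow> real \<Rightarrow> (real ^ 'n) set" where
  "low n E = {\<xi> \<in> Om n. a \<xi> * E \<le> 1}"

lemma low_lebesgue: "low n E \<in> sets lebesgue"
proof -
  have "{\<xi> \<in> space lebesgue. a \<xi> * E \<le> 1} \<inter> Om n \<in> sets lebesgue"
    using Om_lebesgue by (intro sets.Int) measurable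
  moreover have "{\<xi> \<in> space lebesgue. a \<xi> * E \<le> 1} \<inter> Om n = low n E"
    by (auto simp: low_def)
  ultimately show ?thesis by simp
qed

lemma low_subset: "low n E \<subseteq> Om n" by (auto simp: low_def)

definition C1 :: real where
  "C1 = (2 * pi) powr (- real CARD('n)) * (N * (p / (p - 1)))"

lemma C1_nonneg: "C1 \<ge> 0"
  using N_nonneg p by (simp add: C1_def)

text \<open>On the high set \<open>a\<close> exceeds \<open>1 / E\<close>, so
  \<open>nn_integral_a_above\<close> applies at the level \<open>1 / E\<close> and yields the power
  \<open>p - 1\<close> of \<open>E\<close>, uniformly in \<open>n\<close> and
  \<open>x\<close>.\<close>

lemma high_energy:
  assumes E: "E > 0" and B: "Bessel I \<psi>"
  shows "(\<Sum>j\<in>I. (cmod (vel (Om n - low n E) (\<psi> j) x))\<^sup>2) \<le> C1 * E powr (p - 1)"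
proof -
  have "(\<integral>\<^sup>+\<xi>. ennreal (a \<xi>) * indicator (Om n - low n E) \<xi> \<partial>lebesgue)
      \<le> (\<integral>\<^sup>+\<xi>. ennreal (a \<xi>) * indicator {\<xi>. 1 / E < a \<xi>} \<xi> \<partial>lebesgue)"
    using E by (intro nn_integral_mono) (auto simp: indicator_def low_def field_simps)
  also have "\<dots> \<le> ennreal (N * (p / (p - 1)) * (1 / E) powr (1 - p))"
    using E by (intro nn_integral_a_above) simp
  also have "(1 / E) powr (1 - p) = E powr (p - 1)"
    using E by (simp add: powr_divide powr_diff powr_minus divide_simps)
  finally have I: "(\<integral>\<^sup>+\<xi>. ennreal (a \<xi>) * indicator (Om n - low n E) \<xi> \<partial>lebesgue)
      \<le> ennreal (N * (p / (p - 1)) * E powr (p - 1))" .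
  have "ennreal (\<Sum>j\<in>I. (cmod (vel (Om n - low n E) (\<psi> j) x))\<^sup>2)
      \<le> ennreal ((2 * pi) powr (- real CARD('n))) * (\<integral>\<^sup>+\<xi>. ennreal (a \<xi>) * indicator (Om n - low n E) \<xi> \<partial>lebesgue)"
    by (rule Bessel_pointwise[OF _ _ B]) (auto intro!: sets.Diff Om_lebesgue low_lebesgue)
  also have "\<dots> \<le> ennreal ((2 * pi) powr (- real CARD('n))) * ennreal (N * (p / (p - 1)) * E powr (p - 1))"
    by (rule mult_left_mono[OF I]) simp
  also have "\<dots> = ennreal (C1 * E powr (p - 1))"
    using N_nonneg p by (simp add: C1_def mult.assoc flip: ennreal_mult)
  finally show ?thesis
    using C1_nonneg by (subst (asm) ennreal_le_iff) auto
qed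

text \<open>Permits interchanging integrations over \<open>E\<close> and \<open>x\<close>:
  \<open>vel\<close> is a parameter integral over \<xi> of a jointly measurable function.\<close>

lemma vel_joint_measurable:
  "(\<lambda>q. vel (low n (fst q)) \<psi> (snd q)) \<in> borel_measurable (lborel \<Otimes>\<^sub>M lebesgue)"
proof -
  let ?M = "(lborel :: real measure) \<Otimes>\<^sub>M (lebesgue :: (real ^ 'n) measure)"
  have [measurable]: "(\<lambda>z. snd (fst z)) \<in> borel_measurable (?M \<Otimes>\<^sub>M (lebesgue :: (real ^ 'n) measure))"
    by (rule measurable_compose[OF measurable_fst measurable_fst_snd_lebesgue(2)])
  have [measurable]: "snd \<in> borel_measurable (?M \<Otimes>\<^sub>M (lebesgue :: (real ^ 'n) measure))"
    by (rule measurable_fst_snd_lebesgue(2))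
  have [measurable]: "Measurable.pred lebesgue (\<lambda>\<xi>. \<xi> \<in> Om n)"
    using Om_lebesgue by (simp add: pred_def)
  have 1: "(\<lambda>z. cis (1 * (snd (fst z) \<bullet> snd z))) \<in> borel_measurable (?M \<Otimes>\<^sub>M lebesgue)"
    by measurable
  have 2: "(\<lambda>z. if snd z \<in> Om n \<and> a (snd z) * fst (fst z) \<le> 1
      then complex_of_real (sqrt (a (snd z))) * rep \<psi> (snd z) else 0) \<in> borel_measurable (?M \<Otimes>\<^sub>M lebesgue)"
    by measurable
  have "(\<lambda>q. LINT \<xi>|lebesgue. cis (1 * (snd q \<bullet> \<xi>)) * sqrt_a (low n (fst q)) \<psi> \<xi>) \<in> borel_measurable ?M"
    using borel_measurable_times[OF 1 2]
    by (intro sigma_finite_measure.borel_measurable_lebesgue_integral[OF sigma_finite_lebesgue])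
      (simp add: case_prod_beta sqrt_a_def restrict_to_def low_def)
  then show ?thesis unfolding vel_def ft_def by measurable
qed

text \<open>The tangent, at the density \<open>C1 * T powr (p - 1)\<close>, to the convex lower
  bound for the integrated low density. It is linear in the density, and its slope
  \<open>T * r / (r + 1)\<close> can be matched to any prescribed positive weight.\<close>

lemma Rumin_pointwise:
  assumes B: "Bessel I \<psi>" and T: "T > 0"
  defines "r \<equiv> (p - 1) / 2"
  shows "ennreal ((\<Sum>j\<in>I. (cmod (vel (Om n) (\<psi> j) x))\<^sup>2) * T * r / (r + 1))
    \<le> (\<integral>\<^sup>+E. ennreal (\<Sum>j\<in>I. (cmod (vel (low n E) (\<psi> j) x))\<^sup>2) * indicator {0..} E \<partial>lborel)
      + ennreal (C1 * T powr p * (r / ((r + 1) * p)))"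
proof -
  let ?\<rho> = "\<Sum>j\<in>I. (cmod (vel (Om n) (\<psi> j) x))\<^sup>2"
  let ?\<rho>E = "\<lambda>E. \<Sum>j\<in>I. (cmod (vel (low n E) (\<psi> j) x))\<^sup>2"
  have r: "r > 0" using p by (simp add: r_def)
  have "2 * r = p - 1"
    unfolding r_def times_divide_eq_right by (rule nonzero_mult_div_cancel_left) simp
  then have pr: "p = 2 * r + 1" by linarith
  have \<rho>: "?\<rho> \<ge> 0" by (intro sum_nonneg) auto
  have point: "ennreal ((1 - (E / T) powr r) * ?\<rho>) * indicator {0..T} E
      \<le> ennreal (?\<rho>E E) * indicator {0..} E + ennreal (C1 * (T powr r * E powr r - E powr (2 * r))) * indicator {0..T} E"
    if E: "E \<noteq> 0" for E
  proof (cases "E \<in> {0..T}")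
    case True
    with E have E: "0 < E" "E \<le> T" by auto
    define t where "t = (E / T) powr r"
    have t: "0 < t" "t \<le> 1"
      using E T r powr_mono2[of r "E / T" 1] by (auto simp: t_def)
    have tT: "t * T powr r = E powr r" using E T by (simp add: t_def powr_divide)
    \<comment> \<open>As \<open>2 * r = p - 1\<close>, dividing \<open>E powr (p - 1)\<close> by
      \<open>t\<close> leaves \<open>T powr r * E powr r\<close>; this produces the integrand of
      \<open>nn_integral_powr_diff\<close>.\<close>
    have eq: "(1 - t) / t * (C1 * E powr (p - 1)) = C1 * (T powr r * E powr r - E powr (2 * r))"
    proof -
      have "E powr (p - 1) = t * T powr r * E powr r" "E powr (2 * r) = t * T powr r * E powr r"
        unfolding tT pr by (simp_all flip: powr_add)
      then show ?thesis using t by (simp add: field_simps)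
    qed
    have "0 \<le> (1 - t) / t * (C1 * E powr (p - 1))"
      using t C1_nonneg by simp
    then have nonneg: "0 \<le> C1 * (T powr r * E powr r - E powr (2 * r))" by (simp only: eq)
    have "(1 - t) * ?\<rho> = (\<Sum>j\<in>I. (1 - t) * (cmod (vel (low n E) (\<psi> j) x + vel (Om n - low n E) (\<psi> j) x))\<^sup>2)"
    proof -
      have "vel (Om n) (\<psi> j) x = vel (low n E) (\<psi> j) x + vel (Om n - low n E) (\<psi> j) x" for j
      proof -
        have "vel (low n E \<union> (Om n - low n E)) (\<psi> j) x = vel (low n E) (\<psi> j) x + vel (Om n - low n E) (\<psi> j) x"
          by (rule vel_split[where n=n]) (auto intro: low_lebesgue Om_lebesgue low_subset[THEN subsetD])
        then show ?thesis by (simp add: Un_absorb1 low_subset)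
      qed
      then show ?thesis by (simp add: sum_distrib_left)
    qed
    also have "\<dots> \<le> (\<Sum>j\<in>I. (cmod (vel (low n E) (\<psi> j) x))\<^sup>2 + (1 - t) / t * (cmod (vel (Om n - low n E) (\<psi> j) x))\<^sup>2)"
      by (intro sum_mono power2_norm_add_le t)
    also have "\<dots> = ?\<rho>E E + (1 - t) / t * (\<Sum>j\<in>I. (cmod (vel (Om n - low n E) (\<psi> j) x))\<^sup>2)"
      by (simp add: sum.distrib sum_distrib_left)
    also have "\<dots> \<le> ?\<rho>E E + (1 - t) / t * (C1 * E powr (p - 1))"
      using t by (intro add_left_mono mult_left_mono high_energy E B) auto
    also note eq
    finally have "ennreal ((1 - t) * ?\<rho>) \<le> ennreal (?\<rho>E E + C1 * (T powr r * E powr r - E powr (2 * r)))"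
      by (rule ennreal_leI)
    also have "\<dots> = ennreal (?\<rho>E E) + ennreal (C1 * (T powr r * E powr r - E powr (2 * r)))"
      by (rule ennreal_plus[OF _ nonneg]) (simp add: sum_nonneg)
    finally show ?thesis using True by (simp add: t_def)
  qed simp
  have m: "(\<lambda>E. vel (low n E) (\<psi> j) x) \<in> borel_measurable lborel" for j
    using measurable_compose[OF _ vel_joint_measurable[of n "\<psi> j"], of "\<lambda>E. (E, x)"] by simp
  note [measurable] = m[unfolded measurable_lborel1]
  have "ennreal (?\<rho> * T * r / (r + 1))
      = (\<integral>\<^sup>+E. ennreal ((1 - (E / T) powr r) * ?\<rho>) * indicator {0..T} E \<partial>lborel)"
    by (rule nn_integral_one_minus_powr[OF T r \<rho>, symmetric])
  \<comment> \<open>The point \<open>E = 0\<close>, at which \<open>t\<close> vanishes and the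
    splitting would divide by 0, is a null set.\<close>
  also have "\<dots> \<le> (\<integral>\<^sup>+E. ennreal (?\<rho>E E) * indicator {0..} E
      + ennreal (C1 * (T powr r * E powr r - E powr (2 * r))) * indicator {0..T} E \<partial>lborel)"
    by (rule nn_integral_mono_AE, rule eventually_mono[OF AE_lborel_singleton[of 0]]) (rule point)
  also have "\<dots> = (\<integral>\<^sup>+E. ennreal (?\<rho>E E) * indicator {0..} E \<partial>lborel)
      + (\<integral>\<^sup>+E. ennreal (C1 * (T powr r * E powr r - E powr (2 * r))) * indicator {0..T} E \<partial>lborel)"
    by (rule nn_integral_add) measurable
  also have "(\<integral>\<^sup>+E. ennreal (C1 * (T powr r * E powr r - E powr (2 * r))) * indicator {0..T} E \<partial>lborel)
      = ennreal (C1 * T powr p * (r / ((r + 1) * p)))"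
    using nn_integral_powr_diff[OF T r C1_nonneg] unfolding pr[symmetric] .
  finally show ?thesis .
qed

text \<open>The isometry turns the integral over \<open>x\<close> into one of \<open>a\<close> times
  the squared modulus of \<open>\<psi>\<close> over \<open>low n E\<close>. Integrating over
  \<open>E\<close> first, the length \<open>1 / a\<close> of the set of admissible \<open>E\<close>
  cancels \<open>a\<close>. Only an inequality remains, because of the restriction to
  \<open>Om n\<close> and the points where \<open>a\<close> vanishes.\<close>

lemma nn_integral_low:
  "(\<integral>\<^sup>+x. (\<integral>\<^sup>+E. ennreal ((cmod (vel (low n E) \<psi> x))\<^sup>2) * indicator {0..} E \<partial>lborel) \<partial>lebesgue)
    \<le> ennreal ((norm \<psi>)\<^sup>2)"
proof -
  interpret L: pair_sigma_finite "lborel :: real measure" "lebesgue :: (real ^ 'n) measure"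
    by (intro pair_sigma_finite.intro sigma_finite_lebesgue sigma_finite_lborel)
  note [measurable] = vel_joint_measurable[of n \<psi>]
  have [measurable]: "Measurable.pred lebesgue (\<lambda>\<xi>. \<xi> \<in> Om n)"
    using Om_lebesgue by (simp add: pred_def)
  let ?g = "\<lambda>\<xi>. ennreal (a \<xi> * (cmod (rep \<psi> \<xi>))\<^sup>2)"
  let ?i = "\<lambda>E \<xi>. indicator (low n E) \<xi> * indicator {0..} E :: ennreal"
  have "(\<integral>\<^sup>+x. (\<integral>\<^sup>+E. ennreal ((cmod (vel (low n E) \<psi> x))\<^sup>2) * indicator {0..} E \<partial>lborel) \<partial>lebesgue)
      = (\<integral>\<^sup>+E. (\<integral>\<^sup>+x. ennreal ((cmod (vel (low n E) \<psi> x))\<^sup>2) * indicator {0..} E \<partial>lebesgue) \<partial>lborel)"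
    by (rule L.Fubini') (unfold case_prod_beta, measurable)
  also have "\<dots> = (\<integral>\<^sup>+E. (\<integral>\<^sup>+\<xi>. ?g \<xi> * ?i E \<xi> \<partial>lebesgue) \<partial>lborel)"
  proof (rule nn_integral_cong)
    fix E
    have [measurable]: "vel (low n E) \<psi> \<in> borel_measurable lebesgue"
      by (rule L2_measurable[OF vel_L2(1)[OF low_lebesgue low_subset]])
    have "(\<integral>\<^sup>+x. ennreal ((cmod (vel (low n E) \<psi> x))\<^sup>2) * indicator {0..} E \<partial>lebesgue)
        = (\<integral>\<^sup>+x. ennreal ((cmod (vel (low n E) \<psi> x))\<^sup>2) \<partial>lebesgue) * indicator {0..} E"
      by (rule nn_integral_multc) measurable
    also have "\<dots> = (\<integral>\<^sup>+\<xi>. ?g \<xi> * indicator (low n E) \<xi> \<partial>lebesgue) * indicator {0..} E"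
      by (simp only: nn_integral_vel[OF low_lebesgue low_subset])
    also have "\<dots> = (\<integral>\<^sup>+\<xi>. ?g \<xi> * indicator (low n E) \<xi> * indicator {0..} E \<partial>lebesgue)"
      by (intro nn_integral_multc[symmetric] borel_measurable_times_ennreal
          borel_measurable_indicator low_lebesgue) measurable
    finally show "(\<integral>\<^sup>+x. ennreal ((cmod (vel (low n E) \<psi> x))\<^sup>2) * indicator {0..} E \<partial>lebesgue)
        = (\<integral>\<^sup>+\<xi>. ?g \<xi> * ?i E \<xi> \<partial>lebesgue)" by (simp only: mult.assoc)
  qed
  also have "\<dots> = (\<integral>\<^sup>+\<xi>. (\<integral>\<^sup>+E. ?g \<xi> * ?i E \<xi> \<partial>lborel) \<partial>lebesgue)"
  proof (rule L.Fubini'[symmetric])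
    have "(\<lambda>q. ?g (snd q) * (if snd q \<in> Om n \<and> a (snd q) * fst q \<le> 1 \<and> 0 \<le> fst q then 1 else 0))
        \<in> borel_measurable ((lborel :: real measure) \<Otimes>\<^sub>M lebesgue)"
      by measurable
    moreover have "?i E \<xi> = (if \<xi> \<in> Om n \<and> a \<xi> * E \<le> 1 \<and> 0 \<le> E then 1 else 0)" for E \<xi>
      by (auto simp: low_def indicator_def)
    ultimately show "(\<lambda>(E, \<xi>). ?g \<xi> * ?i E \<xi>) \<in> borel_measurable ((lborel :: real measure) \<Otimes>\<^sub>M lebesgue)"
      by (simp add: case_prod_beta)
  qed
  also have "\<dots> \<le> (\<integral>\<^sup>+\<xi>. ennreal ((cmod (rep \<psi> \<xi>))\<^sup>2) \<partial>lebesgue)"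
  proof (rule nn_integral_mono)
    fix \<xi>
    show "(\<integral>\<^sup>+E. ?g \<xi> * ?i E \<xi> \<partial>lborel) \<le> ennreal ((cmod (rep \<psi> \<xi>))\<^sup>2)"
    proof (cases "a \<xi> = 0")
      case False
      then have a: "a \<xi> > 0" using a_nonneg[of \<xi>] by simp
      have "(\<integral>\<^sup>+E. ?g \<xi> * ?i E \<xi> \<partial>lborel) \<le> (\<integral>\<^sup>+E. ?g \<xi> * indicator {0..1 / a \<xi>} E \<partial>lborel)"
        using a by (intro nn_integral_mono mult_left_mono) (auto simp: low_def indicator_def field_simps)
      also have "\<dots> = ?g \<xi> * ennreal (1 / a \<xi>)"
        using a by (subst nn_integral_cmult) auto
      also have "\<dots> = ennreal ((cmod (rep \<psi> \<xi>))\<^sup>2)"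
        using a by (simp flip: ennreal_mult)
      finally show ?thesis .
    qed simp
  qed
  also have "\<dots> = ennreal ((norm \<psi>)\<^sup>2)"
    using nn_integral_L2[OF rep_L2, of \<psi>] by simp
  finally show ?thesis .
qed

definition C0 :: real where
  "C0 = (p + 1) powr (p - 1) / (p - 1) powr p * (2 * pi) powr (- real CARD('n)) * N
    * (LINT x|lebesgue. b x powr p)"

lemma C0_nonneg: "C0 \<ge> 0"
  using N_nonneg p by (simp add: C0_def)

theorem Rumin_inequality:
  assumes B: "Bessel I \<psi>" and \<mu>: "\<mu> > 0"
  shows "(\<Sum>j\<in>I. \<integral>\<^sup>+x. ennreal (b x * (cmod (vel (Om n) (\<psi> j) x))\<^sup>2) \<partial>lebesgue)
    \<le> ennreal (\<mu> * (\<Sum>j\<in>I. (norm (\<psi> j))\<^sup>2) + C0 * \<mu> powr (1 - p))"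
proof -
  define r where "r = (p - 1) / 2"
  have r: "r > 0" using p by (simp add: r_def)
  have "2 * r = p - 1"
    unfolding r_def times_divide_eq_right by (rule nonzero_mult_div_cancel_left) simp
  then have pr: "p = 2 * r + 1" by linarith
  have fin: "finite I" using B by (simp add: Bessel_def)
  \<comment> \<open>The coefficient of \<open>b x powr p\<close> when the \<open>T\<close> chosen
    below is inserted into the remainder of \<open>Rumin_pointwise\<close> and the result is
    multiplied by \<mu>.\<close>
  define K where "K = \<mu> * C1 * (r / ((r + 1) * p)) * ((r + 1) / (\<mu> * r)) powr p"
  have K: "K \<ge> 0" using \<mu> C1_nonneg r p by (simp add: K_def)
  let ?G = "\<lambda>j x. \<integral>\<^sup>+E. ennreal ((cmod (vel (low n E) (\<psi> j) x))\<^sup>2) * indicator {0..} E \<partial>lborel"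
  have [measurable]: "vel (Om n) (\<psi> j) \<in> borel_measurable lebesgue" for j
    by (rule L2_measurable[OF vel_L2(1)[OF Om_lebesgue order_refl]])
  have mE: "(\<lambda>E. vel (low n E) (\<psi> j) x) \<in> borel_measurable borel" for j x
    using measurable_compose[OF _ vel_joint_measurable[of n "\<psi> j"], of "\<lambda>E. (E, x)"] by simp
  have [measurable]: "?G j \<in> borel_measurable lebesgue" for j
  proof -
    note [measurable] = vel_joint_measurable[of n "\<psi> j"]
    have "(\<lambda>q. ennreal ((cmod (vel (low n (fst q)) (\<psi> j) (snd q)))\<^sup>2) * indicator {0..} (fst q))
        \<in> borel_measurable (lborel \<Otimes>\<^sub>M lebesgue)"
      by measurable
    from measurable_compose[OF measurable_pair_swap' this]
    show ?thesis
      by (intro sigma_finite_measure.borel_measurable_nn_integral[OF sigma_finite_lborel])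
        (simp add: case_prod_beta)
  qed
  have point: "(\<Sum>j\<in>I. ennreal (b x * (cmod (vel (Om n) (\<psi> j) x))\<^sup>2))
      \<le> ennreal \<mu> * (\<Sum>j\<in>I. ?G j x) + ennreal (K * b x powr p)" for x
  proof (cases "b x = 0")
    case False
    then have bx: "b x > 0" using b_nonneg[of x] by simp
    \<comment> \<open>Solves \<open>\<mu> * T * r / (r + 1) = b x\<close>, so that \<mu> times the
      left side of \<open>Rumin_pointwise\<close> is \<open>b x\<close> times the density.\<close>
    define T where "T = b x * (r + 1) / (\<mu> * r)"
    have T: "T > 0" using bx r \<mu> by (simp add: T_def)
    let ?\<rho> = "\<Sum>j\<in>I. (cmod (vel (Om n) (\<psi> j) x))\<^sup>2"
    have \<rho>: "?\<rho> \<ge> 0" by (intro sum_nonneg) auto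
    have "(\<Sum>j\<in>I. ennreal (b x * (cmod (vel (Om n) (\<psi> j) x))\<^sup>2)) = ennreal (b x * ?\<rho>)"
      using bx by (simp add: sum_distrib_left)
    also have "b x * ?\<rho> = \<mu> * (?\<rho> * T * r / (r + 1))"
    proof -
      have gen: "B * \<rho> = \<mu> * (\<rho> * (B * s / (\<mu> * r)) * r / s)" if "s > 0" for s \<rho> B
        using that r \<mu> by simp
      show ?thesis unfolding T_def by (rule gen) (use r in simp)
    qed
    also have "ennreal \<dots> = ennreal \<mu> * ennreal (?\<rho> * T * r / (r + 1))"
      using \<mu> r T \<rho> by (intro ennreal_mult) auto
    also have "\<dots> \<le> ennreal \<mu> * ((\<integral>\<^sup>+E. ennreal (\<Sum>j\<in>I. (cmod (vel (low n E) (\<psi> j) x))\<^sup>2) * indicator {0..} E \<partial>lborel)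
        + ennreal (C1 * T powr p * (r / ((r + 1) * p))))"
      unfolding r_def by (intro mult_left_mono Rumin_pointwise[OF B T]) auto
    also have "(\<integral>\<^sup>+E. ennreal (\<Sum>j\<in>I. (cmod (vel (low n E) (\<psi> j) x))\<^sup>2) * indicator {0..} E \<partial>lborel)
        = (\<integral>\<^sup>+E. (\<Sum>j\<in>I. ennreal ((cmod (vel (low n E) (\<psi> j) x))\<^sup>2) * indicator {0..} E) \<partial>lborel)"
      by (intro nn_integral_cong) (simp add: sum_distrib_right flip: sum_ennreal)
    also have "\<dots> = (\<Sum>j\<in>I. ?G j x)"
    proof (rule nn_integral_sum)
      note [measurable] = mE
      show "(\<lambda>E. ennreal ((cmod (vel (low n E) (\<psi> j) x))\<^sup>2) * indicator {0..} E) \<in> borel_measurable lborel" for j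
        by measurable
    qed
    also have "ennreal \<mu> * ((\<Sum>j\<in>I. ?G j x) + ennreal (C1 * T powr p * (r / ((r + 1) * p))))
        = ennreal \<mu> * (\<Sum>j\<in>I. ?G j x) + ennreal (K * b x powr p)"
    proof -
      have "\<mu> * (C1 * T powr p * (r / ((r + 1) * p))) = K * b x powr p"
      proof -
        have "T powr p = b x powr p * ((r + 1) / (\<mu> * r)) powr p"
          using bx r \<mu> by (simp add: T_def flip: powr_mult)
        then show ?thesis by (simp add: K_def)
      qed
      then show ?thesis
        using \<mu> C1_nonneg r p by (simp add: distrib_left flip: ennreal_mult)
    qed
    finally show ?thesis .
  qed simp
  have "(\<Sum>j\<in>I. \<integral>\<^sup>+x. ennreal (b x * (cmod (vel (Om n) (\<psi> j) x))\<^sup>2) \<partial>lebesgue)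
      = (\<integral>\<^sup>+x. (\<Sum>j\<in>I. ennreal (b x * (cmod (vel (Om n) (\<psi> j) x))\<^sup>2)) \<partial>lebesgue)"
    by (rule nn_integral_sum[symmetric]) measurable
  also have "\<dots> \<le> (\<integral>\<^sup>+x. ennreal \<mu> * (\<Sum>j\<in>I. ?G j x) + ennreal (K * b x powr p) \<partial>lebesgue)"
    by (intro nn_integral_mono point)
  also have "\<dots> = ennreal \<mu> * (\<Sum>j\<in>I. \<integral>\<^sup>+x. ?G j x \<partial>lebesgue) + (\<integral>\<^sup>+x. ennreal (K * b x powr p) \<partial>lebesgue)"
    by (simp add: nn_integral_add nn_integral_cmult nn_integral_sum)
  also have "(\<integral>\<^sup>+x. ennreal (K * b x powr p) \<partial>lebesgue) = ennreal (K * (LINT x|lebesgue. b x powr p))"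
    using K b_integrable by (subst nn_integral_eq_integral) auto
  also have "ennreal \<mu> * (\<Sum>j\<in>I. \<integral>\<^sup>+x. ?G j x \<partial>lebesgue) \<le> ennreal \<mu> * (\<Sum>j\<in>I. ennreal ((norm (\<psi> j))\<^sup>2))"
    by (intro mult_left_mono sum_mono nn_integral_low) auto
  also have "\<dots> = ennreal (\<mu> * (\<Sum>j\<in>I. (norm (\<psi> j))\<^sup>2))"
    using \<mu> by (simp add: sum_nonneg flip: ennreal_mult)
  also have "\<dots> + ennreal (K * (LINT x|lebesgue. b x powr p))
      = ennreal (\<mu> * (\<Sum>j\<in>I. (norm (\<psi> j))\<^sup>2) + K * (LINT x|lebesgue. b x powr p))"
    using K \<mu> by (intro ennreal_plus[symmetric]) (auto intro!: mult_nonneg_nonneg sum_nonneg)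
  \<comment> \<open>The factor \<open>p / (p - 1)\<close> in \<open>C1\<close> cancels against
    \<open>r / ((r + 1) * p) = (p - 1) / ((p + 1) * p)\<close>; the power of \<open>T\<close> then
    leaves \<open>((p + 1) / (p - 1)) powr p / (p + 1)\<close>.\<close>
  also have "K * (LINT x|lebesgue. b x powr p) = C0 * \<mu> powr (1 - p)"
  proof -
    have q: "r / (r + 1) = (p - 1) / (p + 1)" "(r + 1) / (\<mu> * r) = ((p + 1) / (p - 1)) / \<mu>"
      using p \<mu> by (auto simp: r_def field_simps)
    have "K = \<mu> * C1 * ((r / (r + 1)) / p) * ((r + 1) / (\<mu> * r)) powr p"
      by (simp add: K_def)
    also have "((r + 1) / (\<mu> * r)) powr p = (p + 1) powr p / (p - 1) powr p / \<mu> powr p"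
      unfolding q using p \<mu> by (simp add: powr_divide powr_mult)
    also have "\<mu> * C1 * ((r / (r + 1)) / p) * \<dots>
        = (2 * pi) powr (- real CARD('n)) * N * (\<mu> / \<mu> powr p) * ((p + 1) powr p / (p + 1)) / (p - 1) powr p"
    proof -
      have gen: "\<mu> * (A * (N * (p / m))) * ((m / s) / p) * (X / Y / Z) = A * N * (\<mu> / Z) * (X / s) / Y"
        if "m \<noteq> 0" for m s A X Y Z :: real
        using that p by (simp add: mult_ac)
      show ?thesis unfolding q C1_def by (rule gen) (use p in simp)
    qed
    also have "\<mu> / \<mu> powr p = \<mu> powr (1 - p)" using \<mu> by (simp add: powr_diff)
    also have "(p + 1) powr p / (p + 1) = (p + 1) powr (p - 1)" using p by (simp add: powr_diff)
    finally show ?thesis by (simp add: C0_def)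
  qed
  finally show ?thesis by (simp add: add_right_mono)
qed

end

section \<open>Graphs of bounded operators\<close>

text \<open>Contains every representative of the image class, so that it can equal the operators of
  the theorem, which are relations between functions.\<close>

definition graph :: "('n::finite l2 \<Rightarrow> 'n l2) \<Rightarrow> 'n operator" where
  "graph T = {(u, w). u \<in> L2 \<and> w \<in> L2 \<and> T (cls u) = cls w}"

lemma inner_J_left: "inner (J x) y = - inner x (J y)"
  using inner_J[of x "J y"] by (simp add: J_J)

lemma cinner_eqI: "(\<And>y. cinner y x = cinner y z) \<Longrightarrow> x = z"
  using inner_diff_right[of "x - z" x z] by (simp add: cinner_def)

lemma J_diff: "J (x - y) = J x - J y"
  and J_scaleR: "J (r *\<^sub>R x) = r *\<^sub>R J x"
  and J_add: "J (x + y) = J x + J y"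
  using bounded_linear_J bounded_linear.linear
  by (metis linear_diff, metis linear_scale, metis linear_add)

text \<open>\<open>S\<close> is the adjoint for the real inner product only. Since \<open>T\<close>
  commutes with \<open>J\<close>, the same identity with \<open>J x\<close> in place of
  \<open>x\<close> supplies the imaginary part.\<close>

lemma op_adjoint_graph:
  fixes T S :: "'n::finite l2 \<Rightarrow> 'n l2"
  assumes TJ: "\<And>x. T (J x) = J (T x)" and S: "\<And>x y. inner (T x) y = inner x (S y)"
  shows "op_adjoint (graph T) = graph S"
proof -
  have *: "(\<forall>x. cinner v (T x) = cinner w x) \<longleftrightarrow> S v = w" for v w
  proof
    assume L: "\<forall>x. cinner v (T x) = cinner w x"
    have "inner x (S v - w) = 0" for x
      using L[rule_format, of x] S[of x v] by (simp add: cinner_def inner_diff_right inner_commute)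
    then show "S v = w" by (metis inner_eq_zero_iff right_minus_eq)
  next
    assume w: "S v = w"
    show "\<forall>x. cinner v (T x) = cinner w x"
    proof
      fix x
      have "inner v (T x) = inner w x" using S[of x v] w by (simp add: inner_commute)
      moreover have "inner (J v) (T x) = inner (J w) x"
        using S[of "J x" v] w by (metis TJ inner_J_left inner_commute)
      ultimately show "cinner v (T x) = cinner w x" by (simp add: cinner_def)
    qed
  qed
  have "(v, w) \<in> op_adjoint (graph T) \<longleftrightarrow> (v, w) \<in> graph S" for v w
  proof (cases "v \<in> L2 \<and> w \<in> L2")
    case True
    have "(\<forall>(u, y)\<in>graph T. l2_inner v y = l2_inner w u) \<longleftrightarrow> (\<forall>x. cinner (cls v) (T x) = cinner (cls w) x)"
    proof
      assume L: "\<forall>(u, y)\<in>graph T. l2_inner v y = l2_inner w u"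
      show "\<forall>x. cinner (cls v) (T x) = cinner (cls w) x"
      proof
        fix x
        have "(rep x, rep (T x)) \<in> graph T" by (simp add: graph_def)
        with L have "l2_inner v (rep (T x)) = l2_inner w (rep x)" by blast
        then show "cinner (cls v) (T x) = cinner (cls w) x"
          using True cinner_cls[of v "rep (T x)"] cinner_cls[of w "rep x"] by simp
      qed
    next
      assume R: "\<forall>x. cinner (cls v) (T x) = cinner (cls w) x"
      have "l2_inner v y = l2_inner w u" if "(u, y) \<in> graph T" for u y
        using R[rule_format, of "cls u"] that True by (simp add: graph_def cinner_cls)
      then show "\<forall>(u, y)\<in>graph T. l2_inner v y = l2_inner w u" by blast
    qed
    then show ?thesis using True by (simp add: op_adjoint_def graph_def *)
  qed (auto simp: op_adjoint_def graph_def)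
  then show ?thesis by auto
qed

lemma graph_relcomp: "graph T O graph S = graph (\<lambda>x. S (T x))"
proof -
  have "(u, w) \<in> graph T O graph S" if "(u, w) \<in> graph (\<lambda>x. S (T x))" for u w
  proof
    show "(u, rep (T (cls u))) \<in> graph T" "(rep (T (cls u)), w) \<in> graph S"
      using that by (auto simp: graph_def)
  qed
  moreover have "graph T O graph S \<subseteq> graph (\<lambda>x. S (T x))" by (auto simp: graph_def)
  ultimately show ?thesis by auto
qed

lemma op_minus_scalar_graph: "op_minus_scalar (graph T) c = graph (\<lambda>x. T x - c *\<^sub>R x)"
proof -
  have 1: "cls (\<lambda>x. w x - complex_of_real c * u x) = cls w - c *\<^sub>R cls u" if "u \<in> L2" "w \<in> L2" for u w :: "'a wave"
    using that by (simp add: cls_diff cls_scaleR L2_cmult scaleR_conv_of_real)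
  have "(u, z) \<in> op_minus_scalar (graph T) c" if "(u, z) \<in> graph (\<lambda>x. T x - c *\<^sub>R x)" for u z
  proof -
    have uz: "u \<in> L2" "z \<in> L2" "T (cls u) - c *\<^sub>R cls u = cls z" using that by (auto simp: graph_def)
    define w where "w x = z x + complex_of_real c * u x" for x
    have "cls w = cls z + c *\<^sub>R cls u"
      unfolding w_def using uz by (simp add: cls_add cls_scaleR L2_scaleR L2_cmult scaleR_conv_of_real)
    then have "(u, w) \<in> graph T"
    proof -
      have "w \<in> L2" unfolding w_def by (intro L2_add L2_cmult uz)
      moreover have "T (cls u) = cls w" using uz(3) \<open>cls w = _\<close> by (simp add: diff_eq_eq)
      ultimately show ?thesis using uz by (simp add: graph_def)
    qed
    moreover have "z = (\<lambda>x. w x - complex_of_real c * u x)" by (simp add: w_def)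
    ultimately show ?thesis unfolding op_minus_scalar_def by blast
  qed
  moreover have "op_minus_scalar (graph T) c \<subseteq> graph (\<lambda>x. T x - c *\<^sub>R x)"
    by (auto simp: op_minus_scalar_def graph_def 1 intro!: L2_diff L2_cmult)
  ultimately show ?thesis by auto
qed

lemma inner_Fou:
  assumes s: "\<bar>s\<bar> = 1"
  shows "inner (Fou s x) (Fou s y) = inner x (y :: 'n::finite l2)"
proof -
  have "Fou s (x + y) = Fou s x + Fou s y"
    by (rule linear_add[OF bounded_linear.linear[OF bounded_linear_Fou[OF s]]])
  then show ?thesis
    unfolding dot_norm[of "Fou s x"] dot_norm[of x] by (simp add: s flip: \<open>Fou s (x + y) = _\<close>)
qed

lemma cinner_Fou: "\<bar>s\<bar> = 1 \<Longrightarrow> cinner (Fou s x) (Fou s y) = cinner x (y :: 'n::finite l2)"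
  by (simp add: cinner_def inner_Fou flip: Fou_J)

lemma Bessel_real:
  fixes e :: "'i \<Rightarrow> 'a::real_inner"
  assumes "finite I" "\<And>i j. i \<in> I \<Longrightarrow> j \<in> I \<Longrightarrow> inner (e i) (e j) = (if i = j then 1 else 0)"
  shows "(\<Sum>i\<in>I. (inner h (e i))\<^sup>2) \<le> (norm h)\<^sup>2"
proof -
  define q where "q = (\<Sum>i\<in>I. inner h (e i) *\<^sub>R e i)"
  have hq: "inner h q = (\<Sum>i\<in>I. (inner h (e i))\<^sup>2)"
    by (simp add: q_def inner_sum_right power2_eq_square)
  have "inner q q = (\<Sum>i\<in>I. \<Sum>j\<in>I. if i = j then (inner h (e i))\<^sup>2 else 0)"
    unfolding q_def inner_sum_left inner_sum_right
    by (intro sum.cong refl) (auto simp: assms(2) power2_eq_square)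
  also have "\<dots> = (\<Sum>i\<in>I. (inner h (e i))\<^sup>2)"
    using assms(1) by simp
  finally have qq: "inner q q = (\<Sum>i\<in>I. (inner h (e i))\<^sup>2)" .
  have "0 \<le> inner (h - q) (h - q)" by simp
  also have "\<dots> = (norm h)\<^sup>2 - (\<Sum>i\<in>I. (inner h (e i))\<^sup>2)"
    by (simp add: inner_diff_left inner_diff_right hq qq inner_commute[of q h] power2_norm_eq_inner)
  finally show ?thesis by simp
qed

section \<open>The bounded operator \<open>K\<close> as closure of the natural one\<close>

context cwikel
begin

lemma vel_add:
  assumes S: "S \<in> sets lebesgue" "S \<subseteq> Om n"
  shows "vel S (x + y) = (\<lambda>t. vel S x t + vel S y t)"
proof -
  have "AE t in lebesgue. rep (x + y) t = rep x t + rep y t"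
    using AE_rep_cls[OF L2_add[OF rep_L2 rep_L2], of x y] cls_add[OF rep_L2 rep_L2, of x y] by simp
  then have "AE t in lebesgue. sqrt_a S (x + y) t = sqrt_a S x t + sqrt_a S y t"
    by eventually_elim (simp add: sqrt_a_def restrict_to_def distrib_left)
  from ft_cong_AE[OF _ _ this] show ?thesis
    unfolding vel_def using sqrt_a_bounded(2)[OF S] by (simp add: ft_add)
qed

lemma vel_cscale:
  assumes S: "S \<in> sets lebesgue" "S \<subseteq> Om n" and y: "y = cls (\<lambda>t. c * rep x t)"
  shows "vel S y = (\<lambda>t. c * vel S x t)"
proof -
  have "AE t in lebesgue. rep y t = c * rep x t"
    using AE_rep_cls[OF L2_cmult[OF rep_L2], of c x] y by simp
  then have "AE t in lebesgue. sqrt_a S y t = c * sqrt_a S x t"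
    by eventually_elim (simp add: sqrt_a_def restrict_to_def)
  from ft_cong_AE[OF _ _ this] show ?thesis
    unfolding vel_def using sqrt_a_bounded(2)[OF S] by (simp add: ft_cmult)
qed

lemma vel_scaleR:
  assumes "S \<in> sets lebesgue" "S \<subseteq> Om n"
  shows "vel S (r *\<^sub>R x) = (\<lambda>t. of_real r * vel S x t)"
  using vel_cscale[OF assms] cls_scaleR[OF rep_L2, of r x] by (simp add: scaleR_conv_of_real)

lemma vel_J:
  assumes "S \<in> sets lebesgue" "S \<subseteq> Om n"
  shows "vel S (J x) = (\<lambda>t. \<i> * vel S x t)"
  using vel_cscale[OF assms] by (simp add: J_def)

text \<open>A function rather than an element of \<open>l2\<close>: as \<open>b\<close> may be
  unbounded, its square integrability comes from the inequality itself, in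
  \<open>kfun_L2_norm_le\<close>.\<close>

definition kfun :: "nat \<Rightarrow> 'n l2 \<Rightarrow> 'n wave" where
  "kfun n x t = complex_of_real (sqrt (b t)) * vel (Om n) (Fou (- 1) x) t"

abbreviation Kn :: "nat \<Rightarrow> 'n l2 \<Rightarrow> 'n l2" where
  "Kn n x \<equiv> cls (kfun n x)"

lemma unit_sign: "\<bar>- 1 :: real\<bar> = 1" "\<bar>1 :: real\<bar> = 1" by simp_all

lemma Fou_inverse': "Fou (- 1) (Fou 1 x) = (x :: 'n l2)" "Fou 1 (Fou (- 1) x) = x"
  using Fou_inverse[OF unit_sign(2), of x] Fou_inverse[OF unit_sign(1), of x] by auto

lemma kfun_add: "kfun n (x + y) = (\<lambda>t. kfun n x t + kfun n y t)"
  unfolding kfun_def linear_add[OF bounded_linear.linear[OF bounded_linear_Fou[OF unit_sign(1)]]]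
    vel_add[OF Om_lebesgue order_refl] by (simp add: distrib_left)

lemma kfun_scaleR: "kfun n (r *\<^sub>R x) = (\<lambda>t. of_real r * kfun n x t)"
  unfolding kfun_def linear_scale[OF bounded_linear.linear[OF bounded_linear_Fou[OF unit_sign(1)]]]
    vel_scaleR[OF Om_lebesgue order_refl] by (simp add: mult_ac)

lemma kfun_J: "kfun n (J x) = (\<lambda>t. \<i> * kfun n x t)"
  unfolding kfun_def Fou_J[OF unit_sign(1)] vel_J[OF Om_lebesgue order_refl] by (simp add: mult_ac)

lemma kfun_measurable [measurable]: "kfun n x \<in> borel_measurable lebesgue"
  unfolding kfun_def
  using L2_measurable[OF vel_L2(1)[OF Om_lebesgue order_refl, of n "Fou (- 1) x"]] by measurable

lemma Bessel_Fou:
  assumes "Bessel I x"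
  shows "Bessel I (\<lambda>j. Fou (- 1) (x j))"
  unfolding Bessel_def
proof (intro conjI allI)
  show "finite I" using assms by (simp add: Bessel_def)
  fix h
  have "cinner h (Fou (- 1) (x j)) = cinner (Fou 1 h) (x j)" for j
    using cinner_Fou[OF unit_sign(1), of "Fou 1 h" "x j"] by (simp add: Fou_inverse')
  then have "(\<Sum>j\<in>I. (cmod (cinner h (Fou (- 1) (x j))))\<^sup>2) \<le> (norm (Fou 1 h))\<^sup>2"
    using assms by (simp only: Bessel_def)
  then show "(\<Sum>j\<in>I. (cmod (cinner h (Fou (- 1) (x j))))\<^sup>2) \<le> (norm h)\<^sup>2"
    by simp
qed

lemma nn_integral_kfun_le:
  assumes B: "Bessel I x" and \<mu>: "\<mu> > 0"
  shows "(\<Sum>j\<in>I. \<integral>\<^sup>+t. ennreal ((cmod (kfun n (x j) t))\<^sup>2) \<partial>lebesgue)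
    \<le> ennreal (\<mu> * (\<Sum>j\<in>I. (norm (x j))\<^sup>2) + C0 * \<mu> powr (1 - p))"
proof -
  have "(cmod (kfun n (x j) t))\<^sup>2 = b t * (cmod (vel (Om n) (Fou (- 1) (x j)) t))\<^sup>2" for j t
    by (simp add: kfun_def norm_mult power_mult_distrib b_nonneg)
  then show ?thesis
    using Rumin_inequality[OF Bessel_Fou[OF B] \<mu>, of n] by simp
qed

text \<open>The real Cauchy-Schwarz inequality for \<open>x\<close> multiplied by the complex number
  \<open>cinner x y\<close>; its real inner product with \<open>y\<close> is the squared
  modulus.\<close>

lemma cmod_cinner_le: "cmod (cinner x y) \<le> norm x * norm (y :: 'n l2)"
proof (cases "cinner x y = 0")
  case False
  have "(cmod (cinner x y))\<^sup>2 = inner (Re (cinner x y) *\<^sub>R x + Im (cinner x y) *\<^sub>R J x) y"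
    unfolding cmod_power2 by (simp add: cinner_def inner_add_left power2_eq_square)
  also have "\<dots> \<le> norm (Re (cinner x y) *\<^sub>R x + Im (cinner x y) *\<^sub>R J x) * norm y"
    by (rule norm_cauchy_schwarz)
  also have "norm (Re (cinner x y) *\<^sub>R x + Im (cinner x y) *\<^sub>R J x) = cmod (cinner x y) * norm x"
  proof (rule power2_eq_imp_eq)
    have "inner x (J x) = 0" using inner_J_left[of x x] by (simp add: inner_commute)
    then show "(norm (Re (cinner x y) *\<^sub>R x + Im (cinner x y) *\<^sub>R J x))\<^sup>2 = (cmod (cinner x y) * norm x)\<^sup>2"
      unfolding power_mult_distrib cmod_power2 power2_norm_eq_inner
      by (simp add: inner_add_left inner_add_right inner_J inner_commute[of "J x" x]
          power2_eq_square algebra_simps)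
  qed auto
  finally show ?thesis using False by (simp add: power2_eq_square)
qed simp

lemma Bessel_singleton: "norm x \<le> 1 \<Longrightarrow> Bessel {j} (\<lambda>_. x)"
  unfolding Bessel_def
proof (intro conjI allI)
  fix h assume x: "norm x \<le> 1"
  have "cmod (cinner h x) \<le> norm h"
    using cmod_cinner_le[of h x] mult_left_mono[OF x norm_ge_zero[of h]] by simp
  then show "(\<Sum>j\<in>{j}. (cmod (cinner h x))\<^sup>2) \<le> (norm h)\<^sup>2" by (simp add: power_mono)
qed simp

text \<open>The inequality for a single vector with \<open>\<mu> = 1\<close> bounds the squared norm
  by \<open>1 + C0\<close> on the unit ball, for all \<open>n\<close> at once; homogeneity does the
  rest.\<close>

lemma kfun_L2_norm_le: "kfun n x \<in> L2" "norm (Kn n x) \<le> sqrt (1 + C0) * norm x"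
proof -
  have unit: "kfun n y \<in> L2 \<and> norm (Kn n y) \<le> sqrt (1 + C0)" if y: "norm y \<le> 1" for y
  proof -
    have "(\<integral>\<^sup>+t. ennreal ((cmod (kfun n y t))\<^sup>2) \<partial>lebesgue) \<le> ennreal ((norm y)\<^sup>2 + C0)"
      using nn_integral_kfun_le[OF Bessel_singleton[OF y, of 0], of 1 n] by simp
    also have "\<dots> \<le> ennreal ((sqrt (1 + C0))\<^sup>2)"
      using power_mono[OF y, of 2] C0_nonneg by (intro ennreal_leI) auto
    finally have le: "(\<integral>\<^sup>+t. ennreal ((cmod (kfun n y t))\<^sup>2) \<partial>lebesgue) \<le> ennreal ((sqrt (1 + C0))\<^sup>2)" .
    have L: "kfun n y \<in> L2"
      by (intro L2_I_nn_integral le_less_trans[OF le]) auto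
    with le show ?thesis using C0_nonneg by (auto intro: norm_cls_le)
  qed
  have x: "x = norm x *\<^sub>R sgn x" by (cases "x = 0") (auto simp: sgn_div_norm)
  have s: "norm (sgn x) \<le> 1" by (simp add: norm_sgn)
  have k: "kfun n x = (\<lambda>t. of_real (norm x) * kfun n (sgn x) t)"
    by (subst x) (rule kfun_scaleR)
  show "kfun n x \<in> L2" unfolding k using unit[OF s] by (intro L2_cmult) auto
  have "Kn n x = norm x *\<^sub>R Kn n (sgn x)"
    unfolding k using unit[OF s] by (simp add: cls_scaleR scaleR_conv_of_real)
  then show "norm (Kn n x) \<le> sqrt (1 + C0) * norm x"
    using unit[OF s] by (simp add: mult.commute mult_left_mono)
qed

lemma Kn_add: "Kn n (x + y) = Kn n x + Kn n y"
  unfolding kfun_add by (simp add: cls_add kfun_L2_norm_le)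

lemma Kn_scaleR: "Kn n (r *\<^sub>R x) = r *\<^sub>R Kn n x"
  unfolding kfun_scaleR by (simp add: cls_scaleR kfun_L2_norm_le scaleR_conv_of_real)

lemma Kn_J: "Kn n (J x) = J (Kn n x)"
  unfolding kfun_J by (simp add: J_cls kfun_L2_norm_le)

lemma Kn_diff: "Kn n (x - y) = Kn n x - Kn n y"
  using Kn_add[of n x "- y"] Kn_scaleR[of n "- 1" y] by simp

text \<open>The momentum-space projection onto \<open>Om m\<close>. Its values approximate
  \<open>x\<close> and lie in the natural domain of \<open>cwikel_K a b\<close>.\<close>

definition cutoff :: "nat \<Rightarrow> 'n l2 \<Rightarrow> 'n l2" where
  "cutoff m x = Fou 1 (cls (restrict_to (Om m) (rep (Fou (- 1) x))))"

lemma cutoff_tendsto: "(\<lambda>m. cutoff m x) \<longlonglongrightarrow> x"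
proof -
  have "(\<lambda>m. Fou 1 (cls (restrict_to (Om m) (rep (Fou (- 1) x))))) \<longlonglongrightarrow> Fou 1 (cls (rep (Fou (- 1) x)))"
    by (intro bounded_linear.tendsto[OF bounded_linear_Fou[OF unit_sign(2)]]
        restrict_to_tendsto rep_L2 Om_lebesgue Om_eventually)
  then show ?thesis unfolding cutoff_def by (simp add: Fou_inverse')
qed

lemma Om_mono: "m \<le> n \<Longrightarrow> Om m \<subseteq> Om n"
  by (auto simp: Om_def)

lemma Kn_cutoff:
  assumes "m \<le> n"
  shows "Kn n (cutoff m x) = Kn m x"
proof -
  let ?\<psi> = "Fou (- 1) x"
  have "AE t in lebesgue. rep (cls (restrict_to (Om m) (rep ?\<psi>))) t = restrict_to (Om m) (rep ?\<psi>) t"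
    by (rule AE_rep_cls[OF restrict_to_L2[OF rep_L2 Om_lebesgue]])
  then have "AE t in lebesgue. sqrt_a (Om n) (cls (restrict_to (Om m) (rep ?\<psi>))) t = sqrt_a (Om m) ?\<psi> t"
    by eventually_elim (use Om_mono[OF assms] in \<open>auto simp: sqrt_a_def restrict_to_def\<close>)
  from ft_cong_AE[OF sqrt_a_bounded(2)[OF Om_lebesgue order_refl] sqrt_a_bounded(2)[OF Om_lebesgue order_refl] this]
  have "vel (Om n) (cls (restrict_to (Om m) (rep ?\<psi>))) = vel (Om m) ?\<psi>"
    unfolding vel_def .
  then show ?thesis unfolding kfun_def cutoff_def by (simp add: Fou_inverse')
qed

definition K :: "'n l2 \<Rightarrow> 'n l2" where
  "K x = lim (\<lambda>n. Kn n x)"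

text \<open>On \<open>cutoff m x\<close> the sequence is constant from index \<open>m\<close> on by
  \<open>Kn_cutoff\<close>. These vectors approximate \<open>x\<close> and the operators are
  uniformly bounded, hence the sequence is Cauchy at every \<open>x\<close>.\<close>

lemma Kn_tendsto: "(\<lambda>n. Kn n x) \<longlonglongrightarrow> K x"
proof -
  have "Cauchy (\<lambda>n. Kn n x)"
  proof (rule CauchyI)
    fix e :: real assume e: "e > 0"
    let ?D = "sqrt (1 + C0)"
    have D: "?D > 0" using C0_nonneg by simp
    then have "e / (2 * ?D) > 0" using e by simp
    then obtain m where m: "norm (cutoff m x - x) < e / (2 * ?D)"
      using LIMSEQ_D[OF cutoff_tendsto[of x]] by blast
    have close: "norm (Kn n x - Kn m x) < e / 2" if "n \<ge> m" for n
    proof -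
      have "Kn n x - Kn m x = Kn n (x - cutoff m x)"
        using Kn_diff[of n x "cutoff m x"] Kn_cutoff[OF that, of x] by simp
      also have "norm \<dots> \<le> ?D * norm (x - cutoff m x)" by (rule kfun_L2_norm_le)
      also have "\<dots> < e / 2" using m D by (simp add: norm_minus_commute field_simps)
      finally show ?thesis .
    qed
    show "\<exists>M. \<forall>i\<ge>M. \<forall>j\<ge>M. norm (Kn i x - Kn j x) < e"
    proof (intro exI allI impI)
      fix i j assume "m \<le> i" "m \<le> j"
      have "norm (Kn i x - Kn j x) \<le> norm (Kn i x - Kn m x) + norm (Kn j x - Kn m x)"
        using norm_triangle_ineq4[of "Kn i x - Kn m x" "Kn j x - Kn m x"] by simp
      then show "norm (Kn i x - Kn j x) < e"
        using close[OF \<open>m \<le> i\<close>] close[OF \<open>m \<le> j\<close>] by linarith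
    qed
  qed
  then show ?thesis
    unfolding K_def by (simp add: Cauchy_convergent convergent_LIMSEQ_iff[symmetric])
qed

lemma bounded_linear_K: "bounded_linear K"
proof (rule bounded_linear_intro)
  fix x y :: "'n l2" and r :: real
  show "K (x + y) = K x + K y"
    using LIMSEQ_unique[OF Kn_tendsto, of "x + y"] tendsto_add[OF Kn_tendsto Kn_tendsto]
    unfolding Kn_add by blast
  show "K (r *\<^sub>R x) = r *\<^sub>R K x"
    using LIMSEQ_unique[OF Kn_tendsto, of "r *\<^sub>R x"] tendsto_scaleR[OF tendsto_const Kn_tendsto]
    unfolding Kn_scaleR by blast
  show "norm (K x) \<le> norm x * sqrt (1 + C0)"
    using kfun_L2_norm_le(2)[of _ x]
    by (intro LIMSEQ_le_const2[OF tendsto_norm[OF Kn_tendsto]]) (auto simp: mult.commute)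
qed

lemma K_J: "K (J x) = J (K x)"
  using LIMSEQ_unique[OF Kn_tendsto, of "J x"] bounded_linear.tendsto[OF bounded_linear_J Kn_tendsto]
  unfolding Kn_J by blast

lemma K_Bessel_le:
  assumes B: "Bessel I x" and \<mu>: "\<mu> > 0"
  shows "(\<Sum>j\<in>I. (norm (K (x j)))\<^sup>2) \<le> \<mu> * (\<Sum>j\<in>I. (norm (x j))\<^sup>2) + C0 * \<mu> powr (1 - p)"
proof (rule LIMSEQ_le_const2)
  show "(\<lambda>n. \<Sum>j\<in>I. (norm (Kn n (x j)))\<^sup>2) \<longlonglongrightarrow> (\<Sum>j\<in>I. (norm (K (x j)))\<^sup>2)"
    by (intro tendsto_sum tendsto_power tendsto_norm Kn_tendsto)
  have "ennreal (\<Sum>j\<in>I. (norm (Kn n (x j)))\<^sup>2)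
      \<le> ennreal (\<mu> * (\<Sum>j\<in>I. (norm (x j))\<^sup>2) + C0 * \<mu> powr (1 - p))" for n
    using nn_integral_kfun_le[OF B \<mu>, of n]
    by (simp add: nn_integral_L2[OF kfun_L2_norm_le(1)])
  moreover have "0 \<le> \<mu> * (\<Sum>j\<in>I. (norm (x j))\<^sup>2) + C0 * \<mu> powr (1 - p)"
    using \<mu> C0_nonneg by (auto intro!: add_nonneg_nonneg mult_nonneg_nonneg sum_nonneg)
  ultimately show "\<exists>N. \<forall>n\<ge>N. (\<Sum>j\<in>I. (norm (Kn n (x j)))\<^sup>2)
      \<le> \<mu> * (\<Sum>j\<in>I. (norm (x j))\<^sup>2) + C0 * \<mu> powr (1 - p)"
    by (simp add: ennreal_le_iff)
qed

text \<open>The truncations \<open>?v n\<close> approximate \<open>v\<close> in the mean, hence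
  almost everywhere along a subsequence. Multiplication by the possibly unbounded
  \<open>sqrt b\<close> preserves the pointwise limit, and \<open>l2_pointwise_limit\<close>
  identifies the result with \<open>K (cls u)\<close>.\<close>

lemma cwikel_K_subset: "cwikel_K a b \<subseteq> graph K"
proof safe
  fix u w assume "(u, w) \<in> cwikel_K a b"
  then obtain v u' v' where 1: "(u, u') \<in> fourier_op" "(u', v') \<in> position_op (\<lambda>\<xi>. sqrt (a \<xi>))"
    "(v, v') \<in> fourier_op" "(v, w) \<in> position_op (\<lambda>x. sqrt (b x))"
    unfolding cwikel_K_def momentum_op_def by auto
  then have L: "u \<in> L2" "u' \<in> L2" "v \<in> L2" "v' \<in> L2" "w \<in> L2"
    and u': "Fou (- 1) (cls u) = cls u'" and v': "Fou (- 1) (cls v) = cls v'"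
    and ae1: "AE \<xi> in lebesgue. v' \<xi> = sqrt (a \<xi>) * u' \<xi>"
    and ae2: "AE x in lebesgue. w x = sqrt (b x) * v x"
    by (auto simp: fourier_op_iff position_op_def)
  let ?v = "\<lambda>n. vel (Om n) (Fou (- 1) (cls u))"
  have vL: "?v n \<in> L2" for n by (rule vel_L2(1)[OF Om_lebesgue order_refl])
  have "cls (sqrt_a (Om n) (cls u')) = cls (restrict_to (Om n) v')" for n
  proof (rule cls_eqI)
    show "AE \<xi> in lebesgue. sqrt_a (Om n) (cls u') \<xi> = restrict_to (Om n) v' \<xi>"
      using ae1 AE_rep_cls[OF L(2)] by eventually_elim (simp add: sqrt_a_def restrict_to_def)
  qed (auto intro!: sqrt_a_bounded[OF Om_lebesgue order_refl] restrict_to_L2 L Om_lebesgue)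
  then have "cls (?v n) = Fou 1 (cls (restrict_to (Om n) v'))" for n
    unfolding u' by (simp add: vel_L2(2)[OF Om_lebesgue order_refl])
  moreover have "(\<lambda>n. Fou 1 (cls (restrict_to (Om n) v'))) \<longlonglongrightarrow> Fou 1 (cls v')"
    by (intro bounded_linear.tendsto[OF bounded_linear_Fou[OF unit_sign(2)]] restrict_to_tendsto L
        Om_lebesgue Om_eventually)
  ultimately have "(\<lambda>n. cls (?v n)) \<longlonglongrightarrow> cls v"
    using Fou_inverse'(2)[of "cls v"] by (simp add: v')
  then have "(\<lambda>n. (norm (cls (?v n) - cls v))\<^sup>2) \<longlonglongrightarrow> 0\<^sup>2"
    by (intro tendsto_power tendsto_norm_zero LIM_zero)
  then have "(\<lambda>n. LINT x|lebesgue. norm ((cmod (?v n x - v x))\<^sup>2)) \<longlonglongrightarrow> 0"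
    by (simp add: cls_diff vL L norm_cls_power2 L2_diff)
  then obtain r where r: "strict_mono r" "AE x in lebesgue. (\<lambda>n. (cmod (?v (r n) x - v x))\<^sup>2) \<longlonglongrightarrow> 0"
    using tendsto_L1_AE_subseq[of lebesgue "\<lambda>n x. (cmod (?v n x - v x))\<^sup>2"]
      L2_integrable[OF L2_diff[OF vL L(3)]] by auto
  have lim: "AE x in lebesgue. (\<lambda>n. kfun (r n) (cls u) x) \<longlonglongrightarrow> sqrt (b x) * v x"
    using r(2)
  proof eventually_elim
    case (elim x)
    have "(\<lambda>n. cmod (?v (r n) x - v x)) \<longlonglongrightarrow> 0"
      using tendsto_real_sqrt[OF elim] by simp
    then have "(\<lambda>n. ?v (r n) x) \<longlonglongrightarrow> v x" by (simp add: tendsto_norm_zero_iff LIM_zero_iff)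
    then show ?case unfolding kfun_def by (intro tendsto_intros)
  qed
  have kl: "(\<lambda>n. Kn (r n) (cls u)) \<longlonglongrightarrow> K (cls u)"
    using LIMSEQ_subseq_LIMSEQ[OF Kn_tendsto r(1)] by (simp add: o_def)
  have [measurable]: "v \<in> borel_measurable lebesgue" using L by (auto intro: L2_measurable)
  have m: "(\<lambda>x. complex_of_real (sqrt (b x)) * v x) \<in> borel_measurable lebesgue" by measurable
  have sv: "(\<lambda>x. complex_of_real (sqrt (b x)) * v x) \<in> L2"
    "cls (\<lambda>x. complex_of_real (sqrt (b x)) * v x) = K (cls u)"
    using l2_pointwise_limit[OF kfun_L2_norm_le(1) kl m lim] by auto
  then have "cls w = K (cls u)" using ae2 L(5) by (subst cls_eqI[of w]) auto
  then show "(u, w) \<in> graph K" using L by (simp add: graph_def)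
qed

lemma cwikel_K_cutoff: "(rep (cutoff m x), kfun m x) \<in> cwikel_K a b"
proof -
  let ?\<psi> = "Fou (- 1) x"
  let ?u = "restrict_to (Om m) (rep ?\<psi>)" and ?v = "vel (Om m) ?\<psi>"
  have uL: "?u \<in> L2" by (rule restrict_to_L2[OF rep_L2 Om_lebesgue])
  have sL: "sqrt_a (Om m) ?\<psi> \<in> L2" by (rule sqrt_a_bounded(1)[OF Om_lebesgue order_refl])
  have vL: "?v \<in> L2" by (rule vel_L2(1)[OF Om_lebesgue order_refl])
  have 1: "(rep (cutoff m x), ?u) \<in> fourier_op"
    by (simp add: fourier_op_iff uL cutoff_def Fou_inverse')
  have 2: "(?u, sqrt_a (Om m) ?\<psi>) \<in> position_op (\<lambda>\<xi>. sqrt (a \<xi>))"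
    using uL sL by (auto simp: position_op_def sqrt_a_def restrict_to_def)
  have 3: "(?v, sqrt_a (Om m) ?\<psi>) \<in> fourier_op"
    by (simp add: fourier_op_iff vL sL vel_L2(2)[OF Om_lebesgue order_refl] Fou_inverse')
  have 4: "(?v, kfun m x) \<in> position_op (\<lambda>x. sqrt (b x))"
    using vL kfun_L2_norm_le(1) by (auto simp: position_op_def kfun_def)
  from 1 2 3 4 show ?thesis unfolding cwikel_K_def momentum_op_def by blast
qed

text \<open>Boundedness of \<open>K\<close> gives one inclusion. For the other, the pairs of
  \<open>cutoff m x\<close> and \<open>kfun m x\<close> lie in the operator by
  \<open>cwikel_K_cutoff\<close> and converge to \<open>x\<close> and \<open>K x\<close>.\<close>

lemma op_closure_cwikel_K: "op_closure (cwikel_K a b) = graph K"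
proof safe
  fix u w assume "(u, w) \<in> op_closure (cwikel_K a b)"
  then obtain f g where fg: "\<And>n. (f n, g n) \<in> cwikel_K a b" "L2_tendsto f u" "L2_tendsto g w"
    unfolding op_closure_def by auto
  then have L: "u \<in> L2" "w \<in> L2" and lim: "(\<lambda>n. cls (f n)) \<longlonglongrightarrow> cls u" "(\<lambda>n. cls (g n)) \<longlonglongrightarrow> cls w"
    by (auto simp: L2_tendsto_iff)
  have "K (cls (f n)) = cls (g n)" for n
    using cwikel_K_subset fg(1)[of n] by (auto simp: graph_def)
  then have "(\<lambda>n. cls (g n)) \<longlonglongrightarrow> K (cls u)"
    using bounded_linear.tendsto[OF bounded_linear_K lim(1)] by simp
  then show "(u, w) \<in> graph K" using lim(2) LIMSEQ_unique L by (auto simp: graph_def)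
next
  fix u w assume "(u, w) \<in> graph K"
  then have L: "u \<in> L2" "w \<in> L2" "K (cls u) = cls w" by (auto simp: graph_def)
  have "L2_tendsto (\<lambda>m. rep (cutoff m (cls u))) u"
    using L cutoff_tendsto by (simp add: L2_tendsto_iff)
  moreover have "L2_tendsto (\<lambda>m. kfun m (cls u)) w"
    using L Kn_tendsto[of "cls u"] kfun_L2_norm_le(1) by (simp add: L2_tendsto_iff)
  ultimately show "(u, w) \<in> op_closure (cwikel_K a b)"
    unfolding op_closure_def mem_Collect_eq case_prod_conv
    by (intro exI[of _ "\<lambda>m. rep (cutoff m (cls u))"] exI[of _ "\<lambda>m. kfun m (cls u)"]
        conjI allI cwikel_K_cutoff)
qed

text \<open>\<open>G\<close> is \<open>K\<close> followed by its real adjoint. Its discreteness is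
  the trace inequality again, read as a bound on the number of orthonormal vectors on which the form
  is at least \<open>\<nu>\<close>.\<close>

lemma form_operator_cwikel:
  obtains G where "form_operator (cwikel_K a b) = graph G" "discrete_op G"
    "\<And>x. G (J x) = J (G x)" "\<And>x. inner x (G x) = (norm (K x))\<^sup>2"
proof -
  obtain S where S: "bounded_linear S" "\<And>x y. inner (K x) y = inner x (S y)"
    using adjoint_exists[OF bounded_linear_K] by blast
  define G where "G x = S (K x)" for x
  have form: "form_operator (cwikel_K a b) = graph G"
    unfolding form_operator_def op_closure_cwikel_K op_adjoint_graph[of K S, OF K_J S(2)] G_def
    by (rule graph_relcomp)
  have quad: "inner x (G x) = (norm (K x))\<^sup>2" for x
    using S(2)[of x "K x"] by (simp add: G_def power2_norm_eq_inner)
  have SJ: "S (J y) = J (S y)" for y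
  proof -
    have "inner x (S (J y) - J (S y)) = 0" for x
      using S(2)[of x "J y"] S(2)[of "J x" y] inner_J_left[of "K x" y] inner_J_left[of x "S y"]
      by (simp add: inner_diff_right K_J)
    then show ?thesis by (metis inner_eq_zero_iff right_minus_eq)
  qed
  have "discrete_op G"
  proof (rule discrete_op.intro)
    show "bounded_linear G"
      unfolding G_def by (rule bounded_linear_compose[OF S(1) bounded_linear_K])
    show "inner (G x) y = inner x (G y)" for x y
      unfolding G_def using S(2)[of y "K x"] S(2)[of x "K y"] by (simp add: inner_commute)
    show "0 \<le> inner x (G x)" for x by (simp add: quad)
    fix \<nu> :: real assume \<nu>: "\<nu> > 0"
    \<comment> \<open>With \<open>\<nu> / 2\<close> in place of \<mu>, the scaled family has total
      form at least \<open>card X * \<nu> / 2\<close> and total squared norm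
      \<open>card X / 2\<close>; the inequality leaves
      \<open>card X * \<nu> / 4 \<le> C\<close>.\<close>
    define C where "C = C0 * (\<nu> / 2) powr (1 - p)"
    show "\<exists>m. \<forall>X. finite X \<longrightarrow> pairwise orthogonal X \<longrightarrow>
        (\<forall>x\<in>X. norm x = 1 \<and> \<nu> \<le> inner x (G x)) \<longrightarrow> card X \<le> m"
    proof (intro exI allI impI)
      fix X :: "'n l2 set"
      assume X: "finite X" "pairwise orthogonal X" "\<forall>x\<in>X. norm x = 1 \<and> \<nu> \<le> inner x (G x)"
      have on: "inner x y = (if x = y then 1 else 0)" if "x \<in> X" "y \<in> X" for x y
        using X(2,3) that by (auto simp: pairwise_def orthogonal_def norm_eq_1)
      \<comment> \<open>A family that is orthonormal for the real inner product has complex Bessel constant 2.\<close>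
      have B: "Bessel X (\<lambda>x. (1 / sqrt 2) *\<^sub>R x)"
        unfolding Bessel_def
      proof (intro conjI allI X)
        fix h :: "'n l2"
        have "(cmod (cinner h ((1 / sqrt 2) *\<^sub>R x)))\<^sup>2 = ((inner h x)\<^sup>2 + (inner (J h) x)\<^sup>2) / 2" for x
          by (simp add: cinner_def cmod_power2 power_divide add_divide_distrib)
        then have "(\<Sum>x\<in>X. (cmod (cinner h ((1 / sqrt 2) *\<^sub>R x)))\<^sup>2)
            = ((\<Sum>x\<in>X. (inner h x)\<^sup>2) + (\<Sum>x\<in>X. (inner (J h) x)\<^sup>2)) / 2"
          by (simp only: sum_divide_distrib[symmetric] sum.distrib)
        also have "\<dots> \<le> (norm h)\<^sup>2"
          using Bessel_real[of X "\<lambda>x. x" h, OF X(1) on] Bessel_real[of X "\<lambda>x. x" "J h", OF X(1) on] by simp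
        finally show "(\<Sum>x\<in>X. (cmod (cinner h ((1 / sqrt 2) *\<^sub>R x)))\<^sup>2) \<le> (norm h)\<^sup>2" .
      qed
      have Kx: "(norm (K ((1 / sqrt 2) *\<^sub>R x)))\<^sup>2 = (norm (K x))\<^sup>2 / 2" for x
        by (simp add: linear_scale[OF bounded_linear.linear[OF bounded_linear_K]] power_divide)
      have "(\<Sum>x\<in>X. \<nu> / 2) \<le> (\<Sum>x\<in>X. (norm (K ((1 / sqrt 2) *\<^sub>R x)))\<^sup>2)"
        unfolding Kx using X(3) by (intro sum_mono) (simp add: quad)
      also have "\<dots> \<le> \<nu> / 2 * (\<Sum>x\<in>X. (norm ((1 / sqrt 2) *\<^sub>R x))\<^sup>2) + C"
        unfolding C_def using K_Bessel_le[OF B, of "\<nu> / 2"] \<nu> by simp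
      also have "(\<Sum>x\<in>X. (norm ((1 / sqrt 2) *\<^sub>R x))\<^sup>2) = (\<Sum>x\<in>X. 1 / 2)"
        using X(3) by (intro sum.cong refl) (simp add: power_divide)
      finally have "real (card X) * \<nu> \<le> 4 * C" by (simp add: algebra_simps)
      then have "real (card X) \<le> 4 * C / \<nu>" using \<nu> by (simp add: field_simps)
      then show "card X \<le> nat \<lceil>4 * C / \<nu>\<rceil>" by linarith
    qed
  qed
  moreover have "G (J x) = J (G x)" for x by (simp add: G_def K_J SJ)
  ultimately show ?thesis using that form quad by blast
qed

end

section \<open>Functional calculus\<close>

lemma cinner_add_right: "cinner x (y + z) = cinner x y + cinner x z"
  by (simp add: cinner_def inner_add_right complex_eq_iff)

lemma cinner_J_right: "cinner x (J y) = \<i> * cinner x y"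
  using inner_J_left[of x y] by (simp add: cinner_def inner_J complex_eq_iff)

lemma cinner_minus_right: "cinner x (- y) = - cinner x y"
  by (simp add: cinner_def complex_eq_iff)

lemma polarization_cls:
  fixes q :: "'n::finite l2 \<Rightarrow> real"
  assumes u: "u \<in> L2" "v \<in> L2"
  shows "(\<Sum>k<4. \<i> ^ k * complex_of_real (q (cls (\<lambda>x. u x + \<i> ^ k * v x))))
    = Complex (q (cls u + cls v) - q (cls u - cls v)) (q (cls u + J (cls v)) - q (cls u - J (cls v)))"
proof -
  have "{..<4} = {0, 1, 2, 3 :: nat}" by auto
  moreover have "cls (\<lambda>x. u x + \<i> * v x) = cls u + J (cls v)"
    using u by (simp add: cls_add J_cls L2_cmult)
  moreover have "cls (\<lambda>x. u x - \<i> * v x) = cls u - J (cls v)"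
    using u by (simp add: cls_diff J_cls L2_cmult)
  moreover have "\<i> ^ 3 = - \<i>" by (simp add: eval_nat_numeral)
  ultimately have "(\<Sum>k<4. \<i> ^ k * complex_of_real (q (cls (\<lambda>x. u x + \<i> ^ k * v x))))
      = q (cls u + cls v) + (\<i> * q (cls u + J (cls v)) + (- q (cls u - cls v) + - \<i> * q (cls u - J (cls v))))"
    using u by (simp add: cls_add cls_diff)
  then show ?thesis by (simp add: complex_eq_iff)
qed

lemma polarization_quadratic:
  fixes A :: "'n::finite l2 \<Rightarrow> 'n l2"
  assumes A: "bounded_linear A" "\<And>x y. inner (A x) y = inner x (A y)"
  shows "Complex (inner (x + y) (A (x + y)) - inner (x - y) (A (x - y)))
      (inner (x + J y) (A (x + J y)) - inner (x - J y) (A (x - J y))) = 4 * cinner y (A x)"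
proof -
  note lin = linear_add[OF bounded_linear.linear[OF A(1)]] linear_diff[OF bounded_linear.linear[OF A(1)]]
  have "inner (x + z) (A (x + z)) - inner (x - z) (A (x - z)) = 4 * inner z (A x)" for z
    using A(2)[of x z] by (simp add: lin inner_add_left inner_add_right inner_diff_left inner_diff_right inner_commute)
  then show ?thesis by (simp add: cinner_def complex_eq_iff)
qed

text \<open>Representatives of the projections \<open>P B\<close> serve as the measure; they commute
  with \<open>J\<close>, so symmetry holds for the complex inner product. Second moments are finite,
  hence the domain of the integral is everything, and polarization turns
  \<open>integral_\<nu>\<close> into the identity that defines
  \<open>spectral_integral\<close>.\<close>

lemma projection_valued_measure_exists:
  fixes A :: "'n::finite l2 \<Rightarrow> 'n l2"
  assumes A: "diagonal_op A" and AJ: "\<And>x. A (J x) = J (A x)"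
  shows "\<exists>E. projection_valued_measure E \<and> graph A = spectral_integral E (\<lambda>t. t)"
proof -
  interpret diagonal_op A by fact
  define E :: "real set \<Rightarrow> 'n wave \<Rightarrow> 'n wave" where "E B u = rep (P B (cls u))" for B u
  have PJ: "P B (J x) = J (P B x)" for B x
    by (rule P_commute[OF bounded_linear_J AJ])
  have sym: "cinner (P B x) y = cinner x (P B y)" for B x y
    by (simp add: cinner_def P_symmetric flip: PJ)
  have EL: "E B u \<in> L2" for B u by (simp add: E_def)
  have aeI: "ae_eq (E B u) v" if "v \<in> L2" "P B (cls u) = cls v" for B u v
    using that EL[of B u] by (simp add: E_def cls_eq_iff[symmetric])
  have PVM: "projection_valued_measure E"
    unfolding projection_valued_measure_def orth_projection_def
  proof (intro conjI ballI allI impI)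
    fix B u v assume "u \<in> (L2 :: 'n wave set)" "v \<in> (L2 :: 'n wave set)"
    then show "l2_inner (E B u) v = l2_inner u (E B v)"
      using sym[of B "cls u" "cls v"] cinner_cls[OF rep_L2, of v "P B (cls u)"] cinner_cls[OF _ rep_L2, of u "P B (cls v)"]
      by (simp add: E_def)
  next
    fix B u show "E B u \<in> L2" by (rule EL)
    show "ae_eq (E B (E B u)) (E B u)"
      by (rule aeI) (auto simp: E_def P_Int[symmetric])
  next
    fix u :: "'n wave" assume u: "u \<in> L2"
    show "ae_eq (E {} u) (\<lambda>x. 0)" by (rule aeI) (auto simp: P_empty L2_0 zero_l2_def)
    show "ae_eq (E UNIV u) u" by (rule aeI) (auto simp: P_UNIV u)
    fix B C show "ae_eq (E (B \<inter> C) u) (E B (E C u))"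
      by (rule aeI) (auto simp: E_def P_Int)
  next
    fix B :: "nat \<Rightarrow> real set" and u :: "'n wave"
    assume B: "range B \<subseteq> sets borel \<and> disjoint_family B" and u: "u \<in> L2"
    have "cls (\<lambda>x. \<Sum>n<N. E (B n) u x) = (\<Sum>n<N. P (B n) (cls u))" for N
      by (subst cls_sum[symmetric]) (auto simp: E_def)
    then show "L2_tendsto (\<lambda>N x. \<Sum>n<N. E (B n) u x) (E (\<Union>n. B n) u)"
      using P_Union_tendsto[of B "cls u"] B by (simp add: L2_tendsto_iff L2_sum EL) (simp add: E_def)
  qed
  have meas: "scalar_measure E u = \<nu> (cls u)" if "u \<in> L2" for u
    using that inner_cls[OF that rep_L2]
    by (simp add: scalar_measure_def \<nu>_def E_def)
  have dom: "spectral_domain E (\<lambda>t. t) = L2"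
    using integrable_\<nu>_power[of _ 2] by (auto simp: spectral_domain_def meas)
  have "(\<forall>v\<in>L2. 4 * l2_inner v w =
      (\<Sum>k<4. \<i> ^ k * complex_of_real (LINT t|scalar_measure E (\<lambda>x. u x + \<i> ^ k * v x). t)))
      \<longleftrightarrow> A (cls u) = cls w" if L: "u \<in> L2" "w \<in> L2" for u w
  proof -
    have eq: "(\<Sum>k<4. \<i> ^ k * complex_of_real (LINT t|scalar_measure E (\<lambda>x. u x + \<i> ^ k * v x). t))
        = 4 * cinner (cls v) (A (cls u))" if v: "v \<in> L2" for v
    proof -
      have "(LINT t|scalar_measure E (\<lambda>x. u x + \<i> ^ k * v x). t)
          = (\<lambda>z. inner z (A z)) (cls (\<lambda>x. u x + \<i> ^ k * v x))" for k
        using L v by (simp add: meas L2_add L2_cmult integral_\<nu>)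
      then show ?thesis
        by (simp only: polarization_cls[OF L(1) v, of "\<lambda>z. inner z (A z)"]
            polarization_quadratic[OF bounded_linear_A symmetric])
    qed
    show ?thesis
    proof
      assume *: "\<forall>v\<in>L2. 4 * l2_inner v w =
        (\<Sum>k<4. \<i> ^ k * complex_of_real (LINT t|scalar_measure E (\<lambda>x. u x + \<i> ^ k * v x). t))"
      show "A (cls u) = cls w"
      proof (rule cinner_eqI)
        fix y :: "'n l2"
        have "4 * l2_inner (rep y) w = 4 * cinner y (A (cls u))"
          using *[rule_format, OF rep_L2, of y] eq[OF rep_L2, of y] by simp
        then show "cinner y (A (cls u)) = cinner y (cls w)"
          using cinner_cls[OF rep_L2 L(2), of y] by simp
      qed
    next
      assume "A (cls u) = cls w"
      then show "\<forall>v\<in>L2. 4 * l2_inner v w =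
        (\<Sum>k<4. \<i> ^ k * complex_of_real (LINT t|scalar_measure E (\<lambda>x. u x + \<i> ^ k * v x). t))"
        using eq L(2) by (simp add: cinner_cls)
    qed
  qed
  then have "graph A = spectral_integral E (\<lambda>t. t)"
    unfolding spectral_integral_def graph_def dom by auto
  with PVM show ?thesis by blast
qed

text \<open>Functional calculus is determined by an arbitrary choice of the projection valued measure,
  so its properties have to be derived from the axioms of such a measure alone.\<close>

context
  fixes E :: "real set \<Rightarrow> 'n::finite wave \<Rightarrow> 'n wave" and A :: "'n l2 \<Rightarrow> 'n l2"
  assumes E: "projection_valued_measure E" and A: "graph A = spectral_integral E (\<lambda>t. t)"
begin

text \<open>The map on classes induced by the measure; \<open>cls_E\<close> shows that it does not
  depend on the representative.\<close>

definition Q :: "real set \<Rightarrow> 'n l2 \<Rightarrow> 'n l2" where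
  "Q B x = cls (E B (rep x))"

context
  fixes B :: "real set"
  assumes B: "B \<in> sets borel"
begin

lemma E_L2: "u \<in> L2 \<Longrightarrow> E B u \<in> L2"
  using E B unfolding projection_valued_measure_def orth_projection_def by blast

lemma Q_symmetric: "cinner (Q B x) y = cinner x (Q B y)"
proof -
  have "l2_inner (E B (rep x)) (rep y) = l2_inner (rep x) (E B (rep y))"
    using E B unfolding projection_valued_measure_def orth_projection_def by blast
  then show ?thesis
    using cinner_cls[OF E_L2[OF rep_L2] rep_L2, of x y] cinner_cls[OF rep_L2 E_L2[OF rep_L2], of x y]
    by (simp add: Q_def)
qed

text \<open>The axioms do not say that \<open>E B\<close> respects null sets, but symmetry implies
  it: the inner products of \<open>E B u\<close> with all other functions depend on the class of
  \<open>u\<close> only. Additivity and compatibility with \<open>J\<close> follow by the same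
  duality.\<close>

lemma cls_E: "u \<in> L2 \<Longrightarrow> cls (E B u) = Q B (cls u)"
proof (rule cinner_eqI)
  fix y assume u: "u \<in> L2"
  have "l2_inner (E B (rep y)) u = l2_inner (rep y) (E B u)"
    using E B u rep_L2 unfolding projection_valued_measure_def orth_projection_def by blast
  then have "cinner (Q B y) (cls u) = cinner y (cls (E B u))"
    using cinner_cls[OF E_L2[OF rep_L2] u, of y] cinner_cls[OF rep_L2 E_L2[OF u], of y]
    by (simp add: Q_def)
  then show "cinner y (cls (E B u)) = cinner y (Q B (cls u))" by (simp add: Q_symmetric)
qed

lemma Q_add: "Q B (x + y) = Q B x + Q B y"
  by (rule cinner_eqI) (simp add: cinner_add_right flip: Q_symmetric)

lemma Q_minus: "Q B (- x) = - Q B x"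
  by (rule cinner_eqI) (simp add: cinner_minus_right flip: Q_symmetric)

lemma Q_diff: "Q B (x - y) = Q B x - Q B y"
  using Q_add[of x "- y"] by (simp add: Q_minus)

lemma Q_J: "Q B (J x) = J (Q B x)"
  by (rule cinner_eqI) (simp add: cinner_J_right flip: Q_symmetric)

end

lemma Q_Int:
  assumes B: "B \<in> sets borel" and C: "C \<in> sets borel"
  shows "Q (C \<inter> B) x = Q C (Q B x)"
proof -
  have CB: "C \<inter> B \<in> sets borel" using B C by auto
  have "ae_eq (E (C \<inter> B) (rep x)) (E C (E B (rep x)))"
    and L: "E (C \<inter> B) (rep x) \<in> L2" "E C (E B (rep x)) \<in> L2"
    using E B C rep_L2[of x] E_L2[OF CB rep_L2] E_L2[OF C E_L2[OF B rep_L2]]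
    unfolding projection_valued_measure_def by auto
  then show ?thesis
    using cls_eq_iff[OF L] cls_E[OF C E_L2[OF B rep_L2], of x]
    by (simp add: Q_def[of "C \<inter> B"] Q_def[of B])
qed

lemma inner_Q_symmetric: "B \<in> sets borel \<Longrightarrow> inner (Q B x) y = inner x (Q B y)"
  using Q_symmetric[of B x y] by (simp add: cinner_def)

lemma Q_idem: "B \<in> sets borel \<Longrightarrow> Q B (Q B x) = Q B x"
  using Q_Int[of B B x] by simp

lemma inner_Q: "B \<in> sets borel \<Longrightarrow> inner x (Q B x) = (norm (Q B x))\<^sup>2"
  using inner_Q_symmetric[of B x "Q B x"] by (simp add: Q_idem power2_norm_eq_inner)

lemma norm_Q_le: "B \<in> sets borel \<Longrightarrow> norm (Q B x) \<le> norm x"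
  using inner_Q[of B x] norm_cauchy_schwarz[of x "Q B x"]
  by (cases "norm (Q B x) = 0") (auto simp: power2_eq_square)

lemma Q_empty: "Q {} x = 0"
proof -
  have "ae_eq (E {} (rep x)) (\<lambda>x. 0)"
    using E rep_L2 unfolding projection_valued_measure_def by blast
  then show ?thesis
    using cls_eq_iff[OF E_L2 L2_0, of "{}" "rep x"] by (simp add: Q_def zero_l2_def)
qed

lemma Q_Union_tendsto:
  assumes "range B \<subseteq> sets borel" "disjoint_family B"
  shows "(\<lambda>N. \<Sum>n<N. Q (B n) x) \<longlonglongrightarrow> Q (\<Union>n. B n) x"
proof -
  have B: "B n \<in> sets borel" for n using assms(1) by auto
  have "L2_tendsto (\<lambda>N t. \<Sum>n<N. E (B n) (rep x) t) (E (\<Union>n. B n) (rep x))"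
    using E assms rep_L2 unfolding projection_valued_measure_def by blast
  moreover have "cls (\<lambda>t. \<Sum>n<N. E (B n) (rep x) t) = (\<Sum>n<N. Q (B n) x)" for N
    unfolding Q_def by (rule cls_sum[symmetric]) (intro E_L2 B rep_L2)
  ultimately show ?thesis by (simp add: L2_tendsto_iff) (simp add: Q_def)
qed

lemma sets_scalar_measure [simp, measurable_cong]: "sets (scalar_measure E u) = sets borel"
  and space_scalar_measure [simp]: "space (scalar_measure E u) = UNIV"
  unfolding scalar_measure_def
  by (simp_all add: sets.sigma_sets_eq[of borel, simplified] space_measure_of_conv)

lemma emeasure_scalar_measure:
  assumes u: "u \<in> L2" and "B \<in> sets borel"
  shows "emeasure (scalar_measure E u) B = ennreal (inner (cls u) (Q B (cls u)))"
proof -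
  have eq: "Re (l2_inner u (E C u)) = inner (cls u) (Q C (cls u))" if "C \<in> sets borel" for C
    using inner_cls[OF u E_L2[OF that u]] by (simp add: cls_E[OF that u])
  have "emeasure (scalar_measure E u) B = ennreal (Re (l2_inner u (E B u)))"
  proof (rule emeasure_measure_of[OF scalar_measure_def])
    show "positive (sets (scalar_measure E u)) (\<lambda>B. ennreal (Re (l2_inner u (E B u))))"
      by (auto simp: positive_def eq Q_empty)
    show "countably_additive (sets (scalar_measure E u)) (\<lambda>B. ennreal (Re (l2_inner u (E B u))))"
      unfolding countably_additive_def
    proof (intro allI impI)
      fix C :: "nat \<Rightarrow> real set"
      assume C: "range C \<subseteq> sets (scalar_measure E u)" "disjoint_family C"
      then have Cn: "C n \<in> sets borel" for n by auto
      then have CU: "(\<Union>n. C n) \<in> sets borel" by auto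
      have "(\<lambda>N. inner (cls u) (\<Sum>n<N. Q (C n) (cls u))) \<longlonglongrightarrow> inner (cls u) (Q (\<Union>n. C n) (cls u))"
        using C by (intro tendsto_intros Q_Union_tendsto) auto
      then have "(\<lambda>n. inner (cls u) (Q (C n) (cls u))) sums inner (cls u) (Q (\<Union>n. C n) (cls u))"
        by (simp add: sums_def inner_sum_right)
      then have "(\<Sum>n. ennreal (inner (cls u) (Q (C n) (cls u)))) = ennreal (inner (cls u) (Q (\<Union>n. C n) (cls u)))"
        by (intro suminf_ennreal_eq) (auto simp: inner_Q Cn)
      then show "(\<Sum>n. ennreal (Re (l2_inner u (E (C n) u)))) = ennreal (Re (l2_inner u (E (\<Union> (range C)) u)))"
        by (simp add: eq Cn CU)
    qed
  qed (use assms in auto)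
  then show ?thesis by (simp add: eq assms)
qed

lemma scalar_measure_cls: "u \<in> L2 \<Longrightarrow> scalar_measure E u = scalar_measure E (rep (cls u))"
  by (rule measure_eqI) (auto simp: emeasure_scalar_measure)

text \<open>Every \<open>u\<close> belongs to the domain of \<open>graph A\<close>, so the domain
  condition in \<open>spectral_integral\<close> holds for it. In this way the everywhere defined
  \<open>A\<close> constrains a measure known only by its axioms.\<close>

lemma spectral_domain_id: "u \<in> L2 \<Longrightarrow> integrable (scalar_measure E u) (\<lambda>t. t\<^sup>2)"
proof -
  assume u: "u \<in> L2"
  then have "(u, rep (A (cls u))) \<in> graph A" by (simp add: graph_def)
  then show ?thesis unfolding A by (auto simp: spectral_integral_def spectral_domain_def)
qed

lemma spectral_domains: "spectral_domain E (\<lambda>t. t) = L2" "spectral_domain E (\<lambda>t. max t 0) = L2"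
proof -
  have "integrable (scalar_measure E u) (\<lambda>t. (max t 0)\<^sup>2)" if "u \<in> L2" for u
  proof (rule Bochner_Integration.integrable_bound[OF spectral_domain_id[OF that]])
    show "AE t in scalar_measure E u. norm ((max t 0)\<^sup>2) \<le> norm (t\<^sup>2)"
      by (intro AE_I2) (auto simp: max_def)
  qed measurable
  then show "spectral_domain E (\<lambda>t. t) = L2" "spectral_domain E (\<lambda>t. max t 0) = L2"
    using spectral_domain_id by (auto simp: spectral_domain_def)
qed

definition q :: "(real \<Rightarrow> real) \<Rightarrow> 'n l2 \<Rightarrow> real" where
  "q f x = (LINT t|scalar_measure E (rep x). f t)"

lemma spectral_integral_iff:
  assumes "spectral_domain E f = L2"
  shows "(u, w) \<in> spectral_integral E f \<longleftrightarrow> u \<in> L2 \<and> w \<in> L2 \<and>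
    (\<forall>y. 4 * cinner y (cls w) = Complex (q f (cls u + y) - q f (cls u - y)) (q f (cls u + J y) - q f (cls u - J y)))"
proof (cases "u \<in> L2 \<and> w \<in> L2")
  case True
  have eq: "(\<Sum>k<4. \<i> ^ k * complex_of_real (LINT t|scalar_measure E (\<lambda>x. u x + \<i> ^ k * v x). f t))
      = Complex (q f (cls u + cls v) - q f (cls u - cls v)) (q f (cls u + J (cls v)) - q f (cls u - J (cls v)))"
    if v: "v \<in> L2" for v
  proof -
    have "(LINT t|scalar_measure E (\<lambda>x. u x + \<i> ^ k * v x). f t) = q f (cls (\<lambda>x. u x + \<i> ^ k * v x))" for k
      using True v unfolding q_def by (subst scalar_measure_cls) (auto intro: L2_add L2_cmult)
    then show ?thesis using True v by (simp only: polarization_cls)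
  qed
  have "(\<forall>v\<in>L2. 4 * l2_inner v w = Complex (q f (cls u + cls v) - q f (cls u - cls v))
        (q f (cls u + J (cls v)) - q f (cls u - J (cls v)))) \<longleftrightarrow>
      (\<forall>y. 4 * cinner y (cls w) = Complex (q f (cls u + y) - q f (cls u - y)) (q f (cls u + J y) - q f (cls u - J y)))"
    (is "?L = ?R")
  proof
    assume L: ?L
    show ?R
    proof
      fix y
      show "4 * cinner y (cls w) = Complex (q f (cls u + y) - q f (cls u - y)) (q f (cls u + J y) - q f (cls u - J y))"
        using L[rule_format, OF rep_L2, of y] cinner_cls[OF rep_L2, of w y] True by simp
    qed
  next
    assume ?R
    then show ?L using True by (simp add: cinner_cls[symmetric])
  qed
  then show ?thesis using True by (simp add: spectral_integral_def assms eq)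
qed (auto simp: spectral_integral_def assms)

lemma q_id: "Complex (q (\<lambda>t. t) (x + y) - q (\<lambda>t. t) (x - y)) (q (\<lambda>t. t) (x + J y) - q (\<lambda>t. t) (x - J y))
    = 4 * cinner y (A x)"
proof -
  have "(rep x, rep (A x)) \<in> spectral_integral E (\<lambda>t. t)"
    unfolding A[symmetric] by (simp add: graph_def)
  then show ?thesis unfolding spectral_integral_iff[OF spectral_domains(1)] by simp
qed

text \<open>The scalar measure of the projected vector is that of \<open>x\<close> restricted to the
  open half-line, on which \<open>t\<close> and \<open>max t 0\<close> agree; elsewhere
  \<open>max t 0\<close> vanishes.\<close>

lemma q_positive_part: "q (\<lambda>t. max t 0) x = q (\<lambda>t. t) (Q {0<..} x)"
proof -
  let ?M = "scalar_measure E (rep x)" and ?S = "{0<..} :: real set"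
  have "scalar_measure E (rep (Q ?S x)) = density ?M (indicator ?S)"
  proof (rule measure_eqI)
    fix B assume "B \<in> sets (scalar_measure E (rep (Q ?S x)))"
    then have B: "B \<in> sets borel" "B \<inter> ?S \<in> sets borel" by auto
    have "emeasure (scalar_measure E (rep (Q ?S x))) B = ennreal (inner (Q ?S x) (Q B (Q ?S x)))"
      by (simp add: emeasure_scalar_measure B)
    also have "inner (Q ?S x) (Q B (Q ?S x)) = inner x (Q (?S \<inter> (B \<inter> ?S)) x)"
      by (simp add: inner_Q_symmetric Q_Int B)
    also have "?S \<inter> (B \<inter> ?S) = B \<inter> ?S" by auto
    also have "ennreal (inner x (Q (B \<inter> ?S) x)) = emeasure ?M (B \<inter> ?S)"
      by (simp add: emeasure_scalar_measure B)
    also have "\<dots> = emeasure (density ?M (indicator ?S)) B"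
      using B by (subst emeasure_density) (auto simp: indicator_inter_arith[symmetric] Int_commute nn_integral_indicator)
    finally show "emeasure (scalar_measure E (rep (Q ?S x))) B = emeasure (density ?M (indicator ?S)) B" .
  qed simp
  then have "q (\<lambda>t. t) (Q ?S x) = (LINT t|density ?M (\<lambda>t. ennreal (indicator ?S t)). t)"
    by (simp add: q_def ennreal_indicator)
  also have "\<dots> = (LINT t|?M. indicator ?S t *\<^sub>R t)"
    by (rule integral_density) auto
  also have "\<dots> = q (\<lambda>t. max t 0) x"
    unfolding q_def by (intro Bochner_Integration.integral_cong refl) (auto simp: indicator_def)
  finally show ?thesis ..
qed

text \<open>Polarization of \<open>q_positive_part\<close>: the positive part is \<open>A\<close>
  compressed to the range of the spectral projection of the open half-line.\<close>

lemma spectral_integral_positive_part: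
  "spectral_integral E (\<lambda>t. max t 0) = graph (\<lambda>x. Q {0<..} (A (Q {0<..} x)))"
proof -
  let ?Q = "Q {0<..}"
  have S: "{0 :: real<..} \<in> sets borel" by simp
  have eq: "Complex (q (\<lambda>t. max t 0) (x + y) - q (\<lambda>t. max t 0) (x - y))
      (q (\<lambda>t. max t 0) (x + J y) - q (\<lambda>t. max t 0) (x - J y)) = 4 * cinner y (?Q (A (?Q x)))" for x y
    unfolding q_positive_part Q_add[OF S] Q_diff[OF S] Q_J[OF S] q_id by (simp add: Q_symmetric)
  have "(\<forall>y. 4 * cinner y z = 4 * cinner y (?Q (A (?Q x)))) \<longleftrightarrow> ?Q (A (?Q x)) = z" for z x
    using cinner_eqI[of z "?Q (A (?Q x))"] by auto
  then have "(u, w) \<in> spectral_integral E (\<lambda>t. max t 0) \<longleftrightarrow> (u, w) \<in> graph (\<lambda>x. ?Q (A (?Q x)))" for u w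
    unfolding spectral_integral_iff[OF spectral_domains(2)] eq by (simp add: graph_def)
  then show ?thesis by auto
qed

end

section \<open>The trace bound\<close>

text \<open>The \<open>x n\<close> together with the \<open>J (x n)\<close> are orthonormal for the
  real inner product, and the squares of the two real coefficients belonging to \<open>j\<close> add
  up to the squared modulus.\<close>

lemma cinner_Bessel:
  fixes x :: "nat \<Rightarrow> 'n::finite l2"
  assumes I: "finite I" and x: "\<And>m n. cinner (x m) (x n) = (if m = n then 1 else 0)"
  shows "(\<Sum>j\<in>I. (cmod (cinner h (x j)))\<^sup>2) \<le> (norm h)\<^sup>2"
proof -
  define e where "e i = (if snd i then J (x (fst i)) else x (fst i))" for i :: "nat \<times> bool"
  have re: "inner (x m) (x n) = (if m = n then 1 else 0)" "inner (J (x m)) (x n) = 0" for m n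
    using x[of m n] by (auto simp: cinner_def complex_eq_iff split: if_splits)
  have im: "inner (x m) (J (x n)) = 0" for m n
    using inner_J_left[of "x m" "x n"] re(2) by simp
  have "(\<Sum>i\<in>I \<times> UNIV. (inner h (e i))\<^sup>2) \<le> (norm h)\<^sup>2"
    using I by (intro Bessel_real) (auto simp: e_def re im inner_J)
  also have "(\<Sum>i\<in>I \<times> UNIV. (inner h (e i))\<^sup>2) = (\<Sum>j\<in>I. (inner h (x j))\<^sup>2 + (inner h (J (x j)))\<^sup>2)"
  proof -
    have "(\<Sum>i\<in>I \<times> UNIV. (inner h (e i))\<^sup>2) = (\<Sum>j\<in>I. \<Sum>k\<in>UNIV. (inner h (e (j, k)))\<^sup>2)"
      by (simp add: sum.cartesian_product)
    then show ?thesis by (simp add: e_def UNIV_bool)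
  qed
  also have "\<dots> = (\<Sum>j\<in>I. (cmod (cinner h (x j)))\<^sup>2)"
    by (intro sum.cong refl) (simp add: cinner_def cmod_power2 inner_J_left)
  finally show ?thesis .
qed

text \<open>\<open>op_trace\<close> is a supremum of series with nonnegative terms, so a bound on
  the partial sums along every orthonormal sequence suffices. The choice in \<open>op_apply\<close>
  is determined up to a null set.\<close>

lemma op_trace_graph_le:
  fixes T :: "'n::finite l2 \<Rightarrow> 'n l2"
  assumes "\<And>(x :: nat \<Rightarrow> 'n l2) N. (\<And>m n. cinner (x m) (x n) = (if m = n then 1 else 0)) \<Longrightarrow>
    (\<Sum>n<N. ennreal (inner (x n) (T (x n)))) \<le> C"
  shows "op_trace (graph T) \<le> C"
  unfolding op_trace_def
proof (rule SUP_least)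
  fix e :: "nat \<Rightarrow> 'n wave" assume "e \<in> {e. orthonormal_basis e}"
  then have eL: "\<And>n. e n \<in> L2" and on: "\<And>m n. l2_inner (e m) (e n) = (if m = n then 1 else 0)"
    by (auto simp: orthonormal_basis_def)
  have G: "(u, rep (T (cls u))) \<in> graph T" if "u \<in> L2" for u
    using that by (simp add: graph_def)
  have ap: "op_apply (graph T) u \<in> L2 \<and> cls (op_apply (graph T) u) = T (cls u)" if "u \<in> L2" for u
    using someI[of "\<lambda>w. (u, w) \<in> graph T", OF G[OF that]] unfolding op_apply_def
    by (auto simp: graph_def)
  have "Re (l2_inner (e n) (op_apply (graph T) (e n))) = inner (cls (e n)) (T (cls (e n)))" for n
    using inner_cls[OF eL, of "op_apply (graph T) (e n)" n] ap[OF eL, of n] by simp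
  moreover have "(\<Sum>n. ennreal (inner (cls (e n)) (T (cls (e n))))) \<le> C"
    unfolding suminf_eq_SUP
    by (rule SUP_least, rule assms[of "\<lambda>n. cls (e n)"]) (simp add: cinner_cls eL on)
  moreover have "range e \<subseteq> Domain (graph T)" using G eL by blast
  ultimately show "(if range e \<subseteq> Domain (graph T)
      then (\<Sum>n. ennreal (Re (l2_inner (e n) (op_apply (graph T) (e n))))) else \<infinity>) \<le> C"
    by simp
qed

text \<open>The vectors \<open>z n\<close>, projections of an orthonormal sequence, form Bessel
  families, and a diagonal entry of the positive part is the squared norm of \<open>K (z n)\<close>
  minus \<mu> times that of \<open>z n\<close>. \<open>K_Bessel_le\<close> bounds exactly the sum of
  such terms.\<close>

theorem (in cwikel) op_trace_le:
  assumes \<mu>: "\<mu> > 0"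
  shows "op_trace (positive_part (op_minus_scalar (form_operator (cwikel_K a b)) \<mu>))
    \<le> ennreal (C0 * \<mu> powr (1 - p))"
proof -
  obtain G where form: "form_operator (cwikel_K a b) = graph G" and G: "discrete_op G"
    and GJ: "\<And>x. G (J x) = J (G x)" and quad: "\<And>x. inner x (G x) = (norm (K x))\<^sup>2"
    using form_operator_cwikel by blast
  define A where "A x = G x - \<mu> *\<^sub>R x" for x
  have H: "op_minus_scalar (form_operator (cwikel_K a b)) \<mu> = graph A"
    unfolding form op_minus_scalar_graph A_def ..
  have dA: "diagonal_op A"
    unfolding A_def by (rule discrete_op.diagonal_op_shift[OF G])
  have AJ: "A (J x) = J (A x)" for x
    by (simp add: A_def GJ J_diff J_scaleR)
  \<comment> \<open>Nothing but the axioms is known of this choice; the existence lemma ensures that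
    it satisfies them.\<close>
  define E where "E = spectral_measure (graph A)"
  have "projection_valued_measure E \<and> graph A = spectral_integral E (\<lambda>t. t)"
    unfolding E_def spectral_measure_def
    by (rule someI_ex[OF projection_valued_measure_exists[OF dA AJ]])
  then have E: "projection_valued_measure E" and EA: "graph A = spectral_integral E (\<lambda>t. t)" by auto
  let ?Q = "Q E {0<..}"
  have S: "{0 :: real<..} \<in> sets borel" by simp
  have T: "positive_part (graph A) = graph (\<lambda>x. ?Q (A (?Q x)))"
    unfolding positive_part_def fun_calculus_def E_def[symmetric]
    by (rule spectral_integral_positive_part[OF E EA])
  show ?thesis
    unfolding H T
  proof (rule op_trace_graph_le)
    fix x :: "nat \<Rightarrow> 'n l2" and m
    assume x: "\<And>m n. cinner (x m) (x n) = (if m = n then 1 else 0)"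
    define z where "z n = ?Q (x n)" for n
    have t: "inner (x n) (?Q (A (?Q (x n)))) = (norm (K (z n)))\<^sup>2 - \<mu> * (norm (z n))\<^sup>2" for n
      by (simp add: inner_Q_symmetric[OF E EA S, symmetric] z_def[symmetric] A_def inner_diff_right
          quad power2_norm_eq_inner)
    \<comment> \<open>Negative terms are truncated to 0 by \<^const>\<open>ennreal\<close>; a subfamily of a Bessel family is
      again one, so it suffices to sum over the others.\<close>
    define I where "I = {n. n < m \<and> 0 \<le> (norm (K (z n)))\<^sup>2 - \<mu> * (norm (z n))\<^sup>2}"
    have I: "finite I" by (simp add: I_def)
    have "Bessel I z"
      unfolding Bessel_def
    proof (intro conjI allI I)
      fix h
      have "(\<Sum>j\<in>I. (cmod (cinner h (z j)))\<^sup>2) = (\<Sum>j\<in>I. (cmod (cinner (?Q h) (x j)))\<^sup>2)"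
        by (simp add: z_def Q_symmetric[OF E EA S])
      also have "\<dots> \<le> (norm (?Q h))\<^sup>2" by (rule cinner_Bessel[OF I x])
      also have "\<dots> \<le> (norm h)\<^sup>2" by (intro power_mono norm_Q_le[OF E EA S]) auto
      finally show "(\<Sum>j\<in>I. (cmod (cinner h (z j)))\<^sup>2) \<le> (norm h)\<^sup>2" .
    qed
    have "(\<Sum>n<m. ennreal (inner (x n) (?Q (A (?Q (x n))))))
        = (\<Sum>n\<in>I. ennreal ((norm (K (z n)))\<^sup>2 - \<mu> * (norm (z n))\<^sup>2))"
      unfolding t by (rule sum.mono_neutral_right) (auto simp: I_def not_le intro!: ennreal_neg)
    also have "\<dots> = ennreal (\<Sum>n\<in>I. (norm (K (z n)))\<^sup>2 - \<mu> * (norm (z n))\<^sup>2)"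
      by (rule sum_ennreal) (simp add: I_def)
    also have "\<dots> \<le> ennreal (C0 * \<mu> powr (1 - p))"
      using K_Bessel_le[OF \<open>Bessel I z\<close> \<mu>]
      by (intro ennreal_leI) (simp add: sum_subtractf sum_distrib_left)
    finally show "(\<Sum>n<m. ennreal (inner (x n) (?Q (A (?Q (x n)))))) \<le> ennreal (C0 * \<mu> powr (1 - p))" .
  qed
qed

lemma position_op_cong:
  assumes "AE x in lebesgue. m x = m' x"
  shows "position_op m = position_op m'"
proof -
  have "(AE x in lebesgue. v x = complex_of_real (m x) * u x) \<longleftrightarrow> (AE x in lebesgue. v x = complex_of_real (m' x) * u x)"
    for u v :: "'a wave"
    using assms by (auto elim: eventually_elim2)
  then show ?thesis unfolding position_op_def by simp
qed

theorem theorem2p1: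
  fixes a b :: "real ^ 'n::finite \<Rightarrow> real" and p \<mu> :: real
  assumes "p > 1"
    and "a \<in> weak_Lp p" and "AE \<xi> in lebesgue. 0 \<le> a \<xi>"
    and "b \<in> Lp p" and "AE x in lebesgue. 0 \<le> b x"
    and "\<mu> > 0"
  shows "op_trace (positive_part (op_minus_scalar (form_operator (cwikel_K a b)) \<mu>))
    \<le> ennreal (\<mu> powr (- p + 1) * ((p + 1) powr (p - 1) / (p - 1) powr p)
        * (2 * pi) powr (- real CARD('n))
        * weak_Lp_norm p a powr p * Lp_norm p b powr p)"
proof -
  define N where "N = enn2real (weak_sup p a)"
  have am: "a \<in> borel_measurable lebesgue" and fin: "weak_sup p a < \<infinity>"
    using assms(2) by (auto simp: weak_Lp_def)
  have bm: "b \<in> borel_measurable lebesgue" and bi: "integrable lebesgue (\<lambda>x. \<bar>b x\<bar> powr p)"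
    using assms(4) by (auto simp: Lp_def)
  have N: "weak_sup p a = ennreal N" using fin by (simp add: N_def)
  \<comment> \<open>The supremum in \<open>weak_sup\<close> is estimated at the level \<tau> and
    solved for the measure of the level set.\<close>
  have weak: "emeasure lebesgue {\<xi>. \<tau> < \<bar>a \<xi>\<bar>} \<le> ennreal (N * \<tau> powr (- p))" if \<tau>: "\<tau> > 0" for \<tau>
  proof -
    let ?m = "emeasure lebesgue {\<xi>. \<tau> < \<bar>a \<xi>\<bar>}"
    have "ennreal (\<tau> powr p) * ?m \<le> ennreal N"
      unfolding N[symmetric] weak_sup_def using \<tau> by (intro SUP_upper) simp
    then have "ennreal (\<tau> powr (- p)) * (ennreal (\<tau> powr p) * ?m) \<le> ennreal (\<tau> powr (- p)) * ennreal N"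
      by (intro mult_left_mono) auto
    moreover have "ennreal (\<tau> powr (- p)) * ennreal (\<tau> powr p) = 1"
      using \<tau> by (simp flip: ennreal_mult powr_add)
    ultimately have "?m \<le> ennreal N * ennreal (\<tau> powr (- p))"
      by (simp add: mult.commute flip: mult.assoc)
    then show ?thesis by (simp add: N_def ennreal_mult)
  qed
  \<comment> \<open>The hypotheses give \<open>a\<close> and \<open>b\<close> nonnegative almost
    everywhere only. Absolute values meet the locale assumptions at every point and leave both
    multiplication operators unchanged.\<close>
  interpret cwikel "\<lambda>\<xi>. \<bar>a \<xi>\<bar>" "\<lambda>x. \<bar>b x\<bar>" p N
    by unfold_locales (use assms(1) am bm bi weak in \<open>auto simp: N_def\<close>)
  have "momentum_op (\<lambda>\<xi>. sqrt (a \<xi>)) = momentum_op (\<lambda>\<xi>. sqrt \<bar>a \<xi>\<bar>)"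
    unfolding momentum_op_def using assms(3)
    by (subst position_op_cong[of "\<lambda>\<xi>. sqrt (a \<xi>)" "\<lambda>\<xi>. sqrt \<bar>a \<xi>\<bar>"]) (auto elim: eventually_mono)
  moreover have "position_op (\<lambda>x. sqrt (b x)) = position_op (\<lambda>x. sqrt \<bar>b x\<bar>)"
    using assms(5) by (intro position_op_cong) (auto elim: eventually_mono)
  ultimately have "cwikel_K a b = cwikel_K (\<lambda>\<xi>. \<bar>a \<xi>\<bar>) (\<lambda>x. \<bar>b x\<bar>)"
    unfolding cwikel_K_def by simp
  moreover have "weak_Lp_norm p a powr p = N"
    using assms(1) N_nonneg by (simp add: weak_Lp_norm_def N_def[symmetric] powr_powr)
  moreover have "Lp_norm p b powr p = (LINT x|lebesgue. \<bar>b x\<bar> powr p)"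
    using assms(1) by (simp add: Lp_norm_def powr_powr)
  ultimately show ?thesis
    using op_trace_le[OF assms(6)] by (simp add: C0_def mult_ac add.commute)
qed

end
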